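(* Let $(H,\mu)$ be a countable locally standard measure algebra. Then $(H,\mu)$ is scalar equivalent to one of the following measure algebras: (i) $\mathbf{St}_n$ for some $n\in\mathbb{N}$; (ii) $H(\infty)\otimes H(s)$ for some Steinitz number $s$; (iii) $H(r,s)$ for some real number $r\in[1,\infty)$ and some infinite Steinitz number $s$; (iv) $H^{+}(r,s)$ for some real number $r\in[1,\infty)$ and some infinite Steinitz number $s$.
   Context: $\mathbb{N}$ is the set of positive integers. Boolean and measure algebras. A Boolean algebra is an associative commutative algebra over the field $\mathbf{F}_2$ of order $2$ (not necessarily with identity) satisfying $x^2=x$. A measure on a Boolean algebra $H$ is a function $\mu:H\to[0,\infty)$ such that $\mu(a)=0$ if and only if $a=0$, and $\mu(a+b)=\mu(a)+\mu(b)$ whenever $ab=0$. A measure algebra is a pair $(H,\mu)$ of a Boolean algebra and a measure on it. A measure subalgebra is a subalgebra (which need not share the identity of $H$) with the restricted measure. Two measure algebras $(H_1,\mu_1)$, $(H_2,\mu_2)$ are scalar equivalent if there are a real $\alpha>0$ and an isomorphism $\varphi:H_1\to H_2$ of Boolean algebras with $\mu_2(\varphi(a))=\alpha\mu_1(a)$ for all $a\in H_1$. $(H,\mu)$ is unital if $1\in H$ and $\mu(1)=1$. Standard algebras. For $n\ge1$, $\mathbf{St}_n=\mathbf{F}_2^n$ with measure $\mu_n(x_1,\dots,x_n)=\frac1n(x_1+\cdots+x_n)$, where $x_i\in\{0,1\}$ are added as integers. $(H,\mu)$ is locally standard if every finite subset of $H$ is contained in a measure subalgebra that is scalar equivalent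 to $\mathbf{St}_n$ for some $n\ge1$. Steinitz numbers. A Steinitz number is a formal product $\prod_{p}p^{r_p}$ over all primes $p$, with $r_p\in\{0,1,2,\dots\}\cup\{\infty\}$; multiplication adds exponents (with $\infty+k=\infty$). Positive integers are Steinitz numbers; the others are called infinite. $\Omega(s)$ is the set of positive integers dividing $s$. For $b\in\Omega(s)$, $s/b$ is obtained by subtracting exponents, with $\infty-k=\infty$. The least common multiple of a set of Steinitz numbers takes suprema of exponents. Tensor products. For measure algebras $(H_1,\mu_1)$, $(H_2,\mu_2)$, the Boolean algebra $H_1\otimes_{\mathbf{F}_2}H_2$ carries the unique measure $\mu$ with $\mu(a\otimes b)=\mu_1(a)\mu_2(b)$. An infinite tensor product of unital measure algebras is the union (direct limit) of the finite tensor products, under the embeddings $a\mapsto a\otimes1$. $H(s)$: write the Steinitz number $s$ as a product of primes $s=\prod_i p_i$, each prime repeated according to its (possibly infinite) exponent; then $H(s)=\bigotimes_i\mathbf{St}_{p_i}$ (with $H(1)=\mathbf{St}_1$). $H(\infty)$: the Boolean algebra of all finite subsets of a countably infinite set, including the empty set (addition is symmetric difference, multiplication is intersection), with measure the number of elements. $H(r,s)$ and $H^{+}(r,s)$: let $s$ be an infinite Steinitz number and $1\le r<\infty$ a real number. Choose $b_1,b_2,\dots\in\Omega(s)$ such that $b_i$ divides $b_{i+1}$ for all $i$, and $s$ is the least common multiple of the $b_i$. For $H(r,s)$ put $m_i=[rb_i]$ (integer part). For $H^+(r,s)$ put $m_i=[rb_i]$ if $rb_i\notin\mathbb{N}$ and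 $m_i=rb_i-1$ if $rb_i\in\mathbb{N}$ (indices with $m_i=0$, for which $\mathbf{St}_0$ is the zero algebra, may be discarded). Put $M_i=\mathbf{St}_{m_i}\otimes H(s/b_i)$. Since $H(s/b_i)\cong\mathbf{St}_{b_{i+1}/b_i}\otimes H(s/b_{i+1})$, one has $M_i\cong\mathbf{St}_{m_ib_{i+1}/b_i}\otimes H(s/b_{i+1})$, and $m_ib_{i+1}/b_i\le m_{i+1}$. Let $e_i=(1,\dots,1,0,\dots,0)\in\mathbf{St}_{m_{i+1}}$ with $m_ib_{i+1}/b_i$ ones. Then $M_i$ is identified with the corner $(e_i\otimes1)M_{i+1}$ of $M_{i+1}$, this identification respecting measures up to a positive scalar. The algebra $H(r,s)$ (respectively $H^+(r,s)$) is $\bigcup_iM_i$, with the measure (unique up to a positive scalar) whose restriction to each $M_i$ is a positive scalar multiple of the measure of $M_i$; for example, the one that restricts to $\frac{m_i}{b_i}$ times the unital measure of $M_i$. *)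

theory Defs
  imports
    "HOL-Algebra.Group"
    "HOL-Library.Z2"
    "HOL-Library.Poly_Mapping"
    "HOL-Library.Extended_Nat"
    "HOL-Library.Countable_Set"
    "HOL-Computational_Algebra.Primes"
    Complex_Main
begin

section \<open>Boolean algebras and measure algebras\<close>

text \<open>
  The ring structures of the distribution carry an identity, so non-unital Boolean algebras
  get their own record.
\<close>

record 'a bool_alg = "'a partial_object" +
  badd :: "'a \<Rightarrow> 'a \<Rightarrow> 'a"
  bmul :: "'a \<Rightarrow> 'a \<Rightarrow> 'a"
  bzero :: 'a

record 'a meas_alg = "'a bool_alg" +
  meas :: "'a \<Rightarrow> real"

text \<open>
  A ring is an algebra over the field of order 2 iff \<open>x + x = 0\<close> holds in it,
  and then the scalar multiplication is determined.
\<close>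

locale F2_boolean_algebra =
  fixes H :: "('a, 'm) bool_alg_scheme"
  assumes additive: "comm_group \<lparr>carrier = carrier H, monoid.mult = badd H, one = bzero H\<rparr>"
    and char_two: "x \<in> carrier H \<Longrightarrow> badd H x x = bzero H"
    and bmul_closed: "x \<in> carrier H \<Longrightarrow> y \<in> carrier H \<Longrightarrow> bmul H x y \<in> carrier H"
    and bmul_assoc: "x \<in> carrier H \<Longrightarrow> y \<in> carrier H \<Longrightarrow> z \<in> carrier H \<Longrightarrow>
          bmul H (bmul H x y) z = bmul H x (bmul H y z)"
    and bmul_comm: "x \<in> carrier H \<Longrightarrow> y \<in> carrier H \<Longrightarrow> bmul H x y = bmul H y x"
    and distrib: "x \<in> carrier H \<Longrightarrow> y \<in> carrier H \<Longrightarrow> z \<in> carrier H \<Longrightarrow>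
          bmul H (badd H x y) z = badd H (bmul H x z) (bmul H y z)"
    and idem: "x \<in> carrier H \<Longrightarrow> bmul H x x = x"

definition is_measure :: "('a, 'm) bool_alg_scheme \<Rightarrow> ('a \<Rightarrow> real) \<Rightarrow> bool" where
  "is_measure H \<mu> \<longleftrightarrow>
     (\<forall>a\<in>carrier H. 0 \<le> \<mu> a) \<and>
     (\<forall>a\<in>carrier H. \<mu> a = 0 \<longleftrightarrow> a = bzero H) \<and>
     (\<forall>a\<in>carrier H. \<forall>b\<in>carrier H. bmul H a b = bzero H \<longrightarrow> \<mu> (badd H a b) = \<mu> a + \<mu> b)"

locale measure_algebra = F2_boolean_algebra H for H :: "'a meas_alg" +
  assumes measure: "is_measure H (meas H)"

definition subalgebra :: "'a set \<Rightarrow> ('a, 'm) bool_alg_scheme \<Rightarrow> bool" where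
  "subalgebra S H \<longleftrightarrow> S \<subseteq> carrier H \<and> bzero H \<in> S \<and>
     (\<forall>x\<in>S. \<forall>y\<in>S. badd H x y \<in> S \<and> bmul H x y \<in> S)"

definition alg_iso :: "('a, 'm) bool_alg_scheme \<Rightarrow> ('b, 'n) bool_alg_scheme \<Rightarrow> ('a \<Rightarrow> 'b) \<Rightarrow> bool"
  where "alg_iso A B \<phi> \<longleftrightarrow> bij_betw \<phi> (carrier A) (carrier B) \<and>
     (\<forall>x\<in>carrier A. \<forall>y\<in>carrier A.
        \<phi> (badd A x y) = badd B (\<phi> x) (\<phi> y) \<and> \<phi> (bmul A x y) = bmul B (\<phi> x) (\<phi> y))"

definition scalar_iso :: "'a meas_alg \<Rightarrow> 'b meas_alg \<Rightarrow> ('a \<Rightarrow> 'b) \<Rightarrow> bool" where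
  "scalar_iso A B \<phi> \<longleftrightarrow> alg_iso A B \<phi> \<and>
     (\<exists>\<alpha>>0. \<forall>a\<in>carrier A. meas B (\<phi> a) = \<alpha> * meas A a)"

definition scalar_equivalent :: "'a meas_alg \<Rightarrow> 'b meas_alg \<Rightarrow> bool" where
  "scalar_equivalent A B \<longleftrightarrow> (\<exists>\<phi>. scalar_iso A B \<phi>)"

text \<open>Only meaningful if the algebra has an identity.\<close>

definition unit_of :: "('a, 'm) bool_alg_scheme \<Rightarrow> 'a" where
  "unit_of H = (THE u. u \<in> carrier H \<and> (\<forall>x\<in>carrier H. bmul H u x = x))"

definition corner :: "'a meas_alg \<Rightarrow> 'a \<Rightarrow> 'a meas_alg" where
  "corner H e = H\<lparr>carrier := bmul H e ` carrier H\<rparr>"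

definition scale_meas :: "real \<Rightarrow> 'a meas_alg \<Rightarrow> 'a meas_alg" where
  "scale_meas c H = H\<lparr>meas := \<lambda>x. c * meas H x\<rparr>"

section \<open>Standard algebras\<close>

text \<open>
  Vectors are functions vanishing from index \<open>n\<close> on.  For \<open>n = 0\<close> this is the zero algebra,
  with zero measure because \<open>x / 0 = 0\<close>.
\<close>

definition St :: "nat \<Rightarrow> (nat \<Rightarrow> bit) meas_alg" where
  "St n = \<lparr>carrier = {x. \<forall>i\<ge>n. x i = 0},
           badd = (\<lambda>x y i. x i + y i),
           bmul = (\<lambda>x y i. x i * y i),
           bzero = (\<lambda>i. 0),
           meas = (\<lambda>x. real (\<Sum>i<n. if x i = 1 then 1 else 0) / real n)\<rparr>"

definition locally_standard :: "'a meas_alg \<Rightarrow> bool" where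
  "locally_standard H \<longleftrightarrow>
     (\<forall>F. finite F \<and> F \<subseteq> carrier H \<longrightarrow>
        (\<exists>S n. subalgebra S H \<and> F \<subseteq> S \<and> n \<ge> 1 \<and> scalar_equivalent (H\<lparr>carrier := S\<rparr>) (St n)))"

section \<open>Steinitz numbers\<close>

typedef steinitz = "{r :: nat \<Rightarrow> enat. \<forall>p. \<not> prime p \<longrightarrow> r p = 0}"
  morphisms expo Abs_steinitz
  by (rule exI[of _ "\<lambda>_. 0"]) simp

setup_lifting type_definition_steinitz

instantiation steinitz :: comm_monoid_mult
begin

lift_definition one_steinitz :: steinitz is "\<lambda>_. 0" by simp

lift_definition times_steinitz :: "steinitz \<Rightarrow> steinitz \<Rightarrow> steinitz" is "\<lambda>r t p. r p + t p" by simp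

instance by standard (transfer; simp add: ac_simps fun_eq_iff)+

end

text \<open>Meaningful for positive arguments.\<close>

lift_definition steinitz_of_nat :: "nat \<Rightarrow> steinitz" is
  "\<lambda>n p. if prime p then enat (multiplicity p n) else 0" by simp

definition infinite_steinitz :: "steinitz \<Rightarrow> bool" where
  "infinite_steinitz s \<longleftrightarrow> (\<forall>n>0. s \<noteq> steinitz_of_nat n)"

definition Omega :: "steinitz \<Rightarrow> nat set" where
  "Omega s = {n. n > 0 \<and> steinitz_of_nat n dvd s}"

text \<open>Subtraction of extended naturals satisfies \<open>\<infinity> - k = \<infinity>\<close>.\<close>

lift_definition steinitz_div :: "steinitz \<Rightarrow> nat \<Rightarrow> steinitz" is
  "\<lambda>r b p. r p - (if prime p then enat (multiplicity p b) else 0)" by simp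

definition steinitz_Lcm :: "steinitz set \<Rightarrow> steinitz" where
  "steinitz_Lcm S = Abs_steinitz (\<lambda>p. SUP t\<in>S. expo t p)"

lemma expo_steinitz_Lcm: "expo (steinitz_Lcm S) p = (SUP t\<in>S. expo t p)"
proof -
  have "(SUP t\<in>S. expo t q) = 0" if "\<not> prime q" for q
  proof -
    have "expo t q = 0" for t
      using expo[of t] that by simp
    then show ?thesis
      by (metis SUP_least bot_enat_def bot.extremum_unique le_numeral_extra(3))
  qed
  then show ?thesis
    unfolding steinitz_Lcm_def by (subst Abs_steinitz_inverse) auto
qed

section \<open>Presented algebras over the field of order 2\<close>

text \<open>
  The type \<open>'g \<Rightarrow>\<^sub>0 bit\<close> is the vector space of formal sums of elements of \<open>'g\<close>.  A set \<open>G\<close> of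
  generators with a multiplication \<open>m\<close>, extended bilinearly to formal sums, is factored by the
  span of a set \<open>R\<close> of relations; elements of the quotient are cosets.
\<close>

definition gen :: "'g \<Rightarrow> ('g \<Rightarrow>\<^sub>0 bit)" where
  "gen g = Poly_Mapping.single g 1"

definition F2_span :: "('g \<Rightarrow>\<^sub>0 bit) set \<Rightarrow> ('g \<Rightarrow>\<^sub>0 bit) set" where
  "F2_span R = (\<lambda>N. 0 \<in> N \<and> (\<forall>x\<in>N. \<forall>y\<in>N. x + y \<in> N)) hull R"

definition coset :: "('g \<Rightarrow>\<^sub>0 bit) set \<Rightarrow> ('g \<Rightarrow>\<^sub>0 bit) \<Rightarrow> ('g \<Rightarrow>\<^sub>0 bit) set" where
  "coset N p = (\<lambda>q. p + q) ` N"

definition formal_mul ::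
  "('g \<Rightarrow> 'g \<Rightarrow> 'g) \<Rightarrow> ('g \<Rightarrow>\<^sub>0 bit) \<Rightarrow> ('g \<Rightarrow>\<^sub>0 bit) \<Rightarrow> ('g \<Rightarrow>\<^sub>0 bit)" where
  "formal_mul m p q = (\<Sum>g\<in>Poly_Mapping.keys p. \<Sum>h\<in>Poly_Mapping.keys q. gen (m g h))"

definition presented_alg ::
  "'g set \<Rightarrow> ('g \<Rightarrow> 'g \<Rightarrow> 'g) \<Rightarrow> ('g \<Rightarrow>\<^sub>0 bit) set \<Rightarrow> ('g \<Rightarrow>\<^sub>0 bit) set bool_alg" where
  "presented_alg G m R =
     \<lparr>carrier = coset (F2_span R) ` {p. Poly_Mapping.keys p \<subseteq> G},
      badd = (\<lambda>X Y. \<Union>p\<in>X. \<Union>q\<in>Y. coset (F2_span R) (p + q)),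
      bmul = (\<lambda>X Y. \<Union>p\<in>X. \<Union>q\<in>Y. coset (F2_span R) (formal_mul m p q)),
      bzero = F2_span R\<rparr>"

text \<open>
  Equips \<open>T\<close> with the unique measure whose value at \<open>e g\<close> is \<open>w g\<close> for all \<open>g \<in> G\<close>.
\<close>

definition with_measure ::
  "'t bool_alg \<Rightarrow> 'g set \<Rightarrow> ('g \<Rightarrow> 't) \<Rightarrow> ('g \<Rightarrow> real) \<Rightarrow> 't meas_alg" where
  "with_measure T G e w =
     \<lparr>carrier = carrier T, badd = badd T, bmul = bmul T, bzero = bzero T,
      meas = (THE \<mu>. \<mu> \<in> extensional (carrier T) \<and> is_measure T \<mu> \<and> (\<forall>g\<in>G. \<mu> (e g) = w g))\<rparr>"

section \<open>Tensor products\<close>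

definition tensor_rels ::
  "'a meas_alg \<Rightarrow> 'b meas_alg \<Rightarrow> ('a \<times> 'b \<Rightarrow>\<^sub>0 bit) set" where
  "tensor_rels A B =
     {gen (badd A a a', b) + gen (a, b) + gen (a', b) | a a' b.
        a \<in> carrier A \<and> a' \<in> carrier A \<and> b \<in> carrier B} \<union>
     {gen (a, badd B b b') + gen (a, b) + gen (a, b') | a b b'.
        a \<in> carrier A \<and> b \<in> carrier B \<and> b' \<in> carrier B}"

definition pure_tensor ::
  "'a meas_alg \<Rightarrow> 'b meas_alg \<Rightarrow> 'a \<Rightarrow> 'b \<Rightarrow> ('a \<times> 'b \<Rightarrow>\<^sub>0 bit) set" where
  "pure_tensor A B a b = coset (F2_span (tensor_rels A B)) (gen (a, b))"

definition tensor ::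
  "'a meas_alg \<Rightarrow> 'b meas_alg \<Rightarrow> ('a \<times> 'b \<Rightarrow>\<^sub>0 bit) set meas_alg" where
  "tensor A B =
     with_measure
       (presented_alg (carrier A \<times> carrier B)
          (\<lambda>(a, b) (a', b'). (bmul A a a', bmul B b b')) (tensor_rels A B))
       (carrier A \<times> carrier B)
       (\<lambda>(a, b). pure_tensor A B a b)
       (\<lambda>(a, b). meas A a * meas B b)"

text \<open>
  The tensor product of a finite family \<open>(A\<^sub>i)\<close>, \<open>i \<in> F\<close>, in one step: the family \<open>x\<close>, a member of
  \<open>\<Pi>\<^sub>E i\<in>F. carrier (A i)\<close>, generates the pure tensor of the \<open>x i\<close>, and the relations express
  additivity in each coordinate.  All finite subfamilies of a family thus give tensor products
  of the same type.
\<close>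

definition ftensor_rels :: "'i set \<Rightarrow> ('i \<Rightarrow> 'a meas_alg) \<Rightarrow> (('i \<Rightarrow> 'a) \<Rightarrow>\<^sub>0 bit) set" where
  "ftensor_rels F A =
     {gen (x(i := badd (A i) a b)) + gen (x(i := a)) + gen (x(i := b)) | x i a b.
        x \<in> (\<Pi>\<^sub>E j\<in>F. carrier (A j)) \<and> i \<in> F \<and> a \<in> carrier (A i) \<and> b \<in> carrier (A i)}"

definition ftensor ::
  "'i set \<Rightarrow> ('i \<Rightarrow> 'a meas_alg) \<Rightarrow> (('i \<Rightarrow> 'a) \<Rightarrow>\<^sub>0 bit) set meas_alg" where
  "ftensor F A =
     with_measure
       (presented_alg (\<Pi>\<^sub>E i\<in>F. carrier (A i))
          (\<lambda>x y. \<lambda>i\<in>F. bmul (A i) (x i) (y i)) (ftensor_rels F A))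
       (\<Pi>\<^sub>E i\<in>F. carrier (A i))
       (\<lambda>x. coset (F2_span (ftensor_rels F A)) (gen x))
       (\<lambda>x. \<Prod>i\<in>F. meas (A i) (x i))"

text \<open>
  For \<open>F \<subseteq> F'\<close>, the embedding \<open>a \<mapsto> a \<otimes> 1\<close> of the tensor product over \<open>F\<close> into the one over \<open>F'\<close>.
\<close>

definition ftensor_emb ::
  "('i \<Rightarrow> 'a meas_alg) \<Rightarrow> 'i set \<Rightarrow> 'i set \<Rightarrow>
     (('i \<Rightarrow> 'a) \<Rightarrow>\<^sub>0 bit) set \<Rightarrow> (('i \<Rightarrow> 'a) \<Rightarrow>\<^sub>0 bit) set" where
  "ftensor_emb A F F' X =
     (\<Union>p\<in>X. coset (F2_span (ftensor_rels F' A))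
        (\<Sum>x\<in>Poly_Mapping.keys p. gen (\<lambda>i\<in>F'. if i \<in> F then x i else unit_of (A i))))"

section \<open>Direct limits\<close>

text \<open>
  \<open>D\<close> is a directed set and \<open>\<phi> d e\<close>, for \<open>d \<le> e\<close>, are the transition maps, assumed to be
  compatible homomorphisms preserving measures.  The class of \<open>(d, x)\<close> consists of the pairs
  having the same image as \<open>x\<close> at some later index.
\<close>

definition lim_class ::
  "'d::order set \<Rightarrow> ('d \<Rightarrow> 'a meas_alg) \<Rightarrow> ('d \<Rightarrow> 'd \<Rightarrow> 'a \<Rightarrow> 'a) \<Rightarrow> 'd \<Rightarrow> 'a \<Rightarrow> ('d \<times> 'a) set" where
  "lim_class D A \<phi> d x =
     {(e, y). e \<in> D \<and> y \<in> carrier (A e) \<and> (\<exists>g\<in>D. d \<le> g \<and> e \<le> g \<and> \<phi> d g x = \<phi> e g y)}"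

definition dir_lim ::
  "'d::order set \<Rightarrow> ('d \<Rightarrow> 'a meas_alg) \<Rightarrow> ('d \<Rightarrow> 'd \<Rightarrow> 'a \<Rightarrow> 'a) \<Rightarrow> ('d \<times> 'a) set meas_alg" where
  "dir_lim D A \<phi> =
     \<lparr>carrier = {lim_class D A \<phi> d x | d x. d \<in> D \<and> x \<in> carrier (A d)},
      badd = (\<lambda>X Y. \<Union>(d, x)\<in>X. \<Union>(e, y)\<in>Y. \<Union>g\<in>{g \<in> D. d \<le> g \<and> e \<le> g}.
                lim_class D A \<phi> g (badd (A g) (\<phi> d g x) (\<phi> e g y))),
      bmul = (\<lambda>X Y. \<Union>(d, x)\<in>X. \<Union>(e, y)\<in>Y. \<Union>g\<in>{g \<in> D. d \<le> g \<and> e \<le> g}.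
                lim_class D A \<phi> g (bmul (A g) (\<phi> d g x) (\<phi> e g y))),
      bzero = (\<Union>d\<in>D. lim_class D A \<phi> d (bzero (A d))),
      meas = (\<lambda>X. THE c. \<exists>(d, x)\<in>X. c = meas (A d) x)\<rparr>"

text \<open>The tensor product of an arbitrary family of unital measure algebras.\<close>

definition inf_tensor ::
  "'i set \<Rightarrow> ('i \<Rightarrow> 'a meas_alg) \<Rightarrow> ('i set \<times> (('i \<Rightarrow> 'a) \<Rightarrow>\<^sub>0 bit) set) set meas_alg" where
  "inf_tensor I A = dir_lim {F. finite F \<and> F \<subseteq> I} (\<lambda>F. ftensor F A) (ftensor_emb A)"

section \<open>The algebras in the classification\<close>

text \<open>
  The prime factors of \<open>s\<close>, repeated according to their exponents, are indexed by the pairs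
  \<open>(p, k)\<close> with \<open>k\<close> less than the exponent of \<open>p\<close>.
\<close>

type_synonym Hs_elem =
  "((nat \<times> nat) set \<times> ((nat \<times> nat \<Rightarrow> nat \<Rightarrow> bit) \<Rightarrow>\<^sub>0 bit) set) set"

definition H_unital :: "steinitz \<Rightarrow> Hs_elem meas_alg" where
  "H_unital s = inf_tensor {(p, k). prime p \<and> enat k < expo s p} (\<lambda>(p, k). St p)"

definition H_infinity :: "nat set meas_alg" where
  "H_infinity = \<lparr>carrier = {X. finite X}, badd = sym_diff, bmul = (\<inter>), bzero = {},
                 meas = (\<lambda>X. real (card X))\<rparr>"

definition divisor_chain :: "steinitz \<Rightarrow> (nat \<Rightarrow> nat) \<Rightarrow> bool" where
  "divisor_chain s b \<longleftrightarrow> (\<forall>i. b i \<in> Omega s) \<and> (\<forall>i. b i dvd b (Suc i)) \<and>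
     s = steinitz_Lcm (range (\<lambda>i. steinitz_of_nat (b i)))"

text \<open>
  Below, \<open>m\<close> gives \<open>m\<^sub>i\<close> as a function of \<open>b\<^sub>i\<close>.  The indices with \<open>m\<^sub>i = 0\<close> are kept: there \<open>M\<^sub>i\<close> is the
  zero algebra, which contributes nothing to the union.
\<close>

type_synonym M_elem = "((nat \<Rightarrow> bit) \<times> Hs_elem \<Rightarrow>\<^sub>0 bit) set"

definition M_alg :: "steinitz \<Rightarrow> (nat \<Rightarrow> nat) \<Rightarrow> (nat \<Rightarrow> nat) \<Rightarrow> nat \<Rightarrow> M_elem meas_alg" where
  "M_alg s m b i = tensor (St (m (b i))) (H_unital (steinitz_div s (b i)))"

definition M_idem :: "steinitz \<Rightarrow> (nat \<Rightarrow> nat) \<Rightarrow> (nat \<Rightarrow> nat) \<Rightarrow> nat \<Rightarrow> M_elem" where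
  "M_idem s m b i =
     (let N = H_unital (steinitz_div s (b (Suc i)))
      in pure_tensor (St (m (b (Suc i)))) N
           (\<lambda>j. if j < m (b i) * (b (Suc i) div b i) then 1 else 0) (unit_of N))"

text \<open>
  The construction involves two choices, which do not affect the result up to scalar
  equivalence: the chain \<open>b\<close>, and the identifications \<open>f i\<close> of \<open>M\<^sub>i\<close> with a corner of \<open>M\<^sub>i\<^sub>+\<^sub>1\<close>,
  respecting measures up to a positive scalar.
  With the unital measure of \<open>M\<^sub>i\<close> scaled by \<open>m\<^sub>i / b\<^sub>i\<close> they preserve measures.
  Note that \<open>fold f [i..<j]\<close> is the composite of \<open>f i\<close>, \<dots>, \<open>f (j - 1)\<close>.
\<close>

definition H_limit ::
  "(nat \<Rightarrow> nat) \<Rightarrow> steinitz \<Rightarrow> (nat \<times> M_elem) set meas_alg" where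
  "H_limit m s =
     (let b = (SOME b. divisor_chain s b);
          f = (\<lambda>i. SOME g. scalar_iso (M_alg s m b i)
                             (corner (M_alg s m b (Suc i)) (M_idem s m b i)) g)
      in dir_lim UNIV
           (\<lambda>i. scale_meas (real (m (b i)) / real (b i)) (M_alg s m b i))
           (\<lambda>i j. fold f [i..<j]))"

definition H_rs :: "real \<Rightarrow> steinitz \<Rightarrow> (nat \<times> M_elem) set meas_alg" where
  "H_rs r s = H_limit (\<lambda>b. nat \<lfloor>r * real b\<rfloor>) s"

definition H_plus_rs :: "real \<Rightarrow> steinitz \<Rightarrow> (nat \<times> M_elem) set meas_alg" where
  "H_plus_rs r s =
     H_limit (\<lambda>b. if r * real b \<in> \<nat> then nat \<lfloor>r * real b\<rfloor> - 1 else nat \<lfloor>r * real b\<rfloor>) s"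

end

theory Submission
  imports Defs "HOL-Algebra.FiniteProduct"
begin

text \<open>
  The proof rests on one invariant, the set \<open>values H\<close> of the measures of the elements of \<open>H\<close>. Two
  countable locally standard measure algebras whose sets of values agree up to a positive scalar are
  scalar equivalent (\<open>scalar_iso_if_same_values\<close>). This is a back-and-forth argument: any finitely many
  elements lie in a subalgebra whose atoms have equal measure, called a chart below. An isomorphism
  between charts of two algebras can be extended to one more element, because the values say that
  the second algebra has charts that are fine enough and large enough to copy the refinement
  (\<open>matching_extend\<close>).

  It remains to compare values. In a chart with atoms of measure \<open>c\<close> the values are the first
  multiples of \<open>c\<close>. Once some value has been scaled to \<open>1\<close>, the masses \<open>c\<close> of the atoms of the
  charts containing it are of the form \<open>1 / b\<close>, where \<open>b\<close> runs through numbers that belong to a Steinitz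
  number \<open>s\<close>, and the set of values is an initial segment of the fractions whose denominators divide
  \<open>s\<close> (\<open>initial_segment_of_fractions\<close>). Such a segment is unbounded, or has a supremum \<open>r \<ge> 1\<close> which is
  attained or not; a bounded segment is finite if \<open>s\<close> is (\<open>values_cases\<close>). These possibilities are the
  values of \<open>H_infinity \<otimes> H(s)\<close>, \<open>H(r, s)\<close>, \<open>H\<^sup>+(r, s)\<close> and \<open>St n\<close>.

  To see this, the algebras of the classification, which are quotients of spaces of formal sums and
  direct limits of such, have to be recognised as countable measure algebras with enough charts. A
  presented algebra is isomorphic to any concrete algebra in which generators can be evaluated and
  elements have normal forms (locale \<open>presentation\<close>). The tensor product of \<open>B\<close> with a standard
  algebra or with \<open>H_infinity\<close> becomes an algebra of finitely supported functions with values in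
  \<open>B\<close>, and a finite tensor product of standard algebras becomes the algebra of subsets of a grid, whose
  embeddings into larger tensor products form cylinders. Charts pass to direct limits. In the definition
  of \<open>H(r, s)\<close> and \<open>H\<^sup>+(r, s)\<close> the identifications of a stage with a corner of the next one are
  arbitrary; that there are any is another instance of the comparison of values (\<open>M_iso_corner\<close>).
\<close>

section \<open>Boolean algebras over the field of order 2\<close>

abbreviation add_group :: "('a, 'm) bool_alg_scheme \<Rightarrow> 'a monoid" where
  "add_group H \<equiv> \<lparr>carrier = carrier H, monoid.mult = badd H, one = bzero H\<rparr>"

lemma F2_boolean_algebraI:
  assumes "bzero H \<in> carrier H"
    and "\<And>x y. x \<in> carrier H \<Longrightarrow> y \<in> carrier H \<Longrightarrow> badd H x y \<in> carrier H"
    and "\<And>x y. x \<in> carrier H \<Longrightarrow> y \<in> carrier H \<Longrightarrow> bmul H x y \<in> carrier H"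
    and "\<And>x. x \<in> carrier H \<Longrightarrow> badd H (bzero H) x = x"
    and "\<And>x. x \<in> carrier H \<Longrightarrow> badd H x x = bzero H"
    and "\<And>x y. x \<in> carrier H \<Longrightarrow> y \<in> carrier H \<Longrightarrow> badd H x y = badd H y x"
    and "\<And>x y z. x \<in> carrier H \<Longrightarrow> y \<in> carrier H \<Longrightarrow> z \<in> carrier H \<Longrightarrow>
           badd H (badd H x y) z = badd H x (badd H y z)"
    and "\<And>x y. x \<in> carrier H \<Longrightarrow> y \<in> carrier H \<Longrightarrow> bmul H x y = bmul H y x"
    and "\<And>x y z. x \<in> carrier H \<Longrightarrow> y \<in> carrier H \<Longrightarrow> z \<in> carrier H \<Longrightarrow>
           bmul H (bmul H x y) z = bmul H x (bmul H y z)"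
    and "\<And>x y z. x \<in> carrier H \<Longrightarrow> y \<in> carrier H \<Longrightarrow> z \<in> carrier H \<Longrightarrow>
           bmul H (badd H x y) z = badd H (bmul H x z) (bmul H y z)"
    and "\<And>x. x \<in> carrier H \<Longrightarrow> bmul H x x = x"
  shows "F2_boolean_algebra H"
proof (rule F2_boolean_algebra.intro)
  show "comm_group (add_group H)"
  proof (rule comm_groupI)
    show "\<exists>y\<in>carrier (add_group H). y \<otimes>\<^bsub>add_group H\<^esub> x = \<one>\<^bsub>add_group H\<^esub>"
      if "x \<in> carrier (add_group H)" for x
      using that assms(5) by auto
  qed (use assms(1-7) in simp_all)
qed (use assms(3,5,8-11) in \<open>simp_all\<close>)

context F2_boolean_algebra
begin

sublocale add: comm_group "add_group H"
  rewrites "carrier (add_group H) = carrier H"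
    and "monoid.mult (add_group H) = badd H"
    and "one (add_group H) = bzero H"
  by (simp_all add: additive)

lemma add_cancel: "x \<in> carrier H \<Longrightarrow> y \<in> carrier H \<Longrightarrow> badd H x (badd H x y) = y"
  by (metis add.m_assoc add.l_one char_two)

lemma add_eq_zero: "x \<in> carrier H \<Longrightarrow> y \<in> carrier H \<Longrightarrow> badd H x y = bzero H \<longleftrightarrow> x = y"
  by (metis add_cancel add.r_one char_two)

lemma zero_mul: "x \<in> carrier H \<Longrightarrow> bmul H (bzero H) x = bzero H"
  by (metis bmul_closed char_two distrib)

lemma mul_zero: "x \<in> carrier H \<Longrightarrow> bmul H x (bzero H) = bzero H"
  using zero_mul bmul_comm by fastforce

lemma distrib_left:
  "x \<in> carrier H \<Longrightarrow> y \<in> carrier H \<Longrightarrow> z \<in> carrier H \<Longrightarrow>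
    bmul H z (badd H x y) = badd H (bmul H z x) (bmul H z y)"
  using distrib bmul_comm add.m_closed by metis

lemma mul_left_idem: "x \<in> carrier H \<Longrightarrow> y \<in> carrier H \<Longrightarrow> bmul H x (bmul H x y) = bmul H x y"
  by (metis bmul_assoc idem)

definition bsum :: "('i \<Rightarrow> 'a) \<Rightarrow> 'i set \<Rightarrow> 'a" where
  "bsum f A = finprod (add_group H) f A"

lemma bsum_empty [simp]: "bsum f {} = bzero H"
  by (simp add: bsum_def)

lemma bsum_closed: "(\<And>x. x \<in> A \<Longrightarrow> f x \<in> carrier H) \<Longrightarrow> bsum f A \<in> carrier H"
  unfolding bsum_def using add.finprod_closed by (auto simp: Pi_def)

lemma bsum_insert:
  "finite A \<Longrightarrow> a \<notin> A \<Longrightarrow> (\<And>x. x \<in> insert a A \<Longrightarrow> f x \<in> carrier H) \<Longrightarrow>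
    bsum f (insert a A) = badd H (f a) (bsum f A)"
  unfolding bsum_def by (rule add.finprod_insert) auto

end

lemma is_measureD:
  assumes "is_measure H \<mu>"
  shows "a \<in> carrier H \<Longrightarrow> 0 \<le> \<mu> a"
    and "a \<in> carrier H \<Longrightarrow> \<mu> a = 0 \<longleftrightarrow> a = bzero H"
    and "a \<in> carrier H \<Longrightarrow> b \<in> carrier H \<Longrightarrow> bmul H a b = bzero H \<Longrightarrow> \<mu> (badd H a b) = \<mu> a + \<mu> b"
  using assms unfolding is_measure_def by blast+

context measure_algebra
begin

lemmas meas_nonneg = is_measureD(1)[OF measure]
lemmas meas_eq_zero = is_measureD(2)[OF measure]
lemmas meas_add = is_measureD(3)[OF measure]

lemma meas_zero [simp]: "meas H (bzero H) = 0"
  using meas_eq_zero[of "bzero H"] by simp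

lemma meas_split:
  assumes "x \<in> carrier H" "y \<in> carrier H"
  shows "meas H x = meas H (bmul H y x) + meas H (badd H x (bmul H y x))"
proof -
  have m: "bmul H y x \<in> carrier H" using assms bmul_closed by blast
  have "bmul H (bmul H y x) (badd H x (bmul H y x)) = bzero H"
  proof -
    have "bmul H (bmul H y x) x = bmul H y x" using assms by (metis bmul_assoc idem)
    moreover have "bmul H (bmul H y x) (bmul H y x) = bmul H y x" using idem[OF m] .
    ultimately show ?thesis using distrib_left[OF assms(1) m m] char_two[OF m] by metis
  qed
  from meas_add[OF m _ this] show ?thesis
    using add_cancel[OF m assms(1)] add.m_comm[OF m assms(1)] m assms(1) by simp
qed

text \<open>An element of largest measure is an identity, since it leaves no room outside itself.\<close>

lemma unit_of_eq:
  assumes u: "u \<in> carrier H" and max: "\<And>x. x \<in> carrier H \<Longrightarrow> meas H x \<le> meas H u"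
  shows "unit_of H = u"
    and "\<And>x. x \<in> carrier H \<Longrightarrow> bmul H u x = x"
proof -
  show id: "bmul H u x = x" if x: "x \<in> carrier H" for x
  proof -
    have m: "bmul H u x \<in> carrier H" and d: "badd H x (bmul H u x) \<in> carrier H"
      using u x bmul_closed by auto
    have "bmul H u (badd H x (bmul H u x)) = bzero H"
      using distrib_left[OF x m u] mul_left_idem[OF u x] char_two[OF m] by simp
    from meas_add[OF u d this] have "meas H (badd H x (bmul H u x)) \<le> 0"
      using max[of "badd H u (badd H x (bmul H u x))"] u d by auto
    then have "badd H x (bmul H u x) = bzero H"
      using meas_nonneg[OF d] meas_eq_zero[OF d] by simp
    then show ?thesis using add_eq_zero[OF x m] by simp
  qed
  show "unit_of H = u"
    unfolding unit_of_def
  proof (rule the_equality)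
    show "u \<in> carrier H \<and> (\<forall>x\<in>carrier H. bmul H u x = x)" using u id by blast
    show "v = u" if "v \<in> carrier H \<and> (\<forall>x\<in>carrier H. bmul H v x = x)" for v
      using that u id bmul_comm by metis
  qed
qed

end

section \<open>Charts\<close>

text \<open>
  A chart is a copy, inside a measure algebra, of the algebra of all subsets of an index set in
  which every point has the same mass; with a finite nonempty index set its image is a measure
  subalgebra that is scalar equivalent to a standard algebra.
\<close>

definition chart :: "'a meas_alg \<Rightarrow> 'i set \<Rightarrow> real \<Rightarrow> ('i set \<Rightarrow> 'a) \<Rightarrow> bool" where
  "chart H I c \<psi> \<longleftrightarrow> c > 0 \<and>
     (\<forall>X\<subseteq>I. \<psi> X \<in> carrier H \<and> meas H (\<psi> X) = c * real (card X)) \<and>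
     (\<forall>X\<subseteq>I. \<forall>Y\<subseteq>I. badd H (\<psi> X) (\<psi> Y) = \<psi> (sym_diff X Y) \<and>
                   bmul H (\<psi> X) (\<psi> Y) = \<psi> (X \<inter> Y))"

lemma chartD:
  assumes "chart H I c \<psi>"
  shows "c > 0"
    and "X \<subseteq> I \<Longrightarrow> \<psi> X \<in> carrier H"
    and "X \<subseteq> I \<Longrightarrow> meas H (\<psi> X) = c * real (card X)"
    and "X \<subseteq> I \<Longrightarrow> Y \<subseteq> I \<Longrightarrow> badd H (\<psi> X) (\<psi> Y) = \<psi> (sym_diff X Y)"
    and "X \<subseteq> I \<Longrightarrow> Y \<subseteq> I \<Longrightarrow> bmul H (\<psi> X) (\<psi> Y) = \<psi> (X \<inter> Y)"
  using assms unfolding chart_def by blast+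

lemma chart_inj:
  assumes "chart H I c \<psi>" "finite I" "measure_algebra H" "X \<subseteq> I" "Y \<subseteq> I" "\<psi> X = \<psi> Y"
  shows "X = Y"
proof -
  interpret measure_algebra H by fact
  have "\<psi> (sym_diff X Y) = bzero H"
    using chartD(2,4)[OF assms(1)] assms char_two by metis
  then have "c * real (card (sym_diff X Y)) = 0"
    using chartD(3)[OF assms(1), of "sym_diff X Y"] assms(4,5) meas_zero by force
  then have "card (sym_diff X Y) = 0"
    using chartD(1)[OF assms(1)] by simp
  moreover have "finite (sym_diff X Y)"
    using assms(2,4,5) by (meson finite_Diff finite_UnI finite_subset)
  ultimately show ?thesis by auto
qed

lemma chart_empty:
  assumes "chart H I c \<psi>" "measure_algebra H"
  shows "\<psi> {} = bzero H"
proof -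
  interpret measure_algebra H by fact
  show ?thesis using chartD(2,3)[OF assms(1), of "{}"] meas_eq_zero by simp
qed

lemma chart_zero:
  assumes "measure_algebra H" "c > 0"
  shows "chart H {} c (\<lambda>_. bzero H)"
proof -
  interpret measure_algebra H by fact
  show ?thesis using assms(2) by (simp add: chart_def zero_mul)
qed

text \<open>
  Coarsening a fine chart is how the charts of two algebras are fitted to each other. The points
  outside all blocks are dropped, so that with blocks of size one this also covers renaming the
  points and restricting to a subset.
\<close>

lemma chart_blocks:
  assumes ch: "chart H J d \<chi>" and "finite I" "finite J" "l > 0"
    and W: "\<And>i. i \<in> I \<Longrightarrow> W i \<subseteq> J" "\<And>i. i \<in> I \<Longrightarrow> card (W i) = l"
    and disj: "\<And>i j. i \<in> I \<Longrightarrow> j \<in> I \<Longrightarrow> i \<noteq> j \<Longrightarrow> W i \<inter> W j = {}"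
  shows "chart H I (d * real l) (\<lambda>X. \<chi> (\<Union>i\<in>X. W i))"
proof -
  have sub: "(\<Union>i\<in>X. W i) \<subseteq> J" if "X \<subseteq> I" for X
    using W(1) that by blast
  have sym: "sym_diff (\<Union>i\<in>X. W i) (\<Union>i\<in>Y. W i) = (\<Union>i\<in>sym_diff X Y. W i)"
    if "X \<subseteq> I" "Y \<subseteq> I" for X Y
    using that disj by blast
  have int: "(\<Union>i\<in>X. W i) \<inter> (\<Union>i\<in>Y. W i) = (\<Union>i\<in>X \<inter> Y. W i)"
    if "X \<subseteq> I" "Y \<subseteq> I" for X Y
    using that disj by blast
  have "card (\<Union>i\<in>X. W i) = l * card X" if "X \<subseteq> I" for X
  proof -
    have "card (\<Union>i\<in>X. W i) = (\<Sum>i\<in>X. card (W i))"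
    proof (rule card_UN_disjoint)
      show "finite X" using that \<open>finite I\<close> finite_subset by blast
      show "\<forall>i\<in>X. finite (W i)" using that W(1) \<open>finite J\<close> finite_subset by blast
      show "\<forall>i\<in>X. \<forall>j\<in>X. i \<noteq> j \<longrightarrow> W i \<inter> W j = {}" using that disj by blast
    qed
    also have "\<dots> = l * card X"
      using that W(2) by (simp add: subset_iff)
    finally show ?thesis .
  qed
  then show ?thesis
    unfolding chart_def using sub sym int chartD[OF ch] \<open>l > 0\<close>
    by (auto simp: mult.assoc)
qed

lemma chart_rename:
  assumes "chart H J d \<chi>" "finite J" "bij_betw f I J"
  shows "chart H I d (\<lambda>X. \<chi> (f ` X))"
proof -
  have "chart H I (d * real 1) (\<lambda>X. \<chi> (\<Union>i\<in>X. {f i}))"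
    using assms(3) bij_betw_finite[OF assms(3)] assms(2)
    by (intro chart_blocks[OF assms(1)]) (auto simp: bij_betw_def inj_on_def)
  moreover have "(\<Union>i\<in>X. {f i}) = f ` X" for X by auto
  ultimately show ?thesis by simp
qed

definition scaling_hom :: "'a meas_alg \<Rightarrow> 'b meas_alg \<Rightarrow> real \<Rightarrow> ('a \<Rightarrow> 'b) \<Rightarrow> bool" where
  "scaling_hom A B \<alpha> \<phi> \<longleftrightarrow> (\<forall>x\<in>carrier A. \<phi> x \<in> carrier B \<and> meas B (\<phi> x) = \<alpha> * meas A x) \<and>
     (\<forall>x\<in>carrier A. \<forall>y\<in>carrier A.
        \<phi> (badd A x y) = badd B (\<phi> x) (\<phi> y) \<and> \<phi> (bmul A x y) = bmul B (\<phi> x) (\<phi> y))"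

lemma scaling_homD:
  assumes "scaling_hom A B \<alpha> \<phi>" and "x \<in> carrier A"
  shows "\<phi> x \<in> carrier B" and "meas B (\<phi> x) = \<alpha> * meas A x"
    and "y \<in> carrier A \<Longrightarrow> \<phi> (badd A x y) = badd B (\<phi> x) (\<phi> y)"
    and "y \<in> carrier A \<Longrightarrow> \<phi> (bmul A x y) = bmul B (\<phi> x) (\<phi> y)"
  using assms unfolding scaling_hom_def by blast+

lemma chart_image:
  assumes "chart A I c \<psi>" "scaling_hom A B \<alpha> \<phi>" "\<alpha> > 0"
  shows "chart B I (\<alpha> * c) (\<lambda>X. \<phi> (\<psi> X))"
  unfolding chart_def
proof (intro conjI allI impI)
  fix X Y assume XY: "X \<subseteq> I" "Y \<subseteq> I"
  note ops = chartD(4,5)[OF assms(1) XY] chartD(2)[OF assms(1) XY(1)] chartD(2)[OF assms(1) XY(2)]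
  show "badd B (\<phi> (\<psi> X)) (\<phi> (\<psi> Y)) = \<phi> (\<psi> (sym_diff X Y))"
    using scaling_homD(3)[OF assms(2)] ops by metis
  show "bmul B (\<phi> (\<psi> X)) (\<phi> (\<psi> Y)) = \<phi> (\<psi> (X \<inter> Y))"
    using scaling_homD(4)[OF assms(2)] ops by metis
qed (use chartD(1-3)[OF assms(1)] scaling_homD(1,2)[OF assms(2)] assms(3) in \<open>auto simp: mult.assoc\<close>)

text \<open>
  The set \<open>\<Gamma>\<close> records, as pairs of a number of points and the mass of a point, a family of charts
  that is cofinal; it makes the values of the measure computable without reference to elements.
\<close>

definition charted :: "'a meas_alg \<Rightarrow> (nat \<times> real) set \<Rightarrow> bool" where
  "charted H \<Gamma> \<longleftrightarrow>
     (\<forall>F. finite F \<and> F \<subseteq> carrier H \<longrightarrow>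
        (\<exists>n c \<psi>. (n, c) \<in> \<Gamma> \<and> chart H {..<n} c \<psi> \<and> F \<subseteq> \<psi> ` Pow {..<n})) \<and>
     (\<forall>n c. (n, c) \<in> \<Gamma> \<longrightarrow> (\<exists>\<psi>. chart H {..<n} c \<psi>))"

lemma charted_cover:
  assumes "charted H \<Gamma>" "finite F" "F \<subseteq> carrier H"
  obtains n c \<psi> where "(n, c) \<in> \<Gamma>" "chart H {..<n} c \<psi>" "F \<subseteq> \<psi> ` Pow {..<n}"
proof -
  have "\<exists>n c \<psi>. (n, c) \<in> \<Gamma> \<and> chart H {..<n} c \<psi> \<and> F \<subseteq> \<psi> ` Pow {..<n}"
    using conjunct1[OF assms(1)[unfolded charted_def]] assms(2,3) by iprover
  then show ?thesis using that by (elim exE conjE)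
qed

lemma charted_realised:
  assumes "charted H \<Gamma>" "(n, c) \<in> \<Gamma>"
  shows "\<exists>\<psi>. chart H {..<n} c \<psi>"
  using conjunct2[OF assms(1)[unfolded charted_def]] assms(2) by iprover

abbreviation "values" :: "'a meas_alg \<Rightarrow> real set" where
  "values H \<equiv> meas H ` carrier H"

lemma chart_values:
  assumes "chart H {..<n} c \<psi>" "k \<le> n"
  shows "c * real k \<in> values H"
proof -
  have "\<psi> {..<k} \<in> carrier H" "meas H (\<psi> {..<k}) = c * real k"
    using chartD(2,3)[OF assms(1), of "{..<k}"] assms(2) by simp_all
  then show ?thesis by force
qed

lemma values_charted:
  assumes "charted H \<Gamma>"
  shows "values H = {c * real k | n c k. (n, c) \<in> \<Gamma> \<and> k \<le> n}"
proof (intro equalityI subsetI)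
  fix v assume "v \<in> values H"
  then obtain h where h: "h \<in> carrier H" "v = meas H h" by blast
  obtain n c \<psi> where *: "(n, c) \<in> \<Gamma>" "chart H {..<n} c \<psi>" "{h} \<subseteq> \<psi> ` Pow {..<n}"
    using charted_cover[OF assms, of "{h}"] h(1) by blast
  then obtain X where X: "X \<subseteq> {..<n}" "h = \<psi> X" by blast
  then have "v = c * real (card X)" using h(2) chartD(3)[OF *(2)] by blast
  moreover have "card X \<le> n" using X(1) by (metis card_lessThan card_mono finite_lessThan)
  ultimately show "v \<in> {c * real k | n c k. (n, c) \<in> \<Gamma> \<and> k \<le> n}" using *(1) by blast
next
  fix v assume "v \<in> {c * real k | n c k. (n, c) \<in> \<Gamma> \<and> k \<le> n}"
  then obtain n c k where *: "v = c * real k" "(n, c) \<in> \<Gamma>" "k \<le> n" by blast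
  then obtain \<psi> where "chart H {..<n} c \<psi>" using charted_realised[OF assms] by blast
  then show "v \<in> values H" using chart_values *(1,3) by blast
qed

lemma charted_UNIV:
  assumes "\<And>F. finite F \<Longrightarrow> F \<subseteq> carrier H \<Longrightarrow>
             \<exists>n c \<psi>. chart H {..<n::nat} c \<psi> \<and> F \<subseteq> \<psi> ` Pow {..<n}"
  shows "charted H {(n, c). \<exists>\<psi>. chart H {..<n} c \<psi>}"
  unfolding charted_def
proof (intro conjI allI impI)
  fix F assume "finite F \<and> F \<subseteq> carrier H"
  then obtain n :: nat and c \<psi> where "chart H {..<n} c \<psi>" "F \<subseteq> \<psi> ` Pow {..<n}"
    using assms[of F] by auto
  then show "\<exists>n c \<psi>. (n, c) \<in> {(n::nat, c). \<exists>\<psi>. chart H {..<n} c \<psi>} \<and> chart H {..<n} c \<psi> \<and> F \<subseteq> \<psi> ` Pow {..<n}"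
    by (intro exI[of _ n] exI[of _ c] exI[of _ \<psi>]) auto
qed auto

section \<open>A charted algebra is determined by its values\<close>

lemma disjoint_blocks:
  assumes "finite A" "finite B" "l * card A \<le> card B"
  shows "\<exists>W. (\<forall>j\<in>A. W j \<subseteq> B \<and> card (W j) = l) \<and>
             (\<forall>i\<in>A. \<forall>j\<in>A. i \<noteq> j \<longrightarrow> W i \<inter> W j = {})"
  using assms
proof (induction A arbitrary: B rule: finite_induct)
  case empty
  then show ?case by simp
next
  case (insert a A)
  have "l \<le> card B" using insert by simp
  then obtain C where C: "C \<subseteq> B" "card C = l" 
    using obtain_subset_with_card_n by metis
  have "card (B - C) = card B - l"
    using C insert.prems(1) by (metis card_Diff_subset finite_subset)
  then have "l * card A \<le> card (B - C)" using insert by simp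
  then obtain W where W: "\<forall>j\<in>A. W j \<subseteq> B - C \<and> card (W j) = l"
      "\<forall>i\<in>A. \<forall>j\<in>A. i \<noteq> j \<longrightarrow> W i \<inter> W j = {}"
    using insert.IH[of "B - C"] insert.prems(1) by blast
  have "(\<forall>j\<in>insert a A. (W(a := C)) j \<subseteq> B \<and> card ((W(a := C)) j) = l)"
    using W(1) C by auto
  moreover have "(W(a := C)) i \<inter> (W(a := C)) j = {}"
    if ij: "i \<in> insert a A" "j \<in> insert a A" "i \<noteq> j" for i j
  proof (cases "i = a \<or> j = a")
    case True
    then show ?thesis using W(1) ij by auto
  next
    case False
    then show ?thesis using W(2) ij by auto
  qed
  ultimately show ?case by blast
qed

text \<open>
  Both parts of the choice are a matter of counting: \<open>B i\<close> has exactly the size of \<open>card (A i)\<close>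
  blocks, so the blocks chosen inside it exhaust it, and what is left of \<open>Y\<close> has room for the
  blocks of the remaining points of \<open>X\<close>. For charts this says that the way one finite subalgebra
  sits inside a finer one can be copied wherever the sizes permit.
\<close>

lemma compatible_blocks:
  assumes fin: "finite I" "finite Y" and "finite (X :: 'x set)"
    and A: "\<And>i. i \<in> I \<Longrightarrow> A i \<subseteq> X" "\<And>i j. i \<in> I \<Longrightarrow> j \<in> I \<Longrightarrow> i \<noteq> j \<Longrightarrow> A i \<inter> A j = {}"
    and B: "\<And>i. i \<in> I \<Longrightarrow> B i \<subseteq> Y" "\<And>i j. i \<in> I \<Longrightarrow> j \<in> I \<Longrightarrow> i \<noteq> j \<Longrightarrow> B i \<inter> B j = {}"
    and card: "\<And>i. i \<in> I \<Longrightarrow> card (B i) = l * card (A i)"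
    and room: "l * card X \<le> card Y"
  obtains W where "\<And>j. j \<in> X \<Longrightarrow> W j \<subseteq> Y" "\<And>j. j \<in> X \<Longrightarrow> card (W j) = l"
    and "\<And>i j. i \<in> X \<Longrightarrow> j \<in> X \<Longrightarrow> i \<noteq> j \<Longrightarrow> W i \<inter> W j = {}"
    and "\<And>i. i \<in> I \<Longrightarrow> (\<Union>j\<in>A i. W j) = B i"
proof -
  have finA: "finite (A i)" and finB: "finite (B i)" if "i \<in> I" for i
    using finite_subset[OF A(1)[OF that] assms(3)] finite_subset[OF B(1)[OF that] fin(2)] .
  have "\<exists>W. (\<forall>j\<in>A i. W j \<subseteq> B i \<and> card (W j) = l) \<and>
             (\<forall>j\<in>A i. \<forall>k\<in>A i. j \<noteq> k \<longrightarrow> W j \<inter> W k = {})" if "i \<in> I" for i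
    by (rule disjoint_blocks) (use that finA finB card in auto)
  then obtain U where U: "\<And>i j. i \<in> I \<Longrightarrow> j \<in> A i \<Longrightarrow> U i j \<subseteq> B i \<and> card (U i j) = l"
      "\<And>i j k. i \<in> I \<Longrightarrow> j \<in> A i \<Longrightarrow> k \<in> A i \<Longrightarrow> j \<noteq> k \<Longrightarrow> U i j \<inter> U i k = {}"
    by metis
  define X' where "X' = X - (\<Union>i\<in>I. A i)"
  define Y' where "Y' = Y - (\<Union>i\<in>I. B i)"
  have cA: "card (\<Union>i\<in>I. A i) = (\<Sum>i\<in>I. card (A i))"
    using fin(1) finA A(2) by (intro card_UN_disjoint) auto
  have cB: "card (\<Union>i\<in>I. B i) = (\<Sum>i\<in>I. card (B i))"
    using fin(1) finB B(2) by (intro card_UN_disjoint) auto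
  have cAB: "card (\<Union>i\<in>I. B i) = l * card (\<Union>i\<in>I. A i)"
    unfolding cA cB by (simp add: card sum_distrib_left)
  have "card (X - (\<Union>i\<in>I. A i)) = card X - card (\<Union>i\<in>I. A i)"
    using A(1) fin(1) finA by (intro card_Diff_subset) auto
  moreover have "card (Y - (\<Union>i\<in>I. B i)) = card Y - card (\<Union>i\<in>I. B i)"
    using B(1) fin(1) finB by (intro card_Diff_subset) auto
  ultimately have "l * card (X - (\<Union>i\<in>I. A i)) \<le> card (Y - (\<Union>i\<in>I. B i))"
    using room cAB by (simp add: diff_mult_distrib2)
  then have room': "l * card X' \<le> card Y'" unfolding X'_def Y'_def .
  obtain V where V: "\<And>j. j \<in> X' \<Longrightarrow> V j \<subseteq> Y' \<and> card (V j) = l"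
      "\<And>j k. j \<in> X' \<Longrightarrow> k \<in> X' \<Longrightarrow> j \<noteq> k \<Longrightarrow> V j \<inter> V k = {}"
    using disjoint_blocks[OF _ _ room'] assms(3) fin(2) unfolding X'_def Y'_def by (metis finite_Diff)
  define W where "W j = (if \<exists>i\<in>I. j \<in> A i then U (THE i. i \<in> I \<and> j \<in> A i) j else V j)" for j
  have WU: "W j = U i j" if "i \<in> I" "j \<in> A i" for i j
  proof -
    have "(THE i. i \<in> I \<and> j \<in> A i) = i"
      using that A(2) by (intro the_equality) blast+
    then show ?thesis using that by (auto simp: W_def)
  qed
  have WV: "W j = V j" if "j \<in> X'" for j
    using that by (auto simp: W_def X'_def)
  have split: "(\<exists>i\<in>I. j \<in> A i) \<or> j \<in> X'" if "j \<in> X" for j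
    using that by (auto simp: X'_def)
  have YB: "Y' \<inter> B i = {}" if "i \<in> I" for i using that by (auto simp: Y'_def)
  show ?thesis
  proof
    show sub: "W j \<subseteq> Y" and "card (W j) = l" if "j \<in> X" for j
    proof -
      have "W j \<subseteq> Y \<and> card (W j) = l"
        using split[OF that]
      proof
        assume "\<exists>i\<in>I. j \<in> A i"
        then obtain i where i: "i \<in> I" "j \<in> A i" ..
        show ?thesis using U(1)[OF i] WU[OF i] B(1)[OF i(1)] by auto
      next
        assume "j \<in> X'"
        then show ?thesis using V(1) WV by (auto simp: Y'_def)
      qed
      then show "W j \<subseteq> Y" "card (W j) = l" by auto
    qed
    show disj: "W j \<inter> W k = {}" if jk: "j \<in> X" "k \<in> X" "j \<noteq> k" for j k
    proof -
      consider (UU) i i' where "i \<in> I" "i' \<in> I" "j \<in> A i" "k \<in> A i'"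
        | (UV) i where "i \<in> I" "j \<in> A i" "k \<in> X'"
        | (VU) i where "i \<in> I" "k \<in> A i" "j \<in> X'"
        | (VV) "j \<in> X'" "k \<in> X'"
        using split[OF jk(1)] split[OF jk(2)] by blast
      then show ?thesis
      proof cases
        case UU
        then show ?thesis
          using U(1)[of i j] U(1)[of i' k] U(2)[of i j k] B(2)[of i i'] WU jk(3) by (cases "i = i'") auto
      next
        case UV
        then show ?thesis using U(1)[of i j] V(1)[of k] WU[of i j] WV[of k] YB[of i] by auto
      next
        case VU
        then show ?thesis using U(1)[of i k] V(1)[of j] WU[of i k] WV[of j] YB[of i] by auto
      next
        case VV
        then show ?thesis using V(2) WV jk(3) by auto
      qed
    qed
    show "(\<Union>j\<in>A i. W j) = B i" if "i \<in> I" for i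
    proof (rule card_subset_eq)
      show "finite (B i)" using finB that .
      show "(\<Union>j\<in>A i. W j) \<subseteq> B i" using U(1) WU that by blast
      have "card (\<Union>j\<in>A i. W j) = (\<Sum>j\<in>A i. card (W j))"
      proof (rule card_UN_disjoint)
        show "\<forall>j\<in>A i. finite (W j)"
          using A(1)[OF that] sub fin(2) by (meson finite_subset subsetD)
        show "\<forall>j\<in>A i. \<forall>k\<in>A i. j \<noteq> k \<longrightarrow> W j \<inter> W k = {}"
          using A(1)[OF that] disj by (meson subsetD)
      qed (use finA[OF that] in simp)
      also have "\<dots> = l * card (A i)"
        using U(1) WU that by simp
      finally show "card (\<Union>j\<in>A i. W j) = card (B i)" using card that by simp
    qed
  qed
qed

text \<open>
  Charts are additive, and a set is the sum of its points, so a containment between two charts only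
  has to be known at the points.
\<close>

lemma chart_through_points:
  assumes "chart H I c \<psi>" "chart H J d \<chi>" "measure_algebra H" "finite X" "X \<subseteq> I"
    and "\<And>i. i \<in> X \<Longrightarrow> A i \<subseteq> J" "\<And>i. i \<in> X \<Longrightarrow> \<psi> {i} = \<chi> (A i)"
    and "\<And>i j. i \<in> X \<Longrightarrow> j \<in> X \<Longrightarrow> i \<noteq> j \<Longrightarrow> A i \<inter> A j = {}"
  shows "\<psi> X = \<chi> (\<Union>i\<in>X. A i)"
  using assms(4-)
proof (induction X rule: finite_induct)
  case empty
  then show ?case using chart_empty assms(1-3) by (metis UN_empty)
next
  case (insert x X)
  have "\<psi> (insert x X) = badd H (\<psi> {x}) (\<psi> X)"
  proof -
    have "sym_diff {x} X = insert x X" using insert by auto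
    then show ?thesis using chartD(4)[OF assms(1), of "{x}" X] insert.prems(1) by auto
  qed
  also have "\<dots> = badd H (\<chi> (A x)) (\<chi> (\<Union>i\<in>X. A i))"
    using insert by simp
  also have "\<dots> = \<chi> (\<Union>i\<in>insert x X. A i)"
  proof -
    have "A x \<inter> (\<Union>i\<in>X. A i) = {}"
    proof (rule ccontr)
      assume "A x \<inter> (\<Union>i\<in>X. A i) \<noteq> {}"
      then obtain i where "i \<in> X" "A x \<inter> A i \<noteq> {}" by blast
      then show False using insert.prems(4)[of x i] insert.hyps(2) by auto
    qed
    then have "sym_diff (A x) (\<Union>i\<in>X. A i) = (\<Union>i\<in>insert x X. A i)" by auto
    moreover have "A x \<subseteq> J" "(\<Union>i\<in>X. A i) \<subseteq> J" using insert.prems(2) by auto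
    ultimately show ?thesis using chartD(4)[OF assms(2), of "A x" "\<Union>i\<in>X. A i"] by simp
  qed
  finally show ?case .
qed

lemma chart_points_disjoint:
  assumes "chart H I c \<psi>" "chart H J d \<chi>" "measure_algebra H" "finite J" 
    and "i \<in> I" "j \<in> I" "i \<noteq> j" "A \<subseteq> J" "B \<subseteq> J" "\<psi> {i} = \<chi> A" "\<psi> {j} = \<chi> B"
  shows "A \<inter> B = {}"
proof -
  have "\<chi> (A \<inter> B) = bmul H (\<psi> {i}) (\<psi> {j})"
    using chartD(5)[OF assms(2)] assms by metis
  also have "\<dots> = \<psi> ({i} \<inter> {j})"
    using chartD(5)[OF assms(1), of "{i}" "{j}"] assms(5,6) by blast
  also have "\<dots> = \<chi> {}"
    using chart_empty assms(1-3,7) by (metis Int_empty_right Int_insert_right singletonD)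
  finally show ?thesis
    using chart_inj[OF assms(2,4,3), of "A \<inter> B" "{}"] assms(8) by blast
qed

text \<open>
  A matching is the graph of an isomorphism, up to the scalar \<open>\<alpha>\<close>, between finite equiatomic
  subalgebras of two measure algebras.
\<close>

definition matching ::
  "'a meas_alg \<Rightarrow> 'b meas_alg \<Rightarrow> real \<Rightarrow> ('a \<times> 'b) set \<Rightarrow> bool" where
  "matching H K \<alpha> G \<longleftrightarrow> (\<exists>n c \<psi> \<chi>. chart H {..<n::nat} c \<psi> \<and> chart K {..<n} (\<alpha> * c) \<chi> \<and>
     G = (\<lambda>X. (\<psi> X, \<chi> X)) ` Pow {..<n})"

lemma matching_converse:
  assumes "matching H K \<alpha> G" "\<alpha> > 0"
  shows "matching K H (inverse \<alpha>) (G\<inverse>)"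
proof -
  obtain n c \<psi> \<chi> where *: "chart H {..<n::nat} c \<psi>" "chart K {..<n} (\<alpha> * c) \<chi>"
      "G = (\<lambda>X. (\<psi> X, \<chi> X)) ` Pow {..<n}"
    using assms(1) unfolding matching_def by blast
  have "inverse \<alpha> * (\<alpha> * c) = c" using assms(2) by simp
  moreover have "G\<inverse> = (\<lambda>X. (\<chi> X, \<psi> X)) ` Pow {..<n}" using *(3) by auto
  ultimately show ?thesis unfolding matching_def using * by metis
qed

text \<open>
  The forth step. A chart of \<open>H\<close> containing the matched subalgebra and \<open>h\<close> refines the old atoms in a
  certain pattern. Since the mass of its atoms and its total mass are values of \<open>K\<close> as well, some
  chart of \<open>K\<close> is fine enough to cut out blocks of that mass, and large enough to have room for as
  many of them as there are atoms; so the pattern can be copied, keeping the old matching.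
\<close>

lemma matching_extend:
  assumes H: "measure_algebra H" "charted H \<Gamma>" and K: "measure_algebra K" "charted K \<Delta>"
    and \<alpha>: "\<alpha> > 0" "values K = (*) \<alpha> ` values H"
    and G: "matching H K \<alpha> G" and h: "h \<in> carrier H"
  shows "\<exists>G'. matching H K \<alpha> G' \<and> G \<subseteq> G' \<and> h \<in> Domain G'"
proof -
  interpret H: measure_algebra H by fact
  interpret K: measure_algebra K by fact
  obtain n c \<psi> \<chi> where \<psi>: "chart H {..<n::nat} c \<psi>" and \<chi>: "chart K {..<n} (\<alpha> * c) \<chi>"
      and Geq: "G = (\<lambda>X. (\<psi> X, \<chi> X)) ` Pow {..<n}"
    using G unfolding matching_def by blast
  obtain n2 :: nat and c2 \<psi>2 where \<psi>2: "chart H {..<n2} c2 \<psi>2"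
      and cover: "insert h (\<psi> ` Pow {..<n}) \<subseteq> \<psi>2 ` Pow {..<n2}"
    by (rule charted_cover[OF H(2), of "insert h (\<psi> ` Pow {..<n})"])
      (use h chartD(2)[OF \<psi>] in auto)
  show ?thesis
  proof (cases "n2 = 0")
    case True
    \<comment> \<open>A chart without points covers only zero, which every matching contains.\<close>
    then have "h = bzero H" using cover chart_empty[OF \<psi>2 H(1)] by auto
    moreover have "(bzero H, bzero K) \<in> G"
      unfolding Geq
      by (rule image_eqI[of _ _ "{}"]) (simp_all add: chart_empty[OF \<psi> H(1)] chart_empty[OF \<chi> K(1)])
    ultimately have "h \<in> Domain G" by blast
    with G show ?thesis by (intro exI[of _ G]) auto
  next
    case False
    have "\<exists>A. A \<subseteq> {..<n2} \<and> \<psi> {i} = \<psi>2 A" if "i < n" for i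
      using subsetD[OF cover, of "\<psi> {i}"] that by auto
    then obtain A where A: "\<And>i. i < n \<Longrightarrow> A i \<subseteq> {..<n2}" "\<And>i. i < n \<Longrightarrow> \<psi> {i} = \<psi>2 (A i)"
      by metis
    have "\<alpha> * (c2 * real 1) \<in> values K" "\<alpha> * (c2 * real n2) \<in> values K"
      unfolding \<alpha>(2) using chart_values[OF \<psi>2, of 1] chart_values[OF \<psi>2, of n2] False
      by (intro imageI; simp)+
    then obtain y z where y: "y \<in> carrier K" "meas K y = \<alpha> * c2"
      and z: "z \<in> carrier K" "meas K z = \<alpha> * (c2 * real n2)"
      by auto
    obtain N :: nat and d \<omega> where \<omega>: "chart K {..<N} d \<omega>"
      and coverK: "insert y (insert z (\<chi> ` Pow {..<n})) \<subseteq> \<omega> ` Pow {..<N}"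
      by (rule charted_cover[OF K(2), of "insert y (insert z (\<chi> ` Pow {..<n}))"])
        (use y z chartD(2)[OF \<chi>] in auto)
    have "\<exists>B. B \<subseteq> {..<N} \<and> \<chi> {i} = \<omega> B" if "i < n" for i
      using subsetD[OF coverK, of "\<chi> {i}"] that by auto
    then obtain B where B: "\<And>i. i < n \<Longrightarrow> B i \<subseteq> {..<N}" "\<And>i. i < n \<Longrightarrow> \<chi> {i} = \<omega> (B i)"
      by metis
    obtain Y Z where YZ: "Y \<subseteq> {..<N}" "y = \<omega> Y" "Z \<subseteq> {..<N}" "z = \<omega> Z"
      using subsetD[OF coverK, of y] subsetD[OF coverK, of z] by auto
    \<comment> \<open>An atom of the chart \<open>\<psi>2\<close> will correspond to a block of \<open>l\<close> atoms of \<open>\<omega>\<close>.\<close>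
    define l where "l = card Y"
    have d: "d > 0" using chartD(1)[OF \<omega>] .
    have c2: "c2 > 0" using chartD(1)[OF \<psi>2] .
    have ld: "\<alpha> * c2 = d * real l"
      using chartD(3)[OF \<omega> YZ(1)] YZ(2) y(2) by (simp add: l_def)
    have "l > 0" using ld \<alpha>(1) c2 d by (intro gr0I) auto
    have "d * real (card Z) = d * (real l * real n2)"
      using chartD(3)[OF \<omega> YZ(3)] YZ(4) z(2) ld by (simp add: mult.assoc[symmetric])
    then have "card Z = l * n2" using d by (simp flip: of_nat_mult)
    then have room: "l * card {..<n2} \<le> card {..<N}"
      using YZ(3) by (metis card_lessThan card_mono finite_lessThan)
    have disjA: "A i \<inter> A j = {}" if "i < n" "j < n" "i \<noteq> j" for i j
      using chart_points_disjoint[OF \<psi> \<psi>2 H(1), of i j "A i" "A j"] that A by auto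
    have disjB: "B i \<inter> B j = {}" if "i < n" "j < n" "i \<noteq> j" for i j
      using chart_points_disjoint[OF \<chi> \<omega> K(1), of i j "B i" "B j"] that B by auto
    have cardAB: "card (B i) = l * card (A i)" if "i < n" for i
    proof -
      have "c = c2 * real (card (A i))"
        using chartD(3)[OF \<psi>, of "{i}"] chartD(3)[OF \<psi>2 A(1)[OF that]] A(2)[OF that] that by simp
      moreover have "\<alpha> * c = d * real (card (B i))"
        using chartD(3)[OF \<chi>, of "{i}"] chartD(3)[OF \<omega> B(1)[OF that]] B(2)[OF that] that by simp
      ultimately have "d * real (card (B i)) = d * (real l * real (card (A i)))"
        using ld by (metis mult.assoc)
      then show ?thesis using d by (simp flip: of_nat_mult)
    qed
    obtain W where W: "\<And>j. j \<in> {..<n2} \<Longrightarrow> W j \<subseteq> {..<N}" "\<And>j. j \<in> {..<n2} \<Longrightarrow> card (W j) = l"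
        "\<And>i j. i \<in> {..<n2} \<Longrightarrow> j \<in> {..<n2} \<Longrightarrow> i \<noteq> j \<Longrightarrow> W i \<inter> W j = {}"
        "\<And>i. i \<in> {..<n} \<Longrightarrow> (\<Union>j\<in>A i. W j) = B i"
      by (rule compatible_blocks[of "{..<n}" "{..<N}" "{..<n2}" A B l])
        (use A(1) B(1) disjA disjB cardAB room in auto)
    define \<chi>2 where "\<chi>2 X = \<omega> (\<Union>j\<in>X. W j)" for X
    have \<chi>2: "chart K {..<n2} (\<alpha> * c2) \<chi>2"
      unfolding \<chi>2_def ld using chart_blocks[OF \<omega> _ _ \<open>l > 0\<close>, of "{..<n2}" W] W by blast
    define G2 where "G2 = (\<lambda>X. (\<psi>2 X, \<chi>2 X)) ` Pow {..<n2}"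
    have "matching H K \<alpha> G2"
      unfolding matching_def G2_def using \<psi>2 \<chi>2 by blast
    moreover have "G \<subseteq> G2"
    proof
      fix g assume "g \<in> G"
      then obtain X where X: "X \<subseteq> {..<n}" "g = (\<psi> X, \<chi> X)" unfolding Geq by blast
      have fX: "finite X" using X(1) finite_subset by blast
      have Xn: "i < n" if "i \<in> X" for i using X(1) that by blast
      have "\<psi> X = \<psi>2 (\<Union>i\<in>X. A i)"
        by (rule chart_through_points[OF \<psi> \<psi>2 H(1) fX X(1)]) (simp_all add: A disjA Xn)
      moreover have "\<chi> X = \<omega> (\<Union>i\<in>X. B i)"
        by (rule chart_through_points[OF \<chi> \<omega> K(1) fX X(1)]) (simp_all add: B disjB Xn)
      moreover have "(\<Union>i\<in>X. B i) = (\<Union>j\<in>(\<Union>i\<in>X. A i). W j)"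
      proof -
        have "(\<Union>j\<in>(\<Union>i\<in>X. A i). W j) = (\<Union>i\<in>X. \<Union>j\<in>A i. W j)" by simp
        also have "\<dots> = (\<Union>i\<in>X. B i)" by (rule SUP_cong) (simp_all add: W(4) Xn)
        finally show ?thesis by simp
      qed
      moreover have "(\<Union>i\<in>X. A i) \<in> Pow {..<n2}" using A(1) Xn by (simp add: UN_subset_iff)
      ultimately show "g \<in> G2"
        unfolding G2_def \<chi>2_def X(2) by (intro image_eqI[of _ _ "\<Union>i\<in>X. A i"]) simp_all
    qed
    moreover have "h \<in> Domain G2"
      using cover unfolding G2_def by blast
    ultimately show ?thesis by blast
  qed
qed

lemma matching_pairs:
  assumes "matching H K \<alpha> G" "measure_algebra H" "measure_algebra K" "\<alpha> > 0"
    and "(x, y) \<in> G" "(x', y') \<in> G"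
  shows "x = x' \<longleftrightarrow> y = y'" and "(badd H x x', badd K y y') \<in> G"
    and "(bmul H x x', bmul K y y') \<in> G" and "x \<in> carrier H" "y \<in> carrier K"
    and "meas K y = \<alpha> * meas H x"
proof -
  obtain n c \<psi> \<chi> where \<psi>: "chart H {..<n::nat} c \<psi>" and \<chi>: "chart K {..<n} (\<alpha> * c) \<chi>"
      and Geq: "G = (\<lambda>X. (\<psi> X, \<chi> X)) ` Pow {..<n}"
    using assms(1) unfolding matching_def by blast
  obtain X X' where X: "X \<subseteq> {..<n}" "X' \<subseteq> {..<n}" and
    eqs: "x = \<psi> X" "y = \<chi> X" "x' = \<psi> X'" "y' = \<chi> X'"
    using assms(5,6) unfolding Geq by blast
  show "x = x' \<longleftrightarrow> y = y'"
    unfolding eqs using chart_inj[OF \<psi> _ assms(2) X] chart_inj[OF \<chi> _ assms(3) X] by auto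
  show "(badd H x x', badd K y y') \<in> G" "(bmul H x x', bmul K y y') \<in> G"
    unfolding eqs Geq using chartD(4,5)[OF \<psi> X] chartD(4,5)[OF \<chi> X] X by auto
  show "x \<in> carrier H" "y \<in> carrier K" "meas K y = \<alpha> * meas H x"
    unfolding eqs using chartD(2,3)[OF \<psi> X(1)] chartD(2,3)[OF \<chi> X(1)] by auto
qed

text \<open>
  Back and forth: matchings are extended alternately on either side, so that in the limit
  every element of the two countable algebras gets a partner.
\<close>

theorem scalar_iso_if_same_values:
  assumes H: "measure_algebra H" "charted H \<Gamma>" "countable (carrier H)"
    and K: "measure_algebra K" "charted K \<Delta>" "countable (carrier K)"
    and \<alpha>: "\<alpha> > 0" "values K = (*) \<alpha> ` values H"
  shows "scalar_equivalent H K"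
proof -
  interpret H: measure_algebra H by fact
  interpret K: measure_algebra K by fact
  have \<beta>: "inverse \<alpha> > 0" "values H = (*) (inverse \<alpha>) ` values K"
    unfolding \<alpha>(2) image_image using \<alpha>(1) by (simp_all add: mult.assoc[symmetric])
  define e where "e = from_nat_into (carrier H)"
  define e' where "e' = from_nat_into (carrier K)"
  have e: "e k \<in> carrier H" and e': "e' k \<in> carrier K" for k
    unfolding e_def e'_def by (metis H.add.one_closed K.add.one_closed empty_iff from_nat_into)+
  have step: "\<exists>G'. matching H K \<alpha> G' \<and> G \<subseteq> G' \<and> e k \<in> Domain G' \<and> e' k \<in> Range G'"
    if G: "matching H K \<alpha> G" for G k
  proof -
    obtain G1 where G1: "matching H K \<alpha> G1" "G \<subseteq> G1" "e k \<in> Domain G1"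
      using matching_extend[OF H(1,2) K(1,2) \<alpha> G e] by blast
    obtain G2 where G2: "matching K H (inverse \<alpha>) G2" "G1\<inverse> \<subseteq> G2" "e' k \<in> Domain G2"
      using matching_extend[OF K(1,2) H(1,2) \<beta> matching_converse[OF G1(1) \<alpha>(1)] e'] by blast
    have "matching H K \<alpha> (G2\<inverse>)"
      using matching_converse[OF G2(1) \<beta>(1)] by simp
    moreover have "G1 \<subseteq> G2\<inverse>" using G2(2) by (simp add: converse_subset_swap)
    then have "G \<subseteq> G2\<inverse>" "e k \<in> Domain (G2\<inverse>)"
      using G1(2) subsetD[OF Domain_mono G1(3)] by (blast, iprover)
    moreover have "e' k \<in> Range (G2\<inverse>)" using G2(3) by simp
    ultimately show ?thesis by (intro exI[of _ "G2\<inverse>"] conjI)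
  qed
  have start: "matching H K \<alpha> {(bzero H, bzero K)}"
    unfolding matching_def
    using chart_zero[OF H(1), of 1] chart_zero[OF K(1), of \<alpha>] \<alpha>(1) 
    by (intro exI[of _ "0::nat"] exI[of _ 1] exI[of _ "\<lambda>_. bzero H"] exI[of _ "\<lambda>_. bzero K"]) auto
  obtain G where G: "\<And>k. matching H K \<alpha> (G k)"
      and Gstep: "\<And>k. G k \<subseteq> G (Suc k) \<and> e k \<in> Domain (G (Suc k)) \<and> e' k \<in> Range (G (Suc k))"
    using dependent_nat_choice[of "\<lambda>_ G. matching H K \<alpha> G"
        "\<lambda>k G G'. G \<subseteq> G' \<and> e k \<in> Domain G' \<and> e' k \<in> Range G'"] start step by metis
  have mono: "G i \<subseteq> G j" if "i \<le> j" for i j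
    by (rule lift_Suc_mono_le[of G, OF conjunct1[OF Gstep] that])
  define U where "U = (\<Union>k. G k)"
  have common: "\<exists>k. p \<in> G k \<and> q \<in> G k" if pq: "p \<in> U" "q \<in> U" for p q
  proof -
    obtain i j where "p \<in> G i" "q \<in> G j" using pq unfolding U_def by blast
    then have "p \<in> G (max i j)" "q \<in> G (max i j)"
      using mono[of i "max i j"] mono[of j "max i j"] by auto
    then show ?thesis by blast
  qed
  have eq: "x = x' \<longleftrightarrow> y = y'" and add: "(badd H x x', badd K y y') \<in> U"
    and mul: "(bmul H x x', bmul K y y') \<in> U"
    if "(x, y) \<in> U" "(x', y') \<in> U" for x y x' y'
  proof -
    obtain k where k: "(x, y) \<in> G k" "(x', y') \<in> G k" using common[OF \<open>(x, y) \<in> U\<close> \<open>(x', y') \<in> U\<close>] by blast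
    note p = matching_pairs[OF G H(1) K(1) \<alpha>(1) k]
    show "x = x' \<longleftrightarrow> y = y'" by (fact p(1))
    show "(badd H x x', badd K y y') \<in> U" "(bmul H x x', bmul K y y') \<in> U"
      unfolding U_def using p(2,3) by blast+
  qed
  have car: "x \<in> carrier H \<and> y \<in> carrier K \<and> meas K y = \<alpha> * meas H x" if "(x, y) \<in> U" for x y
  proof -
    obtain k where k: "(x, y) \<in> G k" using \<open>(x, y) \<in> U\<close> unfolding U_def by blast
    show ?thesis using matching_pairs(4-6)[OF G H(1) K(1) \<alpha>(1) k k] by blast
  qed
  have "\<exists>y. (x, y) \<in> U" if "x \<in> carrier H" for x
  proof -
    obtain k where "e k = x"
      using from_nat_into_surj[OF H(3) \<open>x \<in> carrier H\<close>] unfolding e_def by blast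
    with Gstep[of k] show ?thesis unfolding U_def by (auto simp: Domain.simps Range.simps)
  qed
  then obtain \<phi> where \<phi>: "\<And>x. x \<in> carrier H \<Longrightarrow> (x, \<phi> x) \<in> U" by metis
  have surj: "\<exists>x. (x, y) \<in> U" if "y \<in> carrier K" for y
  proof -
    obtain k where "e' k = y"
      using from_nat_into_surj[OF K(3) \<open>y \<in> carrier K\<close>] unfolding e'_def by blast
    with Gstep[of k] show ?thesis unfolding U_def by (auto simp: Domain.simps Range.simps)
  qed
  have "bij_betw \<phi> (carrier H) (carrier K)"
    unfolding bij_betw_def inj_on_def
  proof (intro conjI ballI impI equalityI subsetI)
    show "x = x'" if "x \<in> carrier H" "x' \<in> carrier H" "\<phi> x = \<phi> x'" for x x'
      using eq[OF \<phi>[OF that(1)] \<phi>[OF that(2)]] that(3) by simp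
    show "y \<in> carrier K" if "y \<in> \<phi> ` carrier H" for y
      using that car[OF \<phi>] by auto
    show "y \<in> \<phi> ` carrier H" if y: "y \<in> carrier K" for y
    proof -
      obtain x where x: "(x, y) \<in> U" using surj[OF y] by blast
      then have "x \<in> carrier H" using car by blast
      then show ?thesis using eq[OF x \<phi>[OF \<open>x \<in> carrier H\<close>]] by auto
    qed
  qed
  moreover have "\<phi> (badd H x x') = badd K (\<phi> x) (\<phi> x')" "\<phi> (bmul H x x') = bmul K (\<phi> x) (\<phi> x')"
    if x: "x \<in> carrier H" "x' \<in> carrier H" for x x'
    using eq[OF \<phi> add[OF \<phi>[OF x(1)] \<phi>[OF x(2)]]] eq[OF \<phi> mul[OF \<phi>[OF x(1)] \<phi>[OF x(2)]]]
      x H.add.m_closed H.bmul_closed by auto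
  moreover have "meas K (\<phi> x) = \<alpha> * meas H x" if "x \<in> carrier H" for x
    using car[OF \<phi>[OF that]] by simp
  ultimately have "scalar_iso H K \<phi>"
    unfolding scalar_iso_def alg_iso_def using \<alpha>(1) by simp (rule exI[of _ \<alpha>], simp)
  then show ?thesis unfolding scalar_equivalent_def by (rule exI[of "scalar_iso H K" \<phi>])
qed

section \<open>Steinitz numbers and their fractions\<close>

lemma expo_steinitz_of_nat:
  "expo (steinitz_of_nat n) p = (if prime p then enat (multiplicity p n) else 0)"
  by transfer simp

lemma expo_times: "expo (s * t) p = expo s p + expo t p"
  by transfer simp

lemma expo_nonprime: "\<not> prime p \<Longrightarrow> expo s p = 0"
  by transfer simp

lemma steinitz_eqI: "(\<And>p. prime p \<Longrightarrow> expo s p = expo t p) \<Longrightarrow> s = t"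
  by (metis expo_inject expo_nonprime ext)

lemma enat_le_imp_add_diff: "(enat a \<le> x) \<Longrightarrow> enat a + (x - enat a) = x"
  by (cases x) auto

lemma Omega_iff:
  "n \<in> Omega s \<longleftrightarrow> n > 0 \<and> (\<forall>p. prime p \<longrightarrow> enat (multiplicity p n) \<le> expo s p)"
proof -
  have "steinitz_of_nat n dvd s \<longleftrightarrow> (\<forall>p. prime p \<longrightarrow> enat (multiplicity p n) \<le> expo s p)"
  proof
    assume "steinitz_of_nat n dvd s"
    then obtain t where "s = steinitz_of_nat n * t" by (rule dvdE)
    then show "\<forall>p. prime p \<longrightarrow> enat (multiplicity p n) \<le> expo s p"
      by (simp add: expo_times expo_steinitz_of_nat)
  next
    assume *: "\<forall>p. prime p \<longrightarrow> enat (multiplicity p n) \<le> expo s p"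
    define t where "t = Abs_steinitz (\<lambda>p. expo s p - (if prime p then enat (multiplicity p n) else 0))"
    have t: "expo t p = expo s p - (if prime p then enat (multiplicity p n) else 0)" for p
      unfolding t_def by (subst Abs_steinitz_inverse) (auto simp: expo_nonprime)
    have "s = steinitz_of_nat n * t"
      by (rule steinitz_eqI) (use * in \<open>simp add: expo_times expo_steinitz_of_nat t enat_le_imp_add_diff\<close>)
    then show "steinitz_of_nat n dvd s" by (rule dvdI)
  qed
  then show ?thesis by (simp add: Omega_def)
qed

lemma Omega_pos: "n \<in> Omega s \<Longrightarrow> n > 0"
  by (simp add: Omega_iff)

lemma one_Omega: "1 \<in> Omega s"
  by (simp add: Omega_iff flip: zero_enat_def)

lemma multiplicity_lcm_max:
  fixes a b p :: nat
  assumes "a > 0" "b > 0" "prime p"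
  shows "multiplicity p (lcm a b) = max (multiplicity p a) (multiplicity p b)"
  using assms by (simp add: multiplicity_lcm)

lemma Omega_lcm: "a \<in> Omega s \<Longrightarrow> b \<in> Omega s \<Longrightarrow> lcm a b \<in> Omega s"
  unfolding Omega_iff by (auto simp: multiplicity_lcm_max lcm_pos_nat max_def)

lemma Omega_steinitz_div:
  assumes "b \<in> Omega s"
  shows "n \<in> Omega (steinitz_div s b) \<longleftrightarrow> n * b \<in> Omega s"
proof -
  have b: "b > 0" and le: "\<And>p. prime p \<Longrightarrow> enat (multiplicity p b) \<le> expo s p"
    using assms by (auto simp: Omega_iff)
  have aux: "enat k \<le> x - enat l \<longleftrightarrow> enat (k + l) \<le> x" if "enat l \<le> x" for k l x
    using that by (cases x) auto
  have "enat (multiplicity p n) \<le> expo (steinitz_div s b) p \<longleftrightarrow> enat (multiplicity p (n * b)) \<le> expo s p"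
    if "prime p" "n > 0" for p
  proof -
    have "expo (steinitz_div s b) p = expo s p - enat (multiplicity p b)"
      using that by transfer simp
    then show ?thesis
      using that b aux[OF le[OF that(1)], of "multiplicity p n"]
      by (simp add: prime_elem_multiplicity_mult_distrib)
  qed
  then show ?thesis using b by (auto simp: Omega_iff)
qed

text \<open>
  A finite exponent not exceeding a supremum of exponents is attained by some member of \<open>B\<close>. For a
  divisor \<open>n\<close> of the supremum, the least common multiple of the members chosen for the finitely
  many prime factors of \<open>n\<close> belongs to \<open>B\<close> and is a multiple of \<open>n\<close>.
\<close>

lemma Omega_if_closed:
  fixes B :: "nat set"
  assumes pos: "0 \<notin> B" and one: "1 \<in> B" and dvd: "\<And>m n. n \<in> B \<Longrightarrow> m dvd n \<Longrightarrow> m \<in> B"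
    and lcm: "\<And>m n. m \<in> B \<Longrightarrow> n \<in> B \<Longrightarrow> lcm m n \<in> B"
  shows "Omega (steinitz_Lcm (steinitz_of_nat ` B)) = B"
proof -
  let ?s = "steinitz_Lcm (steinitz_of_nat ` B)"
  have expo: "expo ?s p = (SUP n\<in>B. enat (multiplicity p n))" if "prime p" for p
    using that by (simp add: expo_steinitz_Lcm expo_steinitz_of_nat image_image)
  have attained: "\<exists>n\<in>B. k \<le> multiplicity p n" if p: "prime p" and k: "enat k \<le> expo ?s p" for p k
  proof (cases k)
    case 0
    then show ?thesis using one by auto
  next
    case (Suc l)
    then have "enat l < (SUP n\<in>B. enat (multiplicity p n))"
      using k expo[OF p] by (metis enat_ord_simps(2) lessI order_less_le_trans)
    then obtain n where "n \<in> B" "enat l < enat (multiplicity p n)"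
      unfolding less_SUP_iff by blast
    then show ?thesis using Suc by (auto simp: Suc_le_eq)
  qed
  have lcm_finite: "Lcm F \<in> B" if "finite F" "F \<subseteq> B" for F
    using that by (induction F rule: finite_induct) (use one lcm in auto)
  show ?thesis
  proof (intro equalityI subsetI)
    fix n assume n: "n \<in> B"
    have "enat (multiplicity p n) \<le> expo ?s p" if "prime p" for p
      unfolding expo[OF that] using n by (rule SUP_upper)
    then show "n \<in> Omega ?s" using pos n by (auto simp: Omega_iff intro: gr0I)
  next
    fix n assume "n \<in> Omega ?s"
    then have n: "n > 0" "\<And>p. prime p \<Longrightarrow> enat (multiplicity p n) \<le> expo ?s p"
      by (auto simp: Omega_iff)
    have "\<exists>m. prime p \<longrightarrow> m \<in> B \<and> multiplicity p n \<le> multiplicity p m" for p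
      using attained n(2) by blast
    then obtain m where m: "\<And>p. prime p \<Longrightarrow> m p \<in> B" 
        "\<And>p. prime p \<Longrightarrow> multiplicity p n \<le> multiplicity p (m p)"
      by metis
    define M where "M = Lcm (m ` prime_factors n)"
    have M: "M \<in> B"
      unfolding M_def using m(1) by (intro lcm_finite) (auto dest: in_prime_factors_imp_prime)
    then have "M > 0" using pos by (metis gr0I)
    have "multiplicity p n \<le> multiplicity p M" if p: "prime p" for p
    proof (cases "p \<in> prime_factors n")
      case True
      then have "m p dvd M" unfolding M_def by (intro dvd_Lcm) auto
      then have "multiplicity p (m p) \<le> multiplicity p M"
        using \<open>M > 0\<close> by (intro dvd_imp_multiplicity_le) auto
      then show ?thesis using m(2)[OF p] by simp
    next
      case False
      then have "\<not> p dvd n" using p n(1) by (auto simp: prime_factors_dvd)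
      then show ?thesis by (simp add: not_dvd_imp_multiplicity_0)
    qed
    then have "n dvd M" using n(1) by (intro multiplicity_le_imp_dvd) auto
    then show "n \<in> B" using dvd M by blast
  qed
qed

lemma steinitz_eq_Lcm_Omega: "s = steinitz_Lcm (steinitz_of_nat ` Omega s)"
proof (rule steinitz_eqI)
  fix p :: nat assume p: "prime p"
  have "expo s p = (SUP n\<in>Omega s. enat (multiplicity p n))"
  proof (rule antisym)
    show "(SUP n\<in>Omega s. enat (multiplicity p n)) \<le> expo s p"
      using p by (intro SUP_least) (simp add: Omega_iff)
    show "expo s p \<le> (SUP n\<in>Omega s. enat (multiplicity p n))"
    proof (rule ccontr)
      assume "\<not> ?thesis"
      then have less: "(SUP n\<in>Omega s. enat (multiplicity p n)) < expo s p" by simp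
      then obtain k where k: "(SUP n\<in>Omega s. enat (multiplicity p n)) = enat k"
        by (cases "SUP n\<in>Omega s. enat (multiplicity p n)") auto
      have "p ^ Suc k \<in> Omega s"
        unfolding Omega_iff
      proof (intro conjI allI impI)
        show "p ^ Suc k > 0" using p by (simp add: prime_gt_0_nat)
        fix q :: nat assume q: "prime q"
        have "enat (Suc k) \<le> expo s p" using less k by (metis Suc_ile_eq)
        then show "enat (multiplicity q (p ^ Suc k)) \<le> expo s q"
          using p q by (cases "p = q") (simp_all add: multiplicity_distinct_prime_power
              flip: zero_enat_def del: power_Suc)
      qed
      then have "enat (multiplicity p (p ^ Suc k)) \<le> enat k"
        unfolding k[symmetric] by (rule SUP_upper)
      then show False using p by (simp del: power_Suc)
    qed
  qed
  then show "expo s p = expo (steinitz_Lcm (steinitz_of_nat ` Omega s)) p"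
    using p by (simp add: expo_steinitz_Lcm expo_steinitz_of_nat image_image)
qed

lemma divisor_chain_dvd:
  assumes "divisor_chain s b" "i \<le> j"
  shows "b i dvd b j"
  using assms(2)
proof (induction j rule: dec_induct)
  case (step j)
  then show ?case using assms(1) unfolding divisor_chain_def by (meson dvd_trans)
qed simp

text \<open>
  The divisors of the members of a chain are closed under least common multiples because the chain is
  directed, so they are all the divisors of a Steinitz number, which can only be \<open>s\<close>.
\<close>

lemma divisor_chain_cofinal:
  assumes "divisor_chain s b" "n \<in> Omega s"
  shows "\<exists>i. n dvd b i"
proof -
  define B where "B = {n. \<exists>i. n dvd b i}"
  have b: "b i > 0" for i
    using assms(1) Omega_pos unfolding divisor_chain_def by blast
  have dir: "\<exists>k. b i dvd b k \<and> b j dvd b k" for i j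
    using divisor_chain_dvd[OF assms(1)] by (meson nat_le_linear)
  have "Omega (steinitz_Lcm (steinitz_of_nat ` B)) = B"
  proof (rule Omega_if_closed)
    show "0 \<notin> B" using b by (simp add: B_def) 
    show "lcm m n \<in> B" if mn: "m \<in> B" "n \<in> B" for m n
    proof -
      obtain i j where "m dvd b i" "n dvd b j" using mn unfolding B_def by blast
      moreover obtain k where "b i dvd b k" "b j dvd b k" using dir by blast
      ultimately have "lcm m n dvd b k" by (meson dvd_trans lcm_least)
      then show ?thesis unfolding B_def by blast
    qed
  qed (auto simp: B_def dest: dvd_trans)
  moreover have "s = steinitz_Lcm (steinitz_of_nat ` B)"
  proof (rule steinitz_eqI)
    fix p :: nat assume p: "prime p"
    have "s = steinitz_Lcm (range (\<lambda>i. steinitz_of_nat (b i)))"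
      using assms(1) unfolding divisor_chain_def by (elim conjE)
    from arg_cong[OF this, of "\<lambda>s. expo s p"]
    have "expo s p = (SUP i. enat (multiplicity p (b i)))"
      by (simp add: expo_steinitz_Lcm expo_steinitz_of_nat image_image p)
    also have "\<dots> = (SUP n\<in>B. enat (multiplicity p n))"
    proof (rule SUP_eq)
      show "\<exists>n\<in>B. enat (multiplicity p (b i)) \<le> enat (multiplicity p n)" for i
        by (rule bexI[of _ "b i"]) (auto simp: B_def intro: exI[of _ i])
      show "\<exists>i\<in>UNIV. enat (multiplicity p n) \<le> enat (multiplicity p (b i))" if n: "n \<in> B" for n
      proof -
        obtain i where i: "n dvd b i" using n unfolding B_def by blast
        have "multiplicity p n \<le> multiplicity p (b i)"
          using i b[of i] by (intro dvd_imp_multiplicity_le) auto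
        then show ?thesis by auto
      qed
    qed
    finally show "expo s p = expo (steinitz_Lcm (steinitz_of_nat ` B)) p"
      using p by (simp add: expo_steinitz_Lcm expo_steinitz_of_nat image_image)
  qed
  ultimately have "Omega s = B" by simp
  then show ?thesis using assms(2) unfolding B_def by blast
qed

lemma divisor_chain_exists: "\<exists>b. divisor_chain s b"
proof -
  define b where "b i = Lcm (Omega s \<inter> {..i})" for i :: nat
  have b: "b i \<in> Omega s" for i
  proof -
    have "Lcm F \<in> Omega s" if "finite F" "F \<subseteq> Omega s" for F
      using that by (induction F rule: finite_induct) (use one_Omega[of s] Omega_lcm in auto)
    then show ?thesis unfolding b_def by simp
  qed
  have "s = steinitz_Lcm (range (\<lambda>i. steinitz_of_nat (b i)))"
  proof (rule steinitz_eqI)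
    fix p :: nat assume p: "prime p"
    have "expo s p = (SUP n\<in>Omega s. enat (multiplicity p n))"
      by (subst steinitz_eq_Lcm_Omega)
        (use p in \<open>simp add: expo_steinitz_Lcm expo_steinitz_of_nat image_image\<close>)
    also have "\<dots> = (SUP i. enat (multiplicity p (b i)))"
    proof (rule SUP_eq)
      show "\<exists>n\<in>Omega s. enat (multiplicity p (b i)) \<le> enat (multiplicity p n)" for i
        using b by blast
      show "\<exists>i\<in>UNIV. enat (multiplicity p n) \<le> enat (multiplicity p (b i))" if n: "n \<in> Omega s" for n
      proof -
        have "n dvd b n" unfolding b_def using n by (intro dvd_Lcm) auto
        then have "multiplicity p n \<le> multiplicity p (b n)"
          using Omega_pos[OF b[of n]] by (intro dvd_imp_multiplicity_le) auto
        then show ?thesis by auto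
      qed
    qed
    finally show "expo s p = expo (steinitz_Lcm (range (\<lambda>i. steinitz_of_nat (b i)))) p"
      using p by (simp add: expo_steinitz_Lcm expo_steinitz_of_nat image_image)
  qed
  moreover have "b i dvd b (Suc i)" for i
    unfolding b_def by (rule Lcm_subset) auto
  ultimately show ?thesis using b unfolding divisor_chain_def by blast
qed

text \<open>
  These are the values of \<open>H_infinity \<otimes> H(s)\<close>; the sets of values of \<open>H(r, s)\<close> and \<open>H\<^sup>+(r, s)\<close> are
  initial segments of this set.
\<close>

definition fractions :: "steinitz \<Rightarrow> real set" where
  "fractions s = {real k / real b | k b. b \<in> Omega s}"

lemma fractionsI: "b \<in> Omega s \<Longrightarrow> real k / real b \<in> fractions s"
  unfolding fractions_def by blast

lemma fractions_denominator:
  assumes "q \<in> fractions s" "a \<in> Omega s"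
  shows "\<exists>k b. b \<in> Omega s \<and> a dvd b \<and> q = real k / real b"
proof -
  obtain k b where b: "b \<in> Omega s" "q = real k / real b"
    using assms(1) unfolding fractions_def by blast
  obtain c where c: "lcm a b = b * c" using dvd_lcm2 by (rule dvdE)
  have "lcm a b \<in> Omega s" using Omega_lcm assms(2) b(1) by blast
  then have "b > 0" "c > 0" using Omega_pos c by (metis nat_0_less_mult_iff)+
  then have "q = real (k * c) / real (lcm a b)" unfolding c b(2) by simp
  then show ?thesis using \<open>lcm a b \<in> Omega s\<close> dvd_lcm1 by blast
qed

section \<open>The possible sets of values\<close>

text \<open>
  Let \<open>B\<close> consist of the integers \<open>b\<close> with \<open>1 / b \<in> V\<close>. A unit of which \<open>1\<close> is a multiple is \<open>1 / N\<close> with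
  \<open>N \<in> B\<close>, and \<open>1 / b\<close> is a multiple of it only if \<open>b\<close> divides \<open>N\<close>. Hence common units show \<open>B\<close> to be
  closed under divisors and least common multiples, so \<open>B\<close> belongs to a Steinitz number; and
  writing a fraction and a larger element of \<open>V\<close> over a common \<open>N\<close> shows that the fraction is in \<open>V\<close>.
\<close>

lemma initial_segment_of_fractions:
  fixes V :: "real set"
  assumes grid: "\<And>F. finite F \<Longrightarrow> F \<subseteq> V \<Longrightarrow>
      \<exists>n c. c > 0 \<and> F \<subseteq> (\<lambda>k. real k * c) ` {..n} \<and> (\<lambda>k. real k * c) ` {..n} \<subseteq> V"
    and one: "1 \<in> V"
  obtains s where "V \<subseteq> fractions s"
    and "\<And>q v. q \<in> fractions s \<Longrightarrow> v \<in> V \<Longrightarrow> q \<le> v \<Longrightarrow> q \<in> V"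
proof -
  define B where "B = {b. b > 0 \<and> 1 / real b \<in> V}"
  have grid1: "\<exists>N n. N \<in> B \<and> N \<le> n \<and> F \<subseteq> (\<lambda>k. real k / real N) ` {..n} \<and> (\<lambda>k. real k / real N) ` {..n} \<subseteq> V"
    if F: "finite F" "F \<subseteq> V" for F
  proof -
    obtain n c where c: "c > 0" "insert 1 F \<subseteq> (\<lambda>k. real k * c) ` {..n}" "(\<lambda>k. real k * c) ` {..n} \<subseteq> V"
      using grid[of "insert 1 F"] F one by auto
    then obtain N where N: "N \<le> n" "1 = real N * c" by auto
    then have "N > 0" by (intro gr0I) auto
    then have cN: "c = 1 / real N" using N(2) by (simp add: field_simps)
    have eq: "(\<lambda>k. real k * c) = (\<lambda>k. real k / real N)" unfolding cN by simp
    have "1 / real N \<in> (\<lambda>k. real k / real N) ` {..n}"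
      using N(1) \<open>N > 0\<close> by (intro image_eqI[of _ _ 1]) auto
    then have "N \<in> B" using c(3) \<open>N > 0\<close> unfolding eq B_def by auto
    then show ?thesis using c(2,3) N(1) unfolding eq by auto
  qed
  have den: "N = b * k" if "1 / real b = real k / real N" "b > 0" "N > 0" for b k N
  proof -
    have "real N = real (b * k)" using that by (simp add: field_simps)
    then show ?thesis by (simp only: of_nat_eq_iff)
  qed
  have inV: "1 / real m \<in> V" if "m dvd N" "N > 0" "N \<le> n" "(\<lambda>k. real k / real N) ` {..n} \<subseteq> V" for m N n
  proof -
    obtain c where c: "N = m * c" using \<open>m dvd N\<close> by (rule dvdE)
    then have "m > 0" "c > 0" "c \<le> N" using that(2) by auto
    then have "1 / real m = real c / real N" unfolding c by simp
    moreover have "real c / real N \<in> (\<lambda>k. real k / real N) ` {..n}"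
      using that(3) \<open>c \<le> N\<close> by (intro image_eqI[of _ _ c]) auto
    ultimately show ?thesis using subsetD[OF that(4)] by simp
  qed
  have dvdN: "b dvd N" if "1 / real b \<in> (\<lambda>k. real k / real N) ` {..n}" "b \<in> B" "N \<in> B" for b N n
    using that den unfolding B_def by fastforce
  have B: "Omega (steinitz_Lcm (steinitz_of_nat ` B)) = B"
  proof (rule Omega_if_closed)
    show "0 \<notin> B" "1 \<in> B" using one by (simp_all add: B_def)
    show "m \<in> B" if mn: "n \<in> B" "m dvd n" for m n
    proof -
      obtain N l where N: "N \<in> B" "N \<le> l" "{1 / real n} \<subseteq> (\<lambda>k. real k / real N) ` {..l}"
          "(\<lambda>k. real k / real N) ` {..l} \<subseteq> V"
        using grid1[of "{1 / real n}"] mn(1) unfolding B_def by auto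
      have "n dvd N" using dvdN N(1,3) mn(1) by blast
      then have "m dvd N" using mn(2) dvd_trans by blast
      moreover have "N > 0" "n > 0" using N(1) mn(1) by (auto simp: B_def)
      ultimately show ?thesis using inV[OF _ _ N(2,4)] mn(2) dvd_pos_nat unfolding B_def by blast
    qed
    show "lcm m n \<in> B" if mn: "m \<in> B" "n \<in> B" for m n
    proof -
      obtain N l where N: "N \<in> B" "N \<le> l" "{1 / real m, 1 / real n} \<subseteq> (\<lambda>k. real k / real N) ` {..l}"
          "(\<lambda>k. real k / real N) ` {..l} \<subseteq> V"
        using grid1[of "{1 / real m, 1 / real n}"] mn unfolding B_def by auto
      have "m dvd N" "n dvd N" using dvdN[of _ N l] N(1,3) mn by auto
      then have "lcm m n dvd N" by simp
      moreover have "N > 0" "lcm m n > 0" using N(1) mn by (auto simp: B_def lcm_pos_nat)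
      ultimately show ?thesis using inV[OF _ _ N(2,4)] unfolding B_def by blast
    qed
  qed
  show ?thesis
  proof
    show "V \<subseteq> fractions (steinitz_Lcm (steinitz_of_nat ` B))"
    proof
      fix v assume "v \<in> V"
      then obtain N l where "N \<in> B" "{v} \<subseteq> (\<lambda>k. real k / real N) ` {..l}"
        using grid1[of "{v}"] by auto
      then show "v \<in> fractions (steinitz_Lcm (steinitz_of_nat ` B))"
        unfolding fractions_def B by auto
    qed
    show "q \<in> V" if q: "q \<in> fractions (steinitz_Lcm (steinitz_of_nat ` B))" and v: "v \<in> V" "q \<le> v" for q v
    proof -
      obtain k b where b: "b \<in> B" "q = real k / real b"
        using q unfolding fractions_def B by blast
      obtain N l where N: "N \<in> B" "{v, 1 / real b} \<subseteq> (\<lambda>k. real k / real N) ` {..l}"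
          "(\<lambda>k. real k / real N) ` {..l} \<subseteq> V"
        using grid1[of "{v, 1 / real b}"] v b(1) unfolding B_def by auto
      then have pos: "N > 0" "b > 0" using b(1) by (auto simp: B_def)
      obtain c where c: "N = b * c" using dvdN[of b N l] N(1,2) b(1) by (auto elim: dvdE)
      have "c > 0" using c pos by auto
      then have qN: "q = real (k * c) / real N" unfolding b(2) c using pos by simp
      obtain j where j: "j \<le> l" "v = real j / real N" using N(2) by auto
      have "real (k * c) \<le> real j"
        using v(2) pos(1) unfolding qN j(2) by (simp add: divide_le_cancel)
      then have "k * c \<le> l" using j(1) by linarith
      then show ?thesis using N(3) qN by auto
    qed
  qed
qed

lemma charted_grid:
  assumes "charted H \<Gamma>" "finite F" "F \<subseteq> values H"
  shows "\<exists>n c. c > 0 \<and> F \<subseteq> (\<lambda>k. real k * c) ` {..n} \<and> (\<lambda>k. real k * c) ` {..n} \<subseteq> values H"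
proof -
  obtain G where G: "G \<subseteq> carrier H" "finite G" "F = meas H ` G"
    using finite_subset_image[OF assms(2,3)] by blast
  obtain n c \<psi> where \<psi>: "chart H {..<n::nat} c \<psi>" "G \<subseteq> \<psi> ` Pow {..<n}"
    using charted_cover[OF assms(1) G(2,1)] by metis
  have "F \<subseteq> (\<lambda>k. real k * c) ` {..n}"
  proof
    fix v assume "v \<in> F"
    then obtain X where X: "X \<subseteq> {..<n}" "v = meas H (\<psi> X)" using G(3) \<psi>(2) by auto
    have "card X \<le> n" using X(1) by (metis card_lessThan card_mono finite_lessThan)
    then show "v \<in> (\<lambda>k. real k * c) ` {..n}"
      using chartD(3)[OF \<psi>(1) X(1)] X(2) by auto
  qed
  moreover have "(\<lambda>k. real k * c) ` {..n} \<subseteq> values H"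
    using chart_values[OF \<psi>(1)] by (auto simp: mult.commute)
  ultimately show ?thesis using chartD(1)[OF \<psi>(1)] by blast
qed

lemma finite_steinitz_fractions:
  assumes "\<not> infinite_steinitz s"
  obtains n where "n > 0" "fractions s = range (\<lambda>k. real k / real n)"
proof -
  obtain n where n: "n > 0" "s = steinitz_of_nat n"
    using assms unfolding infinite_steinitz_def by blast
  have Om: "Omega s = {b. b dvd n}"
  proof -
    have "b \<in> Omega s \<longleftrightarrow> b dvd n" for b
      unfolding Omega_iff n(2) using n(1)
      by (auto simp: expo_steinitz_of_nat dvd_imp_multiplicity_le dvd_pos_nat intro: multiplicity_le_imp_dvd)
    then show ?thesis by blast
  qed
  have "fractions s = range (\<lambda>k. real k / real n)"
  proof (intro equalityI subsetI)
    fix q assume "q \<in> fractions s"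
    then obtain k b where b: "b dvd n" "q = real k / real b" unfolding fractions_def Om by blast
    obtain c where c: "n = b * c" using b(1) by (rule dvdE)
    have "q = real (k * c) / real n" unfolding b(2) c using c n(1) by simp
    then show "q \<in> range (\<lambda>k. real k / real n)" by blast
  next
    show "q \<in> fractions s" if "q \<in> range (\<lambda>k. real k / real n)" for q
      using that fractionsI[of n s] by (auto simp: Om)
  qed
  then show ?thesis using that n(1) by blast
qed

text \<open>
  After scaling the value of \<open>h\<close> to \<open>1\<close>, the values are an initial segment of the fractions of a
  Steinitz number \<open>s\<close>, and an initial segment is everything, or has a supremum that belongs to it or
  does not; the supremum is at least \<open>1\<close>. For finite \<open>s\<close> a bounded set of fractions is finite.
\<close>

lemma values_cases:
  assumes H: "measure_algebra H" "charted H \<Gamma>" and nonzero: "h \<in> carrier H" "h \<noteq> bzero H"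
  obtains (Std) n \<alpha> where "n \<ge> 1" "\<alpha> > 0" "(*) \<alpha> ` values H = (\<lambda>k. real k / real n) ` {..n}"
  | (Unbounded) s \<alpha> where "\<alpha> > 0" "(*) \<alpha> ` values H = fractions s"
  | (Closed) r s \<alpha> where "1 \<le> r" "infinite_steinitz s" "\<alpha> > 0" "(*) \<alpha> ` values H = fractions s \<inter> {..r}"
  | (Open) r s \<alpha> where "1 \<le> r" "infinite_steinitz s" "\<alpha> > 0" "(*) \<alpha> ` values H = fractions s \<inter> {..<r}"
proof -
  interpret measure_algebra H by fact
  define \<alpha> where "\<alpha> = 1 / meas H h"
  have mh: "meas H h > 0" using meas_nonneg[OF nonzero(1)] meas_eq_zero[OF nonzero(1)] nonzero(2) by simp
  then have \<alpha>: "\<alpha> > 0" by (simp add: \<alpha>_def)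
  define V where "V = (*) \<alpha> ` values H"
  have grid: "\<exists>n c. c > 0 \<and> F \<subseteq> (\<lambda>k. real k * c) ` {..n} \<and> (\<lambda>k. real k * c) ` {..n} \<subseteq> V"
    if F: "finite F" "F \<subseteq> V" for F
  proof -
    obtain G where G: "G \<subseteq> values H" "finite G" "F = (*) \<alpha> ` G"
      using finite_subset_image[OF F(1)] F(2) unfolding V_def by blast
    obtain n c where c: "c > 0" "G \<subseteq> (\<lambda>k. real k * c) ` {..n}" "(\<lambda>k. real k * c) ` {..n} \<subseteq> values H"
      using charted_grid[OF H(2) G(2,1)] by blast
    have eq: "(\<lambda>k. real k * (\<alpha> * c)) ` {..n} = (*) \<alpha> ` (\<lambda>k. real k * c) ` {..n}"
      by (simp add: image_image mult.left_commute)
    have "F \<subseteq> (\<lambda>k. real k * (\<alpha> * c)) ` {..n}" "(\<lambda>k. real k * (\<alpha> * c)) ` {..n} \<subseteq> V"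
      unfolding eq G(3) V_def using c by (intro image_mono; simp)+
    then show ?thesis using \<alpha> c(1) by (intro exI[of _ n] exI[of _ "\<alpha> * c"]) simp
  qed
  have "\<alpha> * meas H h = 1" using mh by (simp add: \<alpha>_def)
  then have one: "1 \<in> V" unfolding V_def using nonzero(1) by (metis imageI)
  obtain s where sub: "V \<subseteq> fractions s"
      and down: "\<And>q v. q \<in> fractions s \<Longrightarrow> v \<in> V \<Longrightarrow> q \<le> v \<Longrightarrow> q \<in> V"
    using initial_segment_of_fractions[OF grid one] by metis
  show ?thesis
  proof (cases "bdd_above V")
    case False
    have "V = fractions s"
    proof
      show "fractions s \<subseteq> V"
      proof
        fix q assume "q \<in> fractions s"
        moreover obtain v where "v \<in> V" "q \<le> v"
          using False unfolding bdd_above_def by (meson linear)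
        ultimately show "q \<in> V" using down by blast
      qed
    qed (fact sub)
    then show ?thesis using Unbounded \<alpha> unfolding V_def by blast
  next
    case True
    define r where "r = Sup V"
    have r: "v \<le> r" if "v \<in> V" for v
      unfolding r_def using that True by (rule cSup_upper)
    have r1: "1 \<le> r" using r one .
    have below: "q \<in> V" if "q \<in> fractions s" "q < r" for q
    proof -
      obtain v where "v \<in> V" "q < v"
        using less_cSupE[of q V] \<open>q < r\<close> one unfolding r_def by blast
      then show ?thesis using down that(1) by force
    qed
    have closed: "V = fractions s \<inter> {..r}" if "r \<in> V"
      using sub down r that by auto
    have opn: "V = fractions s \<inter> {..<r}" if "r \<notin> V"
      using sub below r that by (auto simp: less_le)
    show ?thesis
    proof (cases "infinite_steinitz s")
      case True
      then show ?thesis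
        using Closed[OF r1 True \<alpha>] Open[OF r1 True \<alpha>] closed opn unfolding V_def by blast
    next
      case False
      obtain n where n: "n > 0" "fractions s = range (\<lambda>k. real k / real n)"
        using finite_steinitz_fractions[OF False] .
      define K where "K = {k. real k / real n \<in> V}"
      have "K \<subseteq> {..nat \<lfloor>r * real n\<rfloor>}"
      proof
        fix k assume "k \<in> K"
        then have "real k / real n \<le> r" using r by (simp add: K_def)
        then have "real k \<le> r * real n" using n(1) by (simp add: pos_divide_le_eq)
        then show "k \<in> {..nat \<lfloor>r * real n\<rfloor>}" by (simp add: le_nat_floor)
      qed
      then have "finite K" using finite_subset by blast
      have "n \<in> K" using one n(1) by (simp add: K_def)
      define M where "M = Max K"
      have M: "M \<in> K" "n \<le> M"
        using Max_in[OF \<open>finite K\<close>] Max_ge[OF \<open>finite K\<close> \<open>n \<in> K\<close>] \<open>n \<in> K\<close> unfolding M_def by auto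
      then have "M \<ge> 1" using n(1) by simp
      have "V = (\<lambda>k. real k / real n) ` {..M}"
      proof (intro equalityI subsetI)
        fix v assume v: "v \<in> V"
        then obtain k where k: "v = real k / real n" using sub n(2) by auto
        then have "k \<in> K" using v by (simp add: K_def)
        then have "k \<le> M" using \<open>finite K\<close> unfolding M_def by simp
        then show "v \<in> (\<lambda>k. real k / real n) ` {..M}" using k by auto
      next
        fix v assume "v \<in> (\<lambda>k. real k / real n) ` {..M}"
        then obtain k where k: "v = real k / real n" "k \<le> M" by auto
        have "v \<le> real M / real n" using k n(1) by (simp add: divide_le_cancel)
        then show "v \<in> V" using down[of v "real M / real n"] M(1) k(1) n(2) by (auto simp: K_def)
      qed
      then have "(*) (real n / real M) ` V = (\<lambda>k. real k / real M) ` {..M}"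
        using n(1) by (simp add: image_image)
      then have "(*) (real n / real M * \<alpha>) ` values H = (\<lambda>k. real k / real M) ` {..M}"
        unfolding V_def by (simp add: image_image mult.assoc)
      moreover have "real n / real M * \<alpha> > 0" using n(1) \<open>M \<ge> 1\<close> \<alpha> by simp
      ultimately show ?thesis using Std \<open>M \<ge> 1\<close> by blast
    qed
  qed
qed

section \<open>Transport along isomorphisms\<close>

lemma alg_isoD:
  assumes "alg_iso C T \<kappa>"
  shows "bij_betw \<kappa> (carrier C) (carrier T)" and "x \<in> carrier C \<Longrightarrow> \<kappa> x \<in> carrier T"
    and "x \<in> carrier C \<Longrightarrow> y \<in> carrier C \<Longrightarrow> badd T (\<kappa> x) (\<kappa> y) = \<kappa> (badd C x y)"
    and "x \<in> carrier C \<Longrightarrow> y \<in> carrier C \<Longrightarrow> bmul T (\<kappa> x) (\<kappa> y) = \<kappa> (bmul C x y)"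
    and "x \<in> carrier C \<Longrightarrow> y \<in> carrier C \<Longrightarrow> \<kappa> x = \<kappa> y \<longleftrightarrow> x = y"
  using assms unfolding alg_iso_def by (auto simp: bij_betw_def inj_on_def)

lemma alg_iso_surj:
  assumes "alg_iso C T \<kappa>" "t \<in> carrier T"
  obtains x where "x \<in> carrier C" "t = \<kappa> x"
  using bij_betw_imp_surj_on[OF alg_isoD(1)[OF assms(1)]] assms(2) by blast

lemma F2_boolean_algebra_transport:
  assumes C: "F2_boolean_algebra C" and iso: "alg_iso C T \<kappa>" and zero: "bzero T = \<kappa> (bzero C)"
  shows "F2_boolean_algebra T"
proof -
  interpret F2_boolean_algebra C by fact
  note surj = alg_iso_surj[OF iso] and iso = alg_isoD[OF iso]
  show ?thesis
  proof (rule F2_boolean_algebraI)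
    show "bzero T \<in> carrier T" using iso(2) zero by simp
    show "badd T x y \<in> carrier T" "bmul T x y \<in> carrier T" "badd T x y = badd T y x"
      "bmul T x y = bmul T y x" if xy: "x \<in> carrier T" "y \<in> carrier T" for x y
    proof -
      obtain x' where x': "x' \<in> carrier C" "x = \<kappa> x'" using surj[OF xy(1)] .
      obtain y' where y': "y' \<in> carrier C" "y = \<kappa> y'" using surj[OF xy(2)] .
      note [simp] = x' y' iso(3,4)
      show "badd T x y \<in> carrier T" "bmul T x y \<in> carrier T" by (simp_all add: iso(2) bmul_closed)
      show "badd T x y = badd T y x" by (simp add: add.m_comm)
      show "bmul T x y = bmul T y x" by (simp add: bmul_comm)
    qed
    show "badd T (bzero T) x = x" "badd T x x = bzero T" "bmul T x x = x" if x: "x \<in> carrier T" for x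
    proof -
      obtain x' where x': "x' \<in> carrier C" "x = \<kappa> x'" using surj[OF x] .
      show "badd T (bzero T) x = x" "badd T x x = bzero T" "bmul T x x = x"
        by (simp_all add: x' zero iso(3,4) char_two idem)
    qed
    fix x y z assume xyz: "x \<in> carrier T" "y \<in> carrier T" "z \<in> carrier T"
    obtain x' where x': "x' \<in> carrier C" "x = \<kappa> x'" using surj[OF xyz(1)] .
    obtain y' where y': "y' \<in> carrier C" "y = \<kappa> y'" using surj[OF xyz(2)] .
    obtain z' where z': "z' \<in> carrier C" "z = \<kappa> z'" using surj[OF xyz(3)] .
    note [simp] = x' y' z' iso(3,4) bmul_closed
    show "badd T (badd T x y) z = badd T x (badd T y z)" by (simp add: add.m_assoc)
    show "bmul T (bmul T x y) z = bmul T x (bmul T y z)" by (simp add: bmul_assoc)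
    show "bmul T (badd T x y) z = badd T (bmul T x z) (bmul T y z)" by (simp add: distrib)
  qed
qed

lemma is_measure_transport:
  assumes C: "F2_boolean_algebra C" and iso: "alg_iso C T \<kappa>" and zero: "bzero T = \<kappa> (bzero C)"
  shows "is_measure T \<nu> \<longleftrightarrow> is_measure C (\<lambda>x. \<nu> (\<kappa> x))"
proof -
  interpret F2_boolean_algebra C by fact
  note iso = alg_isoD[OF iso]
  have car: "carrier T = \<kappa> ` carrier C" using bij_betw_imp_surj_on[OF iso(1)] by simp
  show ?thesis
    unfolding is_measure_def car by (simp add: iso(3-5) zero bmul_closed cong: ball_cong)
qed

lemma countable_transport: "alg_iso C T \<kappa> \<Longrightarrow> countable (carrier C) \<Longrightarrow> countable (carrier T)"
  using alg_isoD(1) bij_betw_imp_surj_on by (metis countable_image)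

section \<open>Formal sums modulo relations\<close>

lemma bit_poly_add_self [simp]: "p + p = (0 :: 'g \<Rightarrow>\<^sub>0 bit)"
  by (rule poly_mapping_eqI) (simp add: lookup_add)

lemma bit_poly_add_cancel [simp]: "p + (p + q) = (q :: 'g \<Rightarrow>\<^sub>0 bit)"
  by (simp flip: add.assoc)

lemma keys_gen [simp]: "Poly_Mapping.keys (gen g) = {g}"
  by (simp add: gen_def)

lemma keys_gen_add:
  "Poly_Mapping.keys (gen g + q) =
     (if g \<in> Poly_Mapping.keys q then Poly_Mapping.keys q - {g} else insert g (Poly_Mapping.keys q))"
  by (auto simp: in_keys_iff lookup_add gen_def lookup_single when_def split: if_splits)

lemma bit_poly_induct [case_names zero add]:
  fixes p :: "'g \<Rightarrow>\<^sub>0 bit"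
  assumes zero: "P 0"
    and add: "\<And>g p. g \<notin> Poly_Mapping.keys p \<Longrightarrow> P p \<Longrightarrow> P (gen g + p)"
  shows "P p"
proof (induction "card (Poly_Mapping.keys p)" arbitrary: p)
  case 0
  then show ?case using zero by simp
next
  case (Suc n)
  then obtain g where g: "g \<in> Poly_Mapping.keys p" by (metis card.empty equals0I nat.simps(3))
  have keys: "Poly_Mapping.keys (gen g + p) = Poly_Mapping.keys p - {g}"
    using g by (simp add: keys_gen_add)
  then have "card (Poly_Mapping.keys (gen g + p)) = n"
    using g Suc.hyps(2) by simp
  then have "P (gen g + p)" using Suc.hyps(1) by simp
  moreover have "g \<notin> Poly_Mapping.keys (gen g + p)" using keys by simp
  ultimately have "P (gen g + (gen g + p))" by (rule add[rotated])
  then show ?case by simp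
qed

lemma F2_span_base: "r \<in> R \<Longrightarrow> r \<in> F2_span R"
  unfolding F2_span_def by (rule hull_inc)

lemma F2_span_closed: "0 \<in> F2_span R \<and> (\<forall>x\<in>F2_span R. \<forall>y\<in>F2_span R. x + y \<in> F2_span R)"
  unfolding F2_span_def by (rule hull_in) auto

lemma F2_span_zero [simp]: "0 \<in> F2_span R"
  using F2_span_closed by blast

lemma F2_span_add: "x \<in> F2_span R \<Longrightarrow> y \<in> F2_span R \<Longrightarrow> x + y \<in> F2_span R"
  using F2_span_closed by blast

lemma F2_span_minimal:
  assumes "R \<subseteq> N" "0 \<in> N" "\<And>x y. x \<in> N \<Longrightarrow> y \<in> N \<Longrightarrow> x + y \<in> N"
  shows "F2_span R \<subseteq> N"
  unfolding F2_span_def using assms by (intro hull_minimal) auto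

text \<open>
  In characteristic 2 a difference is a sum.
\<close>

definition rel_cong :: "('g \<Rightarrow>\<^sub>0 bit) set \<Rightarrow> ('g \<Rightarrow>\<^sub>0 bit) \<Rightarrow> ('g \<Rightarrow>\<^sub>0 bit) \<Rightarrow> bool" where
  "rel_cong R p q \<longleftrightarrow> p + q \<in> F2_span R"

lemma rel_cong_refl [simp]: "rel_cong R p p"
  by (simp add: rel_cong_def)

lemma rel_cong_sym: "rel_cong R p q \<Longrightarrow> rel_cong R q p"
  by (simp add: rel_cong_def add.commute)

lemma rel_cong_add: "rel_cong R p q \<Longrightarrow> rel_cong R p' q' \<Longrightarrow> rel_cong R (p + p') (q + q')"
  unfolding rel_cong_def using F2_span_add[of "p + q" R "p' + q'"] by (simp add: ac_simps)

lemma rel_cong_trans [trans]: "rel_cong R p q \<Longrightarrow> rel_cong R q r \<Longrightarrow> rel_cong R p r"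
  unfolding rel_cong_def using F2_span_add[of "p + q" R "q + r"]
  by (simp add: ac_simps)

lemma rel_cong_sum: "(\<And>x. x \<in> A \<Longrightarrow> rel_cong R (f x) (g x)) \<Longrightarrow> rel_cong R (sum f A) (sum g A)"
  by (induction A rule: infinite_finite_induct) (auto intro: rel_cong_add)

lemma rel_cong_zero: "rel_cong R p 0 \<longleftrightarrow> p \<in> F2_span R"
  by (simp add: rel_cong_def)

lemma rel_cong_base: "p + q + r \<in> R \<Longrightarrow> rel_cong R p (q + r)"
  unfolding rel_cong_def using F2_span_base by (metis add.assoc)

section \<open>Recognising presented algebras\<close>

text \<open>
  Additivity of a measure applies to such sums, by induction on the number of generators.
\<close>

inductive disjoint_sum :: "('c, 'm) bool_alg_scheme \<Rightarrow> 'g set \<Rightarrow> ('g \<Rightarrow> 'c) \<Rightarrow> 'c \<Rightarrow> bool"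
  for C G \<Phi> where
  zero: "disjoint_sum C G \<Phi> (bzero C)"
| add: "g \<in> G \<Longrightarrow> disjoint_sum C G \<Phi> c \<Longrightarrow> bmul C (\<Phi> g) c = bzero C \<Longrightarrow>
          disjoint_sum C G \<Phi> (badd C (\<Phi> g) c)"

text \<open>
  A concrete measure algebra \<open>C\<close> realises a presentation if the generators have images in \<open>C\<close>
  satisfying the relations, and every element of \<open>C\<close> has a normal form, a formal sum to which
  the formal sums with that value are congruent.  That elements are sums of disjoint generators
  makes a measure determined by its values on generators.
\<close>

locale presentation = measure_algebra C for C :: "'c meas_alg" +
  fixes G :: "'g set" and m :: "'g \<Rightarrow> 'g \<Rightarrow> 'g" and R :: "('g \<Rightarrow>\<^sub>0 bit) set"
    and \<Phi> :: "'g \<Rightarrow> 'c" and normal :: "'c \<Rightarrow> ('g \<Rightarrow>\<^sub>0 bit)"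
  assumes image_closed: "g \<in> G \<Longrightarrow> \<Phi> g \<in> carrier C"
    and mult_closed: "g \<in> G \<Longrightarrow> h \<in> G \<Longrightarrow> m g h \<in> G"
    and image_mult: "g \<in> G \<Longrightarrow> h \<in> G \<Longrightarrow> \<Phi> (m g h) = bmul C (\<Phi> g) (\<Phi> h)"
    and rel_additive: "r \<in> R \<Longrightarrow>
          \<exists>x\<in>G. \<exists>y\<in>G. \<exists>z\<in>G. r = gen x + gen y + gen z \<and> \<Phi> x = badd C (\<Phi> y) (\<Phi> z)"
    and normal_zero: "rel_cong R (normal (bzero C)) 0"
    and normal_add: "c \<in> carrier C \<Longrightarrow> d \<in> carrier C \<Longrightarrow>
          rel_cong R (normal (badd C c d)) (normal c + normal d)"
    and normal_gen: "g \<in> G \<Longrightarrow> rel_cong R (gen g) (normal (\<Phi> g))"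
    and generated: "c \<in> carrier C \<Longrightarrow> disjoint_sum C G \<Phi> c"
begin

definition ev :: "('g \<Rightarrow>\<^sub>0 bit) \<Rightarrow> 'c" where
  "ev p = bsum \<Phi> (Poly_Mapping.keys p)"

lemma ev_closed: "Poly_Mapping.keys p \<subseteq> G \<Longrightarrow> ev p \<in> carrier C"
  unfolding ev_def by (intro bsum_closed image_closed) auto

lemma ev_zero [simp]: "ev 0 = bzero C"
  by (simp add: ev_def)

lemma ev_gen_add:
  assumes g: "g \<in> G" and q: "Poly_Mapping.keys q \<subseteq> G"
  shows "ev (gen g + q) = badd C (\<Phi> g) (ev q)"
proof (cases "g \<in> Poly_Mapping.keys q")
  case True
  have car: "ev (gen g + q) \<in> carrier C"
    using q g by (intro ev_closed) (auto simp: keys_gen_add)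
  have "ev q = badd C (\<Phi> g) (ev (gen g + q))"
    using bsum_insert[of "Poly_Mapping.keys q - {g}" g \<Phi>] True q g image_closed
    by (auto simp: ev_def keys_gen_add insert_absorb)
  then show ?thesis using add_cancel[OF image_closed[OF g] car] by simp
next
  case False
  then show ?thesis
    using bsum_insert[of "Poly_Mapping.keys q" g \<Phi>] q g image_closed
    by (auto simp: ev_def keys_gen_add)
qed

lemma ev_gen: "g \<in> G \<Longrightarrow> ev (gen g) = \<Phi> g"
  using ev_gen_add[of g 0] image_closed by simp

lemma keys_add_closed:
  "Poly_Mapping.keys p \<subseteq> G \<Longrightarrow> Poly_Mapping.keys q \<subseteq> G \<Longrightarrow> Poly_Mapping.keys (p + q) \<subseteq> G"
  using Poly_Mapping.keys_add[of p q] by blast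

lemma ev_add:
  "Poly_Mapping.keys p \<subseteq> G \<Longrightarrow> Poly_Mapping.keys q \<subseteq> G \<Longrightarrow> ev (p + q) = badd C (ev p) (ev q)"
proof (induction p rule: bit_poly_induct)
  case zero
  then show ?case by (simp add: ev_closed)
next
  case (add g p)
  have g: "g \<in> G" and p: "Poly_Mapping.keys p \<subseteq> G" using add by (auto simp: keys_gen_add)
  have "ev (gen g + p + q) = badd C (\<Phi> g) (ev (p + q))"
    unfolding add.assoc by (rule ev_gen_add[OF g keys_add_closed[OF p add.prems(2)]])
  also have "\<dots> = badd C (badd C (\<Phi> g) (ev p)) (ev q)"
    using add.IH p add.prems(2) g by (simp add: add.m_assoc image_closed ev_closed)
  also have "\<dots> = badd C (ev (gen g + p)) (ev q)"
    using ev_gen_add[OF g p] by simp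
  finally show ?case .
qed

lemma ev_normal: 
  assumes "Poly_Mapping.keys p \<subseteq> G"
  shows "rel_cong R p (normal (ev p))"
  using assms
proof (induction p rule: bit_poly_induct)
  case zero
  then show ?case using rel_cong_sym[OF normal_zero] by simp
next
  case (add g p)
  have g: "g \<in> G" and p: "Poly_Mapping.keys p \<subseteq> G" using add by (auto simp: keys_gen_add)
  have "rel_cong R (gen g + p) (normal (\<Phi> g) + normal (ev p))"
    using rel_cong_add[OF normal_gen[OF g] add.IH[OF p]] .
  also have "rel_cong R (normal (\<Phi> g) + normal (ev p)) (normal (badd C (\<Phi> g) (ev p)))"
    using rel_cong_sym[OF normal_add[OF image_closed[OF g] ev_closed[OF p]]] .
  finally show ?case using ev_gen_add[OF g p] by simp
qed

lemma rel_holds: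
  assumes "r \<in> R"
  shows "Poly_Mapping.keys r \<subseteq> G" and "ev r = bzero C"
proof -
  obtain x y z where x: "x \<in> G" and y: "y \<in> G" and z: "z \<in> G"
      and r: "r = gen x + gen y + gen z" and eq: "\<Phi> x = badd C (\<Phi> y) (\<Phi> z)"
    using rel_additive[OF assms] by blast
  have yz: "Poly_Mapping.keys (gen y + gen z) \<subseteq> G" using keys_add_closed[of "gen y" "gen z"] y z by simp
  then have xyz: "Poly_Mapping.keys (gen x + (gen y + gen z)) \<subseteq> G" 
    using keys_add_closed[of "gen x" "gen y + gen z"] x by simp
  then show "Poly_Mapping.keys r \<subseteq> G" by (simp add: r add.assoc)
  have "ev (gen y + gen z) = badd C (\<Phi> y) (\<Phi> z)"
    using ev_gen_add[OF y, of "gen z"] ev_gen[OF z] z by simp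
  then have "ev (gen x + (gen y + gen z)) = bzero C"
    using ev_gen_add[OF x yz] eq char_two[OF image_closed[OF x]] by simp
  then show "ev r = bzero C" by (simp add: r add.assoc)
qed

text \<open>
  The relations hold in \<open>C\<close>, and conversely a formal sum with value zero is congruent to the normal
  form of zero.
\<close>

lemma F2_span_eq: "F2_span R = {p. Poly_Mapping.keys p \<subseteq> G \<and> ev p = bzero C}"
proof (intro equalityI)
  show "F2_span R \<subseteq> {p. Poly_Mapping.keys p \<subseteq> G \<and> ev p = bzero C}"
    using rel_holds by (intro F2_span_minimal) (auto simp: ev_add dest: keys_add_closed)
  show "{p. Poly_Mapping.keys p \<subseteq> G \<and> ev p = bzero C} \<subseteq> F2_span R"
  proof
    fix p assume "p \<in> {p. Poly_Mapping.keys p \<subseteq> G \<and> ev p = bzero C}"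
    then have "rel_cong R p (normal (bzero C))" using ev_normal[of p] by auto
    then show "p \<in> F2_span R" using normal_zero rel_cong_trans rel_cong_zero by blast
  qed
qed

text \<open>
  The cosets of the span of the relations are the fibres of evaluation, which identifies the
  presented algebra with \<open>C\<close>.
\<close>

definition fibre :: "'c \<Rightarrow> ('g \<Rightarrow>\<^sub>0 bit) set" where
  "fibre c = {p. Poly_Mapping.keys p \<subseteq> G \<and> ev p = c}"

lemma coset_eq_fibre:
  assumes "Poly_Mapping.keys p \<subseteq> G"
  shows "coset (F2_span R) p = fibre (ev p)"
proof (intro equalityI subsetI)
  fix q assume "q \<in> coset (F2_span R) p"
  then obtain z where "q = p + z" "Poly_Mapping.keys z \<subseteq> G" "ev z = bzero C"
    unfolding coset_def F2_span_eq by blast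
  then show "q \<in> fibre (ev p)"
    using assms by (auto simp: fibre_def ev_add ev_closed dest: keys_add_closed)
next
  fix q assume q: "q \<in> fibre (ev p)"
  then have "ev (p + q) = bzero C" "Poly_Mapping.keys (p + q) \<subseteq> G"
    using assms ev_add[of p q] keys_add_closed[of p q] char_two[OF ev_closed[OF assms]] by (auto simp: fibre_def)
  then have "p + q \<in> F2_span R" by (simp add: F2_span_eq)
  then have "p + (p + q) \<in> coset (F2_span R) p" unfolding coset_def by (rule imageI)
  then show "q \<in> coset (F2_span R) p" by simp
qed

lemma fibre_nonempty: 
  assumes "c \<in> carrier C"
  shows "\<exists>p. p \<in> fibre c"
  using generated[OF assms]
proof induction
  case zero
  then show ?case by (intro exI[of _ 0]) (simp add: fibre_def)
next
  case (add g c)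
  then obtain p where p: "Poly_Mapping.keys p \<subseteq> G" "ev p = c" by (auto simp: fibre_def)
  have "gen g + p \<in> fibre (badd C (\<Phi> g) c)"
    using p add.hyps(1) ev_gen_add[of g p] by (auto simp: fibre_def keys_gen_add split: if_splits)
  then show ?case ..
qed

lemma ev_formal_mul:
  assumes "Poly_Mapping.keys p \<subseteq> G" and q: "Poly_Mapping.keys q \<subseteq> G"
  shows "Poly_Mapping.keys (formal_mul m p q) \<subseteq> G \<and> ev (formal_mul m p q) = bmul C (ev p) (ev q)"
proof -
  have inner: "Poly_Mapping.keys (\<Sum>h\<in>Q. gen (m g h)) \<subseteq> G \<and>
      ev (\<Sum>h\<in>Q. gen (m g h)) = bmul C (\<Phi> g) (bsum \<Phi> Q)" if "finite Q" "Q \<subseteq> G" "g \<in> G" for Q g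
    using that(1,2)
  proof (induction Q rule: finite_induct)
    case empty
    then show ?case using mul_zero image_closed that(3) by simp
  next
    case (insert h Q)
    have Q: "bsum \<Phi> Q \<in> carrier C" using insert.prems by (intro bsum_closed image_closed) auto
    have mgh: "m g h \<in> G" using mult_closed that(3) insert.prems by simp
    have "ev (gen (m g h) + (\<Sum>h\<in>Q. gen (m g h))) = badd C (bmul C (\<Phi> g) (\<Phi> h)) (bmul C (\<Phi> g) (bsum \<Phi> Q))"
      using ev_gen_add[OF mgh] insert image_mult that(3) by simp
    also have "\<dots> = bmul C (\<Phi> g) (bsum \<Phi> (insert h Q))"
      using insert image_closed that(3) Q by (subst bsum_insert) (auto simp: distrib_left)
    finally show ?case using insert keys_add_closed[of "gen (m g h)" "\<Sum>h\<in>Q. gen (m g h)"] mgh by simp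
  qed
  have "Poly_Mapping.keys (\<Sum>g\<in>P. \<Sum>h\<in>Poly_Mapping.keys q. gen (m g h)) \<subseteq> G \<and>
      ev (\<Sum>g\<in>P. \<Sum>h\<in>Poly_Mapping.keys q. gen (m g h)) = bmul C (bsum \<Phi> P) (ev q)"
    if "finite P" "P \<subseteq> G" for P
    using that
  proof (induction P rule: finite_induct)
    case empty
    then show ?case using zero_mul ev_closed[OF q] by simp
  next
    case (insert g P)
    have P: "bsum \<Phi> P \<in> carrier C" using insert.prems by (intro bsum_closed image_closed) auto
    have g: "g \<in> G" using insert.prems by simp
    note in_g = inner[OF finite_keys q g, folded ev_def]
    have "ev ((\<Sum>h\<in>Poly_Mapping.keys q. gen (m g h)) + (\<Sum>g\<in>P. \<Sum>h\<in>Poly_Mapping.keys q. gen (m g h))) =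
        badd C (bmul C (\<Phi> g) (ev q)) (bmul C (bsum \<Phi> P) (ev q))"
      using in_g insert by (subst ev_add) auto
    also have "\<dots> = bmul C (bsum \<Phi> (insert g P)) (ev q)"
      using insert image_closed g P ev_closed[OF q] by (subst bsum_insert) (auto simp: distrib)
    finally show ?case
      using insert in_g
        keys_add_closed[of "\<Sum>h\<in>Poly_Mapping.keys q. gen (m g h)"
          "\<Sum>g\<in>P. \<Sum>h\<in>Poly_Mapping.keys q. gen (m g h)"] by simp
  qed
  from this[OF finite_keys assms(1)] show ?thesis
    unfolding formal_mul_def ev_def .
qed

lemma presented_iso: "alg_iso C (presented_alg G m R) fibre"
  and presented_zero: "bzero (presented_alg G m R) = fibre (bzero C)"
proof -
  let ?T = "presented_alg G m R"
  have "carrier ?T = fibre ` carrier C"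
  proof (intro equalityI subsetI)
    show "X \<in> fibre ` carrier C" if "X \<in> carrier ?T" for X
      using that coset_eq_fibre ev_closed by (auto simp: presented_alg_def)
    show "X \<in> carrier ?T" if X: "X \<in> fibre ` carrier C" for X
    proof -
      obtain c p where c: "c \<in> carrier C" "X = fibre c" "p \<in> fibre c"
        using X fibre_nonempty by blast
      then have "X = coset (F2_span R) p" "Poly_Mapping.keys p \<subseteq> G"
        using coset_eq_fibre[of p] by (auto simp: fibre_def)
      then show ?thesis by (auto simp: presented_alg_def)
    qed
  qed
  moreover have "inj_on fibre (carrier C)"
  proof (rule inj_onI)
    fix c d assume *: "c \<in> carrier C" "d \<in> carrier C" "fibre c = fibre d"
    then obtain p where "p \<in> fibre c" "p \<in> fibre d" using fibre_nonempty by blast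
    then show "c = d" by (simp add: fibre_def)
  qed
  ultimately have bij: "bij_betw fibre (carrier C) (carrier ?T)"
    by (simp add: bij_betw_def)
  have "badd ?T (fibre c) (fibre d) = fibre (badd C c d)" "bmul ?T (fibre c) (fibre d) = fibre (bmul C c d)"
    if cd: "c \<in> carrier C" "d \<in> carrier C" for c d
  proof -
    obtain p q where pq: "p \<in> fibre c" "q \<in> fibre d" using fibre_nonempty cd by blast
    have "coset (F2_span R) (p + q) = fibre (badd C c d)" 
      "coset (F2_span R) (formal_mul m p q) = fibre (bmul C c d)"
      if "p \<in> fibre c" "q \<in> fibre d" for p q
      using that coset_eq_fibre[OF keys_add_closed[of p q]] ev_add[of p q]
        ev_formal_mul[of p q] coset_eq_fibre[of "formal_mul m p q"]
      by (auto simp: fibre_def)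
    then have "(\<Union>p\<in>fibre c. \<Union>q\<in>fibre d. coset (F2_span R) (p + q)) = fibre (badd C c d)"
      "(\<Union>p\<in>fibre c. \<Union>q\<in>fibre d. coset (F2_span R) (formal_mul m p q)) = fibre (bmul C c d)"
      using pq by auto
    then show "badd ?T (fibre c) (fibre d) = fibre (badd C c d)" 
      "bmul ?T (fibre c) (fibre d) = fibre (bmul C c d)"
      by (simp_all add: presented_alg_def)
  qed
  then show "alg_iso C ?T fibre" using bij by (simp add: alg_iso_def)
  show "bzero ?T = fibre (bzero C)"
    by (simp add: presented_alg_def fibre_def F2_span_eq)
qed

text \<open>
  The measure prescribed on generators exists, by transport from \<open>C\<close>, and is unique, so
  the definite description picks the transported one.
\<close>

theorem with_measure_presented:
  fixes e :: "'g \<Rightarrow> ('g \<Rightarrow>\<^sub>0 bit) set" and w :: "'g \<Rightarrow> real"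
  assumes e: "\<And>g. g \<in> G \<Longrightarrow> e g = coset (F2_span R) (gen g)"
    and w: "\<And>g. g \<in> G \<Longrightarrow> w g = meas C (\<Phi> g)"
  defines "T \<equiv> with_measure (presented_alg G m R) G e w"
  shows "measure_algebra T" and "alg_iso C T fibre" and "bzero T = fibre (bzero C)"
    and "\<And>c. c \<in> carrier C \<Longrightarrow> meas T (fibre c) = meas C c"
    and "\<And>g. g \<in> G \<Longrightarrow> e g = fibre (\<Phi> g)"
proof -
  let ?T = "presented_alg G m R"
  have alg: "F2_boolean_algebra C" ..
  note iso = alg_isoD[OF presented_iso]
  define \<nu> where "\<nu> = restrict (\<lambda>X. meas C (inv_into (carrier C) fibre X)) (carrier ?T)"
  have \<nu>: "\<nu> (fibre c) = meas C c" if "c \<in> carrier C" for c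
    using that iso(1,2) by (simp add: \<nu>_def bij_betw_def)
  show eg: "e g = fibre (\<Phi> g)" if "g \<in> G" for g
    using e[OF that] coset_eq_fibre[of "gen g"] ev_gen[OF that] that by simp
  have cong: "is_measure C \<mu>" if "\<And>c. c \<in> carrier C \<Longrightarrow> \<mu> c = meas C c" for \<mu>
    using measure that unfolding is_measure_def by (auto simp: bmul_closed)
  have "meas T = \<nu>"
    unfolding T_def with_measure_def
  proof (simp, rule the_equality, intro conjI ballI)
    show "\<nu> \<in> extensional (carrier ?T)" by (simp add: \<nu>_def)
    show "is_measure ?T \<nu>"
      unfolding is_measure_transport[OF alg presented_iso presented_zero] using \<nu> by (rule cong)
    show "\<nu> (e g) = w g" if "g \<in> G" for g
      using that \<nu> image_closed by (simp add: eg w)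
    fix \<mu> assume \<mu>: "\<mu> \<in> extensional (carrier ?T) \<and> is_measure ?T \<mu> \<and> (\<forall>g\<in>G. \<mu> (e g) = w g)"
    then have m: "is_measure C (\<lambda>c. \<mu> (fibre c))"
      using is_measure_transport[OF alg presented_iso presented_zero] by blast
    have "\<mu> (fibre c) = meas C c \<and> c \<in> carrier C" if "c \<in> carrier C" for c
      using generated[OF that]
    proof induction
      case zero
      then show ?case using is_measureD(2)[OF m, of "bzero C"] by simp
    next
      case (add g c)
      then show ?case
        using is_measureD(3)[OF m image_closed[OF add.hyps(1)], of c] meas_add[OF image_closed[OF add.hyps(1)], of c]
          \<mu> eg[OF add.hyps(1)] w[OF add.hyps(1)] image_closed[OF add.hyps(1)] by auto
    qed
    then have agree: "\<mu> (fibre c) = \<nu> (fibre c)" if "c \<in> carrier C" for c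
      using \<nu> that by simp
    show "\<mu> = \<nu>"
    proof (rule extensionalityI)
      show "\<mu> \<in> extensional (carrier ?T)" using \<mu> by blast
      show "\<nu> \<in> extensional (carrier ?T)" by (simp add: \<nu>_def)
      fix X assume "X \<in> carrier ?T"
      then obtain c where "c \<in> carrier C" "X = fibre c" by (rule alg_iso_surj[OF presented_iso])
      then show "\<mu> X = \<nu> X" using agree by simp
    qed
  qed
  moreover have fields: "carrier T = carrier ?T" "badd T = badd ?T" "bmul T = bmul ?T" "bzero T = bzero ?T"
    by (simp_all add: T_def with_measure_def)
  ultimately show meas: "\<And>c. c \<in> carrier C \<Longrightarrow> meas T (fibre c) = meas C c"
    using \<nu> by simp
  show iso: "alg_iso C T fibre" using presented_iso unfolding alg_iso_def fields .
  show zero: "bzero T = fibre (bzero C)" unfolding fields by (rule presented_zero)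
  have "is_measure T (meas T)"
    unfolding is_measure_transport[OF alg iso zero] using meas by (rule cong)
  then show "measure_algebra T"
    using F2_boolean_algebra_transport[OF alg iso zero]
    by (simp add: measure_algebra_def measure_algebra_axioms_def)
qed

end

text \<open>
  A formal sum over the field of order 2 is determined by its finite set of keys.
\<close>

lemma countable_presented_alg:
  fixes G :: "'g set"
  assumes "countable G"
  shows "countable (carrier (presented_alg G m R))"
proof -
  have "inj_on Poly_Mapping.keys {p :: 'g \<Rightarrow>\<^sub>0 bit. Poly_Mapping.keys p \<subseteq> G}"
  proof (rule inj_onI)
    fix p q :: "'g \<Rightarrow>\<^sub>0 bit" assume *: "Poly_Mapping.keys p = Poly_Mapping.keys q"
    have "Poly_Mapping.lookup p g = Poly_Mapping.lookup q g" for g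
    proof -
      have "Poly_Mapping.lookup p g = 0 \<longleftrightarrow> Poly_Mapping.lookup q g = 0"
        using * by (simp flip: not_in_keys_iff_lookup_eq_zero)
      then show ?thesis by (cases "Poly_Mapping.lookup p g"; cases "Poly_Mapping.lookup q g") auto
    qed
    then show "p = q" by (rule poly_mapping_eqI)
  qed
  moreover have "countable (Poly_Mapping.keys ` {p :: 'g \<Rightarrow>\<^sub>0 bit. Poly_Mapping.keys p \<subseteq> G})"
    by (rule countable_subset[OF _ countable_Collect_finite_subset[OF assms]]) auto
  ultimately have "countable {p :: 'g \<Rightarrow>\<^sub>0 bit. Poly_Mapping.keys p \<subseteq> G}"
    by (rule countable_image_inj_on[rotated])
  then show ?thesis by (simp add: presented_alg_def)
qed

lemma charted_transport:
  assumes iso: "alg_iso C T \<kappa>" and meas: "\<And>x. x \<in> carrier C \<Longrightarrow> meas T (\<kappa> x) = meas C x"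
    and C: "charted C \<Gamma>"
  shows "charted T \<Gamma>"
proof -
  note iso' = alg_isoD[OF iso]
  have hom: "scaling_hom C T 1 \<kappa>"
    unfolding scaling_hom_def using iso' meas by simp
  show ?thesis
    unfolding charted_def
  proof (intro conjI allI impI)
    fix F assume F: "finite F \<and> F \<subseteq> carrier T"
    have "carrier T = \<kappa> ` carrier C" using bij_betw_imp_surj_on[OF iso'(1)] by simp
    then obtain E where E: "E \<subseteq> carrier C" "finite E" "F = \<kappa> ` E"
      using finite_subset_image[of F \<kappa> "carrier C"] F by metis
    obtain n c \<psi> where \<psi>: "(n, c) \<in> \<Gamma>" "chart C {..<n} c \<psi>" "E \<subseteq> \<psi> ` Pow {..<n}"
      using charted_cover[OF C E(2,1)] .
    have "chart T {..<n} c (\<lambda>X. \<kappa> (\<psi> X))" using chart_image[OF \<psi>(2) hom] by simp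
    moreover have "F \<subseteq> (\<lambda>X. \<kappa> (\<psi> X)) ` Pow {..<n}"
      using \<psi>(3) unfolding E(3) by (metis image_image image_mono)
    ultimately show "\<exists>n c \<psi>. (n, c) \<in> \<Gamma> \<and> chart T {..<n} c \<psi> \<and> F \<subseteq> \<psi> ` Pow {..<n}"
      using \<psi>(1) by (intro exI conjI)
  next
    fix n c assume "(n, c) \<in> \<Gamma>"
    then obtain \<psi> where "chart C {..<n} c \<psi>" using charted_realised[OF C] by blast
    from chart_image[OF this hom] show "\<exists>\<psi>. chart T {..<n} c \<psi>" by auto
  qed
qed

section \<open>Tensor products with an atomic algebra\<close>

text \<open>
  This covers the standard algebras and \<open>H_infinity\<close> at once: the elements of \<open>A\<close> are, via \<open>\<iota>\<close>, the
  finite sets of atoms. The atoms are indexed by a set \<open>I\<close> which may be empty, whence the separate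
  weight \<open>w\<close>.
\<close>

locale atomic = measure_algebra A for A :: "'a meas_alg" +
  fixes I :: "'i set" and \<iota> :: "'a \<Rightarrow> 'i set" and w :: real
  assumes bij: "bij_betw \<iota> (carrier A) {X. finite X \<and> X \<subseteq> I}"
    and \<iota>_add: "x \<in> carrier A \<Longrightarrow> y \<in> carrier A \<Longrightarrow> \<iota> (badd A x y) = sym_diff (\<iota> x) (\<iota> y)"
    and \<iota>_mul: "x \<in> carrier A \<Longrightarrow> y \<in> carrier A \<Longrightarrow> \<iota> (bmul A x y) = \<iota> x \<inter> \<iota> y"
    and \<iota>_meas: "x \<in> carrier A \<Longrightarrow> meas A x = w * real (card (\<iota> x))"
    and w_pos: "w > 0"
begin

lemma \<iota>_finite: "x \<in> carrier A \<Longrightarrow> finite (\<iota> x)"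
  and \<iota>_subset: "x \<in> carrier A \<Longrightarrow> \<iota> x \<subseteq> I"
  using bij unfolding bij_betw_def by auto

definition el :: "'i set \<Rightarrow> 'a" where
  "el = inv_into (carrier A) \<iota>"

lemma el: "finite X \<Longrightarrow> X \<subseteq> I \<Longrightarrow> el X \<in> carrier A \<and> \<iota> (el X) = X"
  using bij unfolding el_def bij_betw_def by (metis (mono_tags) f_inv_into_f inv_into_into mem_Collect_eq)

lemma \<iota>_inj: "x \<in> carrier A \<Longrightarrow> y \<in> carrier A \<Longrightarrow> \<iota> x = \<iota> y \<Longrightarrow> x = y"
  using bij unfolding bij_betw_def inj_on_def by blast

lemma \<iota>_zero: "\<iota> (bzero A) = {}"
  using \<iota>_add[of "bzero A" "bzero A"] by simp

lemma el_empty: "el {} = bzero A"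
  using el[of "{}"] by (intro \<iota>_inj) (auto simp: \<iota>_zero)

lemma el_insert: "finite X \<Longrightarrow> insert i X \<subseteq> I \<Longrightarrow> i \<notin> X \<Longrightarrow> el (insert i X) = badd A (el {i}) (el X)"
  using el[of X] el[of "{i}"] el[of "insert i X"] by (intro \<iota>_inj) (auto simp: \<iota>_add)

end

definition supp :: "'b meas_alg \<Rightarrow> ('i \<Rightarrow> 'b) \<Rightarrow> 'i set" where
  "supp B f = {i. f i \<noteq> bzero B}"

text \<open>
  The elements of \<open>A \<otimes> B\<close> are finite sums of tensors of an atom of \<open>A\<close> with an element of \<open>B\<close>, which
  amounts to a finitely supported function from atoms to \<open>B\<close>.
\<close>

definition power_alg :: "'i set \<Rightarrow> real \<Rightarrow> 'b meas_alg \<Rightarrow> ('i \<Rightarrow> 'b) meas_alg" where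
  "power_alg I w B = \<lparr>carrier = {f. finite (supp B f) \<and> supp B f \<subseteq> I \<and> range f \<subseteq> carrier B},
     badd = (\<lambda>f g i. badd B (f i) (g i)), bmul = (\<lambda>f g i. bmul B (f i) (g i)),
     bzero = (\<lambda>_. bzero B), meas = (\<lambda>f. w * (\<Sum>i\<in>supp B f. meas B (f i)))\<rparr>"

lemma power_alg_simps [simp]:
  "badd (power_alg I w B) = (\<lambda>f g i. badd B (f i) (g i))"
  "bmul (power_alg I w B) = (\<lambda>f g i. bmul B (f i) (g i))"
  "bzero (power_alg I w B) = (\<lambda>_. bzero B)"
  by (simp_all add: power_alg_def)

lemma power_alg_carrierD:
  assumes "f \<in> carrier (power_alg I w B)"
  shows "finite (supp B f)" "supp B f \<subseteq> I" "f i \<in> carrier B"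
  using assms by (auto simp: power_alg_def)

lemma power_alg_carrierI:
  assumes "finite K" "K \<subseteq> I" "\<And>i. i \<notin> K \<Longrightarrow> f i = bzero B" "\<And>i. f i \<in> carrier B"
  shows "f \<in> carrier (power_alg I w B)"
proof -
  have "supp B f \<subseteq> K" using assms(3) by (auto simp: supp_def)
  then show ?thesis using assms finite_subset by (fastforce simp: power_alg_def)
qed

lemma power_alg_meas:
  assumes "measure_algebra B" "finite K" "supp B f \<subseteq> K"
  shows "meas (power_alg I w B) f = w * (\<Sum>i\<in>K. meas B (f i))"
proof -
  interpret measure_algebra B by fact
  have "(\<Sum>i\<in>supp B f. meas B (f i)) = (\<Sum>i\<in>K. meas B (f i))"
    using assms(2,3) by (intro sum.mono_neutral_left) (auto simp: supp_def)
  then show ?thesis by (simp add: power_alg_def)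
qed

lemma measure_algebra_power_alg:
  assumes B: "measure_algebra B" and w: "w > 0"
  shows "measure_algebra (power_alg I w B)"
proof -
  interpret B: measure_algebra B by fact
  let ?C = "power_alg I w B"
  note car = power_alg_carrierD
  have closed: "(\<lambda>i. badd B (f i) (g i)) \<in> carrier ?C" "(\<lambda>i. bmul B (f i) (g i)) \<in> carrier ?C"
    if "f \<in> carrier ?C" "g \<in> carrier ?C" for f g
    using car[OF that(1)] car[OF that(2)]
    by (intro power_alg_carrierI[of "supp B f \<union> supp B g"];
        auto simp: supp_def B.zero_mul B.bmul_closed)+
  have "F2_boolean_algebra ?C"
  proof (rule F2_boolean_algebraI)
    show "bzero ?C \<in> carrier ?C" by (auto intro!: power_alg_carrierI[of "{}"])
    fix f g h assume f: "f \<in> carrier ?C" and g: "g \<in> carrier ?C" and h: "h \<in> carrier ?C"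
    note c = car(3)[OF f] car(3)[OF g] car(3)[OF h]
    show "badd ?C (badd ?C f g) h = badd ?C f (badd ?C g h)"
      "bmul ?C (bmul ?C f g) h = bmul ?C f (bmul ?C g h)"
      "bmul ?C (badd ?C f g) h = badd ?C (bmul ?C f h) (bmul ?C g h)"
      using B.add.m_assoc[OF c] B.bmul_assoc[OF c] B.distrib[OF c] by simp_all
    show "badd ?C f g = badd ?C g f" "bmul ?C f g = bmul ?C g f"
      using B.add.m_comm[OF c(1,2)] B.bmul_comm[OF c(1,2)] by simp_all
  qed (auto simp: closed car fun_eq_iff B.char_two B.idem)
  moreover have "is_measure ?C (meas ?C)"
    unfolding is_measure_def
  proof (intro conjI ballI impI)
    fix f assume f: "f \<in> carrier ?C"
    have nonneg: "0 \<le> meas B (f i)" for i using B.meas_nonneg car(3)[OF f] .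
    have m: "meas ?C f = w * (\<Sum>i\<in>supp B f. meas B (f i))" by (simp add: power_alg_def)
    show "0 \<le> meas ?C f" unfolding m using w nonneg by (simp add: sum_nonneg)
    show "meas ?C f = 0 \<longleftrightarrow> f = bzero ?C"
    proof
      assume "meas ?C f = 0"
      then have "\<forall>i\<in>supp B f. meas B (f i) = 0"
        unfolding m using w nonneg sum_nonneg_eq_0_iff[OF car(1)[OF f], of "\<lambda>i. meas B (f i)"] by simp
      then have "supp B f = {}" using B.meas_eq_zero car(3)[OF f] by (auto simp: supp_def)
      then show "f = bzero ?C" by (auto simp: supp_def)
    qed (auto simp: power_alg_def supp_def)
    fix g assume g: "g \<in> carrier ?C" and fg: "bmul ?C f g = bzero ?C"
    let ?K = "supp B f \<union> supp B g"
    have K: "finite ?K" using car(1) f g by blast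
    have "supp B (badd ?C f g) \<subseteq> ?K" by (auto simp: supp_def)
    then have "meas ?C (badd ?C f g) = w * (\<Sum>i\<in>?K. meas B (badd B (f i) (g i)))"
      using power_alg_meas[OF B K, of "badd ?C f g"] by simp
    also have "\<dots> = w * (\<Sum>i\<in>?K. meas B (f i) + meas B (g i))"
      using fg B.meas_add car(3)[OF f] car(3)[OF g] by (simp add: fun_eq_iff)
    also have "\<dots> = meas ?C f + meas ?C g"
      using power_alg_meas[OF B K, of f] power_alg_meas[OF B K, of g]
      by (simp add: sum.distrib distrib_left)
    finally show "meas ?C (badd ?C f g) = meas ?C f + meas ?C g" .
  qed
  ultimately show ?thesis by (simp add: measure_algebra_def measure_algebra_axioms_def)
qed

text \<open>
  The chart of \<open>B\<close> is repeated over the \<open>k\<close> atoms in \<open>K\<close>: the point \<open>j\<close> lies over the atom number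
  \<open>j div n\<close> and is there the point \<open>j mod n\<close>.
\<close>

lemma power_alg_chart:
  fixes n k :: nat
  assumes B: "measure_algebra B" and \<psi>: "chart B {..<n} c \<psi>" and w: "w > 0"
    and h: "bij_betw h K {..<k}" and K: "finite K" "K \<subseteq> I"
  defines "\<theta> \<equiv> \<lambda>X i. if i \<in> K then \<psi> {j. j < n \<and> h i * n + j \<in> X} else bzero B"
  shows "chart (power_alg I w B) {..<k * n} (w * c) \<theta>"
proof -
  interpret B: measure_algebra B by fact
  have sl: "{j. j < n \<and> h i * n + j \<in> X} \<subseteq> {..<n}" for i X by auto
  note \<psi>' = chartD[OF \<psi>]
  have zero: "\<psi> {} = bzero B" using chart_empty[OF \<psi> B] .
  show ?thesis
    unfolding chart_def
  proof (intro conjI allI impI)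
    show "0 < w * c" using w \<psi>'(1) by simp
    fix X assume X: "X \<subseteq> {..<k * n}"
    show "\<theta> X \<in> carrier (power_alg I w B)"
      by (rule power_alg_carrierI[OF K]) (auto simp: \<theta>_def \<psi>'(2)[OF sl])
    have "(\<Sum>i\<in>K. card {j. j < n \<and> h i * n + j \<in> X}) = card (SIGMA i:K. {j. j < n \<and> h i * n + j \<in> X})"
      using K(1) finite_subset[OF sl finite_lessThan] by (intro card_SigmaI[symmetric]) auto
    also have "\<dots> = card X"
    proof (rule bij_betw_same_card[of "\<lambda>(i, j). h i * n + j"], rule bij_betw_imageI)
      have "h i = h i' \<and> j = j'" if "h i * n + j = h i' * n + j'" "j < n" "j' < n" for i i' j j'
      proof -
        have "(h i * n + j) div n = h i" "(h i' * n + j') div n = h i'"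
          using that(2,3) by simp_all
        then show ?thesis using that(1) by simp
      qed
      then show "inj_on (\<lambda>(i, j). h i * n + j) (SIGMA i:K. {j. j < n \<and> h i * n + j \<in> X})"
        using h by (auto simp: inj_on_def bij_betw_def)
      show "(\<lambda>(i, j). h i * n + j) ` (SIGMA i:K. {j. j < n \<and> h i * n + j \<in> X}) = X"
      proof (intro equalityI subsetI)
        fix x assume x: "x \<in> X"
        then have "x < k * n" using X by auto
        then have "n > 0" "x div n < k" by (auto simp: less_mult_imp_div_less intro: gr0I)
        then obtain i where i: "i \<in> K" "h i = x div n"
          using h unfolding bij_betw_def by (metis imageE lessThan_iff)
        have "h i * n + x mod n = x" using i(2) by simp
        then show "x \<in> (\<lambda>(i, j). h i * n + j) ` (SIGMA i:K. {j. j < n \<and> h i * n + j \<in> X})"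
          using i(1) x \<open>n > 0\<close> by (intro image_eqI[of _ _ "(i, x mod n)"]) auto
      qed auto
    qed
    finally have card: "(\<Sum>i\<in>K. card {j. j < n \<and> h i * n + j \<in> X}) = card X" .
    have "meas (power_alg I w B) (\<theta> X) = w * (\<Sum>i\<in>K. meas B (\<theta> X i))"
      by (rule power_alg_meas[OF B K(1)]) (auto simp: \<theta>_def supp_def)
    also have "\<dots> = w * (\<Sum>i\<in>K. c * real (card {j. j < n \<and> h i * n + j \<in> X}))"
      by (simp add: \<theta>_def \<psi>'(3)[OF sl])
    also have "\<dots> = w * c * real (card X)"
      by (simp add: card[symmetric] sum_distrib_left mult.assoc)
    finally show "meas (power_alg I w B) (\<theta> X) = w * c * real (card X)" .
    fix Y
    have sym: "sym_diff {j. j < n \<and> h i * n + j \<in> X} {j. j < n \<and> h i * n + j \<in> Y} =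
        {j. j < n \<and> h i * n + j \<in> sym_diff X Y}" for i by auto
    show "badd (power_alg I w B) (\<theta> X) (\<theta> Y) = \<theta> (sym_diff X Y)"
      using \<psi>'(4)[OF sl sl, of _ X _ Y] sym by (auto simp: \<theta>_def fun_eq_iff)
    have int: "{j. j < n \<and> h i * n + j \<in> X} \<inter> {j. j < n \<and> h i * n + j \<in> Y} =
        {j. j < n \<and> h i * n + j \<in> X \<inter> Y}" for i by auto
    show "bmul (power_alg I w B) (\<theta> X) (\<theta> Y) = \<theta> (X \<inter> Y)"
      using \<psi>'(5)[OF sl sl, of _ X _ Y] int by (auto simp: \<theta>_def fun_eq_iff B.zero_mul)
  qed
qed

text \<open>
  Finitely many functions have supports in a common finite set of atoms and finitely many values,
  which lie in one chart of \<open>B\<close>.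
\<close>

lemma charted_power_alg:
  assumes B: "measure_algebra B" "charted B \<Gamma>" and w: "w > 0"
  shows "charted (power_alg I w B) {(card K * n, w * c) | K n c. finite K \<and> K \<subseteq> I \<and> (n, c) \<in> \<Gamma>}"
  unfolding charted_def
proof (intro conjI allI impI)
  fix F assume F: "finite F \<and> F \<subseteq> carrier (power_alg I w B)"
  define K where "K = (\<Union>f\<in>F. supp B f)"
  have K: "finite K" "K \<subseteq> I" using F power_alg_carrierD(1,2) unfolding K_def by blast+
  define E where "E = (\<Union>f\<in>F. f ` K)"
  have E: "finite E" "E \<subseteq> carrier B"
    using F K(1) power_alg_carrierD(3)[of _ I w B] by (auto simp: E_def subset_iff)
  obtain n c \<psi> where \<psi>: "(n, c) \<in> \<Gamma>" "chart B {..<n} c \<psi>" "E \<subseteq> \<psi> ` Pow {..<n}"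
    using charted_cover[OF B(2) E] .
  obtain h where h: "bij_betw h K {..<card K}"
    using ex_bij_betw_finite_nat[OF K(1)] by (auto simp: atLeast0LessThan)
  define \<theta> where "\<theta> = (\<lambda>X i. if i \<in> K then \<psi> {j. j < n \<and> h i * n + j \<in> X} else bzero B)"
  have ch: "chart (power_alg I w B) {..<card K * n} (w * c) \<theta>"
    unfolding \<theta>_def by (rule power_alg_chart[OF B(1) \<psi>(2) w h K])
  have "F \<subseteq> \<theta> ` Pow {..<card K * n}"
  proof
    fix f assume f: "f \<in> F"
    have "\<exists>Y. Y \<subseteq> {..<n} \<and> f i = \<psi> Y" if "i \<in> K" for i
    proof -
      have "f i \<in> E" using f that unfolding E_def by blast
      then show ?thesis using subsetD[OF \<psi>(3)] by blast
    qed
    then obtain Y where Y: "\<And>i. i \<in> K \<Longrightarrow> Y i \<subseteq> {..<n}" "\<And>i. i \<in> K \<Longrightarrow> f i = \<psi> (Y i)" by metis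
    define X where "X = {x. x < card K * n \<and> x mod n \<in> Y (inv_into K h (x div n))}"
    have "f i = \<theta> X i" for i
    proof (cases "i \<in> K")
      case True
      have hi: "h i < card K" using h True by (auto simp: bij_betw_def)
      have "h i * n + j < card K * n" if "j < n" for j
      proof -
        have "h i * n + j < Suc (h i) * n" using that by simp
        also have "\<dots> \<le> card K * n" using hi by (intro mult_le_mono1) simp
        finally show ?thesis .
      qed
      then have "{j. j < n \<and> h i * n + j \<in> X} = Y i"
        using Y(1)[OF True] h True by (auto simp: X_def bij_betw_def)
      then show ?thesis using True Y(2) by (simp add: \<theta>_def)
    next
      case False
      then show ?thesis using f by (auto simp: \<theta>_def K_def supp_def)
    qed
    then show "f \<in> \<theta> ` Pow {..<card K * n}"
      by (intro image_eqI[of _ _ X]) (auto simp: X_def)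
  qed
  then show "\<exists>n c \<psi>. (n, c) \<in> {(card K * n, w * c) | K n c. finite K \<and> K \<subseteq> I \<and> (n, c) \<in> \<Gamma>} \<and>
      chart (power_alg I w B) {..<n} c \<psi> \<and> F \<subseteq> \<psi> ` Pow {..<n}"
    using ch \<psi>(1) K by (intro exI[of _ "card K * n"] exI[of _ "w * c"] exI[of _ \<theta>]) auto
next
  fix n' c' assume "(n', c') \<in> {(card K * n, w * c) | K n c. finite K \<and> K \<subseteq> I \<and> (n, c) \<in> \<Gamma>}"
  then obtain K n c where *: "n' = card K * n" "c' = w * c" "finite K" "K \<subseteq> I" "(n, c) \<in> \<Gamma>" by blast
  obtain \<psi> where "chart B {..<n} c \<psi>" using charted_realised[OF B(2) *(5)] by blast
  moreover obtain h where "bij_betw h K {..<card K}"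
    using ex_bij_betw_finite_nat[OF *(3)] by (auto simp: atLeast0LessThan)
  ultimately show "\<exists>\<psi>. chart (power_alg I w B) {..<n'} c' \<psi>"
    using power_alg_chart[OF B(1) _ w _ *(3,4)] unfolding *(1,2) by blast
qed

lemma finite_supp_sum:
  assumes "\<And>i. i \<in> K \<Longrightarrow> f i = bzero B \<Longrightarrow> rel_cong R (u i) 0" "finite K" "supp B f \<subseteq> K"
  shows "rel_cong R (sum u (supp B f)) (sum u K)"
proof -
  have "sum u K = sum u (supp B f) + sum u (K - supp B f)"
    using assms(2,3) by (metis add.commute sum.subset_diff)
  moreover have "rel_cong R (sum u (K - supp B f)) 0"
    using rel_cong_sum[of "K - supp B f" R u "\<lambda>_. 0"] assms(1) by (auto simp: supp_def)
  ultimately show ?thesis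
    using rel_cong_add[OF rel_cong_refl[of R "sum u (supp B f)"]] rel_cong_sym by fastforce
qed

locale atomic_tensor = atomic A I \<iota> w + B: measure_algebra B
  for A :: "'a meas_alg" and I :: "'i set" and \<iota> w and B :: "'b meas_alg"
begin

abbreviation "R \<equiv> tensor_rels A B"

definition tens :: "'a \<times> 'b \<Rightarrow> ('i \<Rightarrow> 'b)" where
  "tens = (\<lambda>(a, b) i. if i \<in> \<iota> a then b else bzero B)"

definition atoms_sum :: "('i \<Rightarrow> 'b) \<Rightarrow> ('a \<times> 'b \<Rightarrow>\<^sub>0 bit)" where
  "atoms_sum f = (\<Sum>i\<in>supp B f. gen (el {i}, f i))"

lemma rel_left:
  "a \<in> carrier A \<Longrightarrow> a' \<in> carrier A \<Longrightarrow> b \<in> carrier B \<Longrightarrow>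
    rel_cong R (gen (badd A a a', b)) (gen (a, b) + gen (a', b))"
  by (rule rel_cong_base) (auto simp: tensor_rels_def)

lemma rel_right:
  "a \<in> carrier A \<Longrightarrow> b \<in> carrier B \<Longrightarrow> b' \<in> carrier B \<Longrightarrow>
    rel_cong R (gen (a, badd B b b')) (gen (a, b) + gen (a, b'))"
  by (rule rel_cong_base) (auto simp: tensor_rels_def)

lemma rel_zero_left: "b \<in> carrier B \<Longrightarrow> rel_cong R (gen (bzero A, b)) 0"
  using rel_left[of "bzero A" "bzero A" b] by simp

lemma rel_zero_right: "a \<in> carrier A \<Longrightarrow> rel_cong R (gen (a, bzero B)) 0"
  using rel_right[of a "bzero B" "bzero B"] by simp

lemma atom: "i \<in> I \<Longrightarrow> el {i} \<in> carrier A \<and> \<iota> (el {i}) = {i}"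
  using el by simp

lemma atoms_sum_cong:
  assumes "finite K" "supp B f \<subseteq> K" "K \<subseteq> I"
  shows "rel_cong R (atoms_sum f) (\<Sum>i\<in>K. gen (el {i}, f i))"
  unfolding atoms_sum_def
  by (rule finite_supp_sum) (use assms rel_zero_right atom in auto)

lemma gen_cong_atoms:
  assumes b: "b \<in> carrier B"
  shows "finite X \<Longrightarrow> X \<subseteq> I \<Longrightarrow> rel_cong R (gen (el X, b)) (\<Sum>i\<in>X. gen (el {i}, b))"
proof (induction X rule: finite_induct)
  case empty
  then show ?case using rel_zero_left[OF b] by (simp add: el_empty)
next
  case (insert i X)
  have "rel_cong R (gen (el (insert i X), b)) (gen (el {i}, b) + gen (el X, b))"
  proof -
    have "el {i} \<in> carrier A" "el X \<in> carrier A" using insert.hyps insert.prems atom[of i] el[of X] by auto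
    from rel_left[OF this b] show ?thesis
      using el_insert[OF insert.hyps(1) insert.prems insert.hyps(2)] by simp
  qed
  also have "rel_cong R (gen (el {i}, b) + gen (el X, b)) (\<Sum>i\<in>insert i X. gen (el {i}, b))"
    using insert.hyps insert.prems rel_cong_add[OF rel_cong_refl insert.IH] by simp
  finally show ?case .
qed

lemma tens_closed:
  "a \<in> carrier A \<Longrightarrow> b \<in> carrier B \<Longrightarrow> tens (a, b) \<in> carrier (power_alg I w B)"
  using \<iota>_finite \<iota>_subset by (intro power_alg_carrierI[of "\<iota> a"]) (auto simp: tens_def)

lemma atoms_gen:
  assumes "a \<in> carrier A" "b \<in> carrier B"
  shows "rel_cong R (gen (a, b)) (atoms_sum (tens (a, b)))"
proof -
  have "el (\<iota> a) = a" using el[of "\<iota> a"] assms(1) \<iota>_finite \<iota>_subset \<iota>_inj by metis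
  then have "rel_cong R (gen (a, b)) (\<Sum>i\<in>\<iota> a. gen (el {i}, b))"
    using gen_cong_atoms[OF assms(2), of "\<iota> a"] assms(1) \<iota>_finite \<iota>_subset by simp
  also have "(\<Sum>i\<in>\<iota> a. gen (el {i}, b)) = (\<Sum>i\<in>\<iota> a. gen (el {i}, tens (a, b) i))"
    by (rule sum.cong) (simp_all add: tens_def)
  also have "rel_cong R \<dots> (atoms_sum (tens (a, b)))"
    using assms(1) \<iota>_finite \<iota>_subset
    by (intro rel_cong_sym[OF atoms_sum_cong]) (auto simp: supp_def tens_def)
  finally show ?thesis .
qed

lemma tens_generates:
  assumes f: "f \<in> carrier (power_alg I w B)"
  shows "disjoint_sum (power_alg I w B) (carrier A \<times> carrier B) tens f"
proof -
  have "disjoint_sum (power_alg I w B) (carrier A \<times> carrier B) tens f"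
    if "finite K" "K \<subseteq> I" "supp B f \<subseteq> K" "range f \<subseteq> carrier B" for K f
    using that
  proof (induction K arbitrary: f rule: finite_induct)
    case empty
    then have "f = bzero (power_alg I w B)" by (auto simp: supp_def)
    then show ?case by (metis disjoint_sum.zero)
  next
    case (insert i K)
    define g where "g = f(i := bzero B)"
    have g: "disjoint_sum (power_alg I w B) (carrier A \<times> carrier B) tens g"
      using insert by (intro insert.IH) (auto simp: g_def supp_def)
    have i: "(el {i}, f i) \<in> carrier A \<times> carrier B"
      using atom[of i] insert.prems by auto
    have fB: "f x \<in> carrier B" for x using insert.prems(3) by auto
    have fg: "f = badd (power_alg I w B) (tens (el {i}, f i)) g"
      using insert.prems atom[of i] by (auto simp: fun_eq_iff g_def tens_def fB)
    have "bmul (power_alg I w B) (tens (el {i}, f i)) g = bzero (power_alg I w B)"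
      using insert.prems atom[of i] by (auto simp: fun_eq_iff g_def tens_def B.mul_zero B.zero_mul fB)
    from disjoint_sum.add[OF i g this] show ?case unfolding fg[symmetric] .
  qed
  then show ?thesis
    using f power_alg_carrierD(1,2)[OF f] by (auto simp: power_alg_def)
qed

lemma presentation:
  "presentation (power_alg I w B) (carrier A \<times> carrier B)
    (\<lambda>(a, b) (a', b'). (bmul A a a', bmul B b b')) R tens atoms_sum"
proof -
  interpret P: measure_algebra "power_alg I w B"
    by (rule measure_algebra_power_alg[OF B.measure_algebra_axioms w_pos])
  show ?thesis
  proof
    show "tens g \<in> carrier (power_alg I w B)" if "g \<in> carrier A \<times> carrier B" for g
      using that tens_closed by auto
    show "(case g of (a, b) \<Rightarrow> \<lambda>(a', b'). (bmul A a a', bmul B b b')) h \<in> carrier A \<times> carrier B"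
      "tens ((case g of (a, b) \<Rightarrow> \<lambda>(a', b'). (bmul A a a', bmul B b b')) h) =
        bmul (power_alg I w B) (tens g) (tens h)"
      if "g \<in> carrier A \<times> carrier B" "h \<in> carrier A \<times> carrier B" for g h
      using that
      by (auto simp: bmul_closed B.bmul_closed tens_def \<iota>_mul fun_eq_iff B.zero_mul B.mul_zero)
    show "\<exists>x\<in>carrier A \<times> carrier B. \<exists>y\<in>carrier A \<times> carrier B. \<exists>z\<in>carrier A \<times> carrier B.
        r = gen x + gen y + gen z \<and> tens x = badd (power_alg I w B) (tens y) (tens z)"
      if "r \<in> R" for r
      using that unfolding tensor_rels_def
    proof (elim UnE CollectE exE conjE)
      fix a a' b assume *: "r = gen (badd A a a', b) + gen (a, b) + gen (a', b)"
        "a \<in> carrier A" "a' \<in> carrier A" "b \<in> carrier B"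
      then have "tens (badd A a a', b) = badd (power_alg I w B) (tens (a, b)) (tens (a', b))"
        by (auto simp: tens_def \<iota>_add fun_eq_iff B.char_two)
      with * show ?thesis
        by (intro bexI[of _ "(badd A a a', b)"] bexI[of _ "(a, b)"] bexI[of _ "(a', b)"]) auto
    next
      fix a b b' assume *: "r = gen (a, badd B b b') + gen (a, b) + gen (a, b')"
        "a \<in> carrier A" "b \<in> carrier B" "b' \<in> carrier B"
      then have "tens (a, badd B b b') = badd (power_alg I w B) (tens (a, b)) (tens (a, b'))"
        by (auto simp: tens_def fun_eq_iff)
      with * show ?thesis
        by (intro bexI[of _ "(a, badd B b b')"] bexI[of _ "(a, b)"] bexI[of _ "(a, b')"]) auto
    qed
    show "rel_cong R (atoms_sum (bzero (power_alg I w B))) 0"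
      by (simp add: atoms_sum_def supp_def)
    show "rel_cong R (gen g) (atoms_sum (tens g))" if "g \<in> carrier A \<times> carrier B" for g
      using that atoms_gen by auto
    show "disjoint_sum (power_alg I w B) (carrier A \<times> carrier B) tens f"
      if "f \<in> carrier (power_alg I w B)" for f
      using tens_generates[OF that] .
    fix f g assume f: "f \<in> carrier (power_alg I w B)" and g: "g \<in> carrier (power_alg I w B)"
    define K where "K = supp B f \<union> supp B g"
    have K: "finite K" "supp B f \<subseteq> K" "supp B g \<subseteq> K" "K \<subseteq> I" "supp B (badd (power_alg I w B) f g) \<subseteq> K"
      using power_alg_carrierD(1,2)[OF f] power_alg_carrierD(1,2)[OF g] by (auto simp: K_def supp_def)
    have "rel_cong R (atoms_sum (badd (power_alg I w B) f g)) (\<Sum>i\<in>K. gen (el {i}, badd B (f i) (g i)))"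
      using atoms_sum_cong[OF K(1,5,4)] by simp
    also have "rel_cong R \<dots> (\<Sum>i\<in>K. gen (el {i}, f i) + gen (el {i}, g i))"
      using K(4) power_alg_carrierD(3)[OF f] power_alg_carrierD(3)[OF g] atom
      by (intro rel_cong_sum rel_right) auto
    also have "\<dots> = (\<Sum>i\<in>K. gen (el {i}, f i)) + (\<Sum>i\<in>K. gen (el {i}, g i))"
      by (rule sum.distrib)
    also have "rel_cong R \<dots> (atoms_sum f + atoms_sum g)"
      by (intro rel_cong_add rel_cong_sym[OF atoms_sum_cong] K)
    finally show "rel_cong R (atoms_sum (badd (power_alg I w B) f g)) (atoms_sum f + atoms_sum g)" .
  qed
qed

lemma meas_tens:
  assumes "a \<in> carrier A" "b \<in> carrier B"
  shows "meas (power_alg I w B) (tens (a, b)) = meas A a * meas B b"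
proof -
  have "meas (power_alg I w B) (tens (a, b)) = w * (\<Sum>i\<in>\<iota> a. meas B (tens (a, b) i))"
    by (rule power_alg_meas[OF B.measure_algebra_axioms \<iota>_finite[OF assms(1)]])
      (auto simp: supp_def tens_def)
  then show ?thesis using \<iota>_meas[OF assms(1)] by (simp add: tens_def)
qed

text \<open>
  The normal form of a function is the formal sum of the tensors of the atoms with its values; bilinearity
  reduces every tensor to it.
\<close>

theorem tensor_power_alg:
  obtains \<kappa> where "measure_algebra (tensor A B)" "alg_iso (power_alg I w B) (tensor A B) \<kappa>"
    "\<And>f. f \<in> carrier (power_alg I w B) \<Longrightarrow> meas (tensor A B) (\<kappa> f) = meas (power_alg I w B) f"
    "\<And>a b. a \<in> carrier A \<Longrightarrow> b \<in> carrier B \<Longrightarrow> pure_tensor A B a b = \<kappa> (tens (a, b))"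
proof -
  interpret P: presentation "power_alg I w B" "carrier A \<times> carrier B"
    "\<lambda>(a, b) (a', b'). (bmul A a a', bmul B b b')" R tens atoms_sum
    by (rule presentation)
  have weights: "(case g of (a, b) \<Rightarrow> meas A a * meas B b) = meas (power_alg I w B) (tens g)"
    if "g \<in> carrier A \<times> carrier B" for g
    using that by (auto simp: meas_tens)
  have "(case g of (a, b) \<Rightarrow> pure_tensor A B a b) = coset (F2_span R) (gen g)"
    if "g \<in> carrier A \<times> carrier B" for g
    by (simp add: pure_tensor_def split: prod.split)
  note T = P.with_measure_presented[of "\<lambda>(a, b). pure_tensor A B a b" "\<lambda>(a, b). meas A a * meas B b",
      OF this weights, folded tensor_def]
  show ?thesis
    by (rule that[OF T(1,2,4)]) (use T(5) in auto)
qed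

lemma measure_algebra_tensor: "measure_algebra (tensor A B)"
  by (rule tensor_power_alg)

lemma pure_tensor:
  assumes "a \<in> carrier A" "b \<in> carrier B"
  shows "pure_tensor A B a b \<in> carrier (tensor A B)"
    and "meas (tensor A B) (pure_tensor A B a b) = meas A a * meas B b"
proof -
  obtain \<kappa> where T: "measure_algebra (tensor A B)" "alg_iso (power_alg I w B) (tensor A B) \<kappa>"
    "\<And>f. f \<in> carrier (power_alg I w B) \<Longrightarrow> meas (tensor A B) (\<kappa> f) = meas (power_alg I w B) f"
    "\<And>a b. a \<in> carrier A \<Longrightarrow> b \<in> carrier B \<Longrightarrow> pure_tensor A B a b = \<kappa> (tens (a, b))"
    by (rule tensor_power_alg) iprover
  show "pure_tensor A B a b \<in> carrier (tensor A B)"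
    using T(4)[OF assms] alg_isoD(2)[OF T(2) tens_closed[OF assms]] by simp
  show "meas (tensor A B) (pure_tensor A B a b) = meas A a * meas B b"
    using T(3)[OF tens_closed[OF assms]] T(4)[OF assms] meas_tens[OF assms] by simp
qed

lemma charted_tensor:
  assumes "charted B \<Gamma>"
  shows "charted (tensor A B) {(card K * n, w * c) | K n c. finite K \<and> K \<subseteq> I \<and> (n, c) \<in> \<Gamma>}"
proof -
  obtain \<kappa> where iso: "alg_iso (power_alg I w B) (tensor A B) \<kappa>"
    "\<And>f. f \<in> carrier (power_alg I w B) \<Longrightarrow> meas (tensor A B) (\<kappa> f) = meas (power_alg I w B) f"
    by (rule tensor_power_alg) iprover
  show ?thesis
    by (rule charted_transport[OF iso charted_power_alg[OF B.measure_algebra_axioms assms w_pos]])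
qed

end

lemma countable_tensor:
  assumes "countable (carrier A)" "countable (carrier B)"
  shows "countable (carrier (tensor A B))"
  using countable_presented_alg[of "carrier A \<times> carrier B"] assms
  by (simp add: tensor_def with_measure_def)

lemma sum_bit_card: "finite A \<Longrightarrow> (\<Sum>i\<in>A. if P i then 1 else 0 :: nat) = card {i \<in> A. P i}"
  by (simp add: sum.If_cases Int_def)

lemma measure_algebra_St: "measure_algebra (St n)"
proof -
  have m: "meas (St n) x = real (card {i. i < n \<and> x i = 1}) / real n" for x
    by (simp add: St_def sum_bit_card)
  have "F2_boolean_algebra (St n)"
    by (rule F2_boolean_algebraI) (auto simp: St_def fun_eq_iff algebra_simps)
  moreover have "is_measure (St n) (meas (St n))"
    unfolding is_measure_def
  proof (intro conjI ballI impI)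
    fix x assume x: "x \<in> carrier (St n)"
    show "0 \<le> meas (St n) x" by (simp add: m)
    show "meas (St n) x = 0 \<longleftrightarrow> x = bzero (St n)"
    proof
      assume "meas (St n) x = 0"
      then have "n = 0 \<or> {i. i < n \<and> x i = 1} = {}" by (auto simp: m)
      then have "x i \<noteq> 1" for i using x by (cases "i < n") (auto simp: St_def)
      then have "x i = 0" for i by (metis bit_not_one_iff)
      then show "x = bzero (St n)" by (simp add: St_def fun_eq_iff)
    qed (auto simp: m St_def)
    fix y assume y: "y \<in> carrier (St n)" and xy: "bmul (St n) x y = bzero (St n)"
    have disj: "x i = 0 \<or> y i = 0" for i using xy by (simp add: St_def fun_eq_iff)
    have "{i. i < n \<and> badd (St n) x y i = 1} = {i. i < n \<and> x i = 1} \<union> {i. i < n \<and> y i = 1}"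
      using disj by (auto simp: St_def) (metis bit_not_one_iff)+
    moreover have "{i. i < n \<and> x i = 1} \<inter> {i. i < n \<and> y i = 1} = {}"
    proof -
      have "\<not> (x i = 1 \<and> y i = 1)" for i using disj[of i] by auto
      then show ?thesis by blast
    qed
    ultimately show "meas (St n) (badd (St n) x y) = meas (St n) x + meas (St n) y"
      by (simp add: m card_Un_disjoint add_divide_distrib)
  qed
  ultimately show ?thesis by (simp add: measure_algebra_def measure_algebra_axioms_def)
qed

lemma atomic_St: "atomic (St n) {..<n} (\<lambda>x. {i. x i = 1}) (1 / real (max 1 n))"
proof -
  interpret measure_algebra "St n" by (rule measure_algebra_St)
  show ?thesis
  proof
    have "(\<lambda>x. {i. x i = 1}) ` carrier (St n) = {X. finite X \<and> X \<subseteq> {..<n}}"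
    proof (intro equalityI subsetI)
      fix X assume X: "X \<in> {X. finite X \<and> X \<subseteq> {..<n}}"
      show "X \<in> (\<lambda>x. {i. x i = 1}) ` carrier (St n)"
        using X by (intro image_eqI[of _ _ "\<lambda>i. if i \<in> X then 1 else 0"]) (auto simp: St_def)
    next
      fix X assume "X \<in> (\<lambda>x. {i. x i = 1}) ` carrier (St n)"
      then obtain x :: "nat \<Rightarrow> bit" where x: "X = {i. x i = 1}" "\<forall>i\<ge>n. x i = 0" by (auto simp: St_def)
      then have "X \<subseteq> {..<n}" by (auto simp: not_le[symmetric])
      then show "X \<in> {X. finite X \<and> X \<subseteq> {..<n}}" using finite_subset by blast
    qed
    moreover have "inj_on (\<lambda>x. {i. x i = 1}) (carrier (St n))"
    proof (rule inj_onI)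
      fix x y :: "nat \<Rightarrow> bit" assume "{i. x i = 1} = {i. y i = 1}"
      then have "x i = 1 \<longleftrightarrow> y i = 1" for i by blast
      then have "x i = y i" for i by (metis bit_not_one_iff)
      then show "x = y" by blast
    qed
    ultimately show "bij_betw (\<lambda>x. {i. x i = 1}) (carrier (St n)) {X. finite X \<and> X \<subseteq> {..<n}}"
      by (simp add: bij_betw_def)
    show "{i. badd (St n) x y i = 1} = sym_diff {i. x i = 1} {i. y i = 1}" for x y
    proof -
      have "a + b = 1 \<longleftrightarrow> (a = 1) \<noteq> (b = 1)" for a b :: bit by (cases a; cases b) auto
      then show ?thesis by (auto simp: St_def)
    qed
    show "{i. bmul (St n) x y i = 1} = {i. x i = 1} \<inter> {i. y i = 1}" for x y
    proof -
      have "a * b = 1 \<longleftrightarrow> a = 1 \<and> b = 1" for a b :: bit by (cases a; cases b) auto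
      then show ?thesis by (auto simp: St_def)
    qed
    show "meas (St n) x = 1 / real (max 1 n) * real (card {i. x i = 1})" if "x \<in> carrier (St n)" for x
    proof -
      have "{i. i < n \<and> x i = 1} = {i. x i = 1}" using that by (auto simp: St_def not_le[symmetric])
      then have "meas (St n) x = real (card {i. x i = 1}) / real n" by (simp add: St_def sum_bit_card)
      moreover have "{i. x i = 1} = {}" if "n = 0" using that \<open>x \<in> carrier (St n)\<close> by (simp add: St_def)
      ultimately show ?thesis by (cases "n = 0") (simp_all add: max_def)
    qed
  qed simp
qed

lemma atomic_H_infinity: "atomic H_infinity UNIV id 1"
proof -
  have "F2_boolean_algebra H_infinity"
    by (rule F2_boolean_algebraI) (auto simp: H_infinity_def)
  moreover have "is_measure H_infinity (meas H_infinity)"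
  proof -
    have "card (sym_diff a b) = card a + card b"
      if "finite a" "finite b" "a \<inter> b = {}" for a b :: "nat set"
    proof -
      have "sym_diff a b = a \<union> b" using that(3) by blast
      then show ?thesis using card_Un_disjoint[OF that] by simp
    qed
    then show ?thesis
      unfolding is_measure_def by (simp add: H_infinity_def)
  qed
  ultimately interpret measure_algebra H_infinity
    by (simp add: measure_algebra_def measure_algebra_axioms_def)
  show ?thesis
    by unfold_locales (auto simp: H_infinity_def)
qed

section \<open>Direct limits of measure algebras\<close>

locale directed_system =
  fixes D :: "'d::order set" and A :: "'d \<Rightarrow> 'a meas_alg" and \<phi> :: "'d \<Rightarrow> 'd \<Rightarrow> 'a \<Rightarrow> 'a"
  assumes nonempty: "D \<noteq> {}"
    and directed: "d \<in> D \<Longrightarrow> e \<in> D \<Longrightarrow> \<exists>g\<in>D. d \<le> g \<and> e \<le> g"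
    and algebra: "d \<in> D \<Longrightarrow> measure_algebra (A d)"
    and hom: "d \<in> D \<Longrightarrow> e \<in> D \<Longrightarrow> d \<le> e \<Longrightarrow> scaling_hom (A d) (A e) 1 (\<phi> d e)"
    and comp: "d \<in> D \<Longrightarrow> e \<in> D \<Longrightarrow> g \<in> D \<Longrightarrow> d \<le> e \<Longrightarrow> e \<le> g \<Longrightarrow> x \<in> carrier (A d) \<Longrightarrow>
          \<phi> e g (\<phi> d e x) = \<phi> d g x"
begin

abbreviation "\<kappa> \<equiv> lim_class D A \<phi>"
abbreviation "L \<equiv> dir_lim D A \<phi>"

lemma map_closed:
  "d \<in> D \<Longrightarrow> e \<in> D \<Longrightarrow> d \<le> e \<Longrightarrow> x \<in> carrier (A d) \<Longrightarrow> \<phi> d e x \<in> carrier (A e)"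
  and map_meas:
  "d \<in> D \<Longrightarrow> e \<in> D \<Longrightarrow> d \<le> e \<Longrightarrow> x \<in> carrier (A d) \<Longrightarrow> meas (A e) (\<phi> d e x) = meas (A d) x"
  and map_add:
  "d \<in> D \<Longrightarrow> e \<in> D \<Longrightarrow> d \<le> e \<Longrightarrow> x \<in> carrier (A d) \<Longrightarrow> y \<in> carrier (A d) \<Longrightarrow>
     \<phi> d e (badd (A d) x y) = badd (A e) (\<phi> d e x) (\<phi> d e y)"
  and map_mul:
  "d \<in> D \<Longrightarrow> e \<in> D \<Longrightarrow> d \<le> e \<Longrightarrow> x \<in> carrier (A d) \<Longrightarrow> y \<in> carrier (A d) \<Longrightarrow>
     \<phi> d e (bmul (A d) x y) = bmul (A e) (\<phi> d e x) (\<phi> d e y)"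
  using scaling_homD[OF hom] by simp_all

text \<open>The transition maps are injective because they preserve the measure of \<open>x + y\<close>.\<close>

lemma map_inj:
  assumes "d \<in> D" "e \<in> D" "d \<le> e" "x \<in> carrier (A d)" "y \<in> carrier (A d)" "\<phi> d e x = \<phi> d e y"
  shows "x = y"
proof -
  interpret d: measure_algebra "A d" by (rule algebra) fact
  interpret e: measure_algebra "A e" by (rule algebra) fact
  have "meas (A d) (badd (A d) x y) = meas (A e) (badd (A e) (\<phi> d e x) (\<phi> d e x))"
    using map_meas[OF assms(1-3), of "badd (A d) x y"] map_add[OF assms(1-5)] assms(4-6) by simp
  also have "\<dots> = 0"
    using e.char_two[OF map_closed[OF assms(1-4)]] by simp
  finally show ?thesis
    using d.meas_eq_zero[of "badd (A d) x y"] d.add_eq_zero assms(4,5) by simp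
qed

text \<open>
  Injectivity makes the choice of the later index in the definition of the classes immaterial.
\<close>

lemma agree_everywhere:
  assumes d: "d \<in> D" "x \<in> carrier (A d)" and e: "e \<in> D" "y \<in> carrier (A e)"
    and g: "g \<in> D" "d \<le> g" "e \<le> g" "\<phi> d g x = \<phi> e g y"
    and h: "h \<in> D" "d \<le> h" "e \<le> h"
  shows "\<phi> d h x = \<phi> e h y"
proof -
  obtain k where k: "k \<in> D" "g \<le> k" "h \<le> k" using directed[OF g(1) h(1)] by blast
  have "\<phi> h k (\<phi> d h x) = \<phi> g k (\<phi> d g x)"
    using comp[OF d(1) h(1) k(1) h(2) k(3) d(2)] comp[OF d(1) g(1) k(1) g(2) k(2) d(2)] by simp
  also have "\<dots> = \<phi> h k (\<phi> e h y)"
    using comp[OF e(1) h(1) k(1) h(3) k(3) e(2)] comp[OF e(1) g(1) k(1) g(3) k(2) e(2)] g(4) by simp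
  finally show ?thesis
    using map_inj[OF h(1) k(1) k(3) map_closed[OF d(1) h(1,2) d(2)] map_closed[OF e(1) h(1,3) e(2)]]
    by blast
qed

lemma map_self: 
  assumes "d \<in> D" "x \<in> carrier (A d)"
  shows "\<phi> d d x = x"
  using map_inj[OF assms(1,1) order_refl map_closed[OF assms(1,1) order_refl assms(2)] assms(2)]
    comp[OF assms(1,1,1) order_refl order_refl assms(2)] by blast

lemma in_class_iff:
  "(e, y) \<in> \<kappa> d x \<longleftrightarrow> e \<in> D \<and> y \<in> carrier (A e) \<and> (\<exists>g\<in>D. d \<le> g \<and> e \<le> g \<and> \<phi> d g x = \<phi> e g y)"
  by (simp add: lim_class_def)

lemma in_own_class: "d \<in> D \<Longrightarrow> x \<in> carrier (A d) \<Longrightarrow> (d, x) \<in> \<kappa> d x"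
  unfolding in_class_iff by blast

lemma class_eqI:
  assumes d: "d \<in> D" "x \<in> carrier (A d)" and e: "e \<in> D" "y \<in> carrier (A e)"
    and g: "g \<in> D" "d \<le> g" "e \<le> g" "\<phi> d g x = \<phi> e g y"
  shows "\<kappa> d x = \<kappa> e y"
proof -
  have incl: "\<kappa> d x \<subseteq> \<kappa> e y"
    if d: "d \<in> D" "x \<in> carrier (A d)" and e: "e \<in> D" "y \<in> carrier (A e)"
      and g: "g \<in> D" "d \<le> g" "e \<le> g" "\<phi> d g x = \<phi> e g y" for d e x y
  proof
    fix p assume "p \<in> \<kappa> d x"
    moreover obtain f z where p: "p = (f, z)" by fastforce
    ultimately have f: "f \<in> D" "z \<in> carrier (A f)" and ex: "\<exists>h\<in>D. d \<le> h \<and> f \<le> h \<and> \<phi> d h x = \<phi> f h z"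
      by (simp_all add: in_class_iff)
    then obtain h where h: "h \<in> D" "d \<le> h" "f \<le> h" "\<phi> d h x = \<phi> f h z" by blast
    obtain k where k: "k \<in> D" "g \<le> k" "h \<le> k" using directed[OF g(1) h(1)] by blast
    have le: "d \<le> k" "e \<le> k" "f \<le> k" using g(2,3) h(3) k(2,3) by (meson order_trans)+
    have "\<phi> e k y = \<phi> d k x" using agree_everywhere[OF d e g k(1) le(1,2)] by simp
    also have "\<dots> = \<phi> f k z" using agree_everywhere[OF d f h k(1) le(1,3)] .
    finally show "p \<in> \<kappa> e y" unfolding p in_class_iff using f k(1) le by blast
  qed
  show ?thesis using incl[OF d e g] incl[OF e d g(1,3,2) g(4)[symmetric]] by blast
qed

lemma class_shift:
  assumes "d \<in> D" "g \<in> D" "d \<le> g" "x \<in> carrier (A d)"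
  shows "\<kappa> g (\<phi> d g x) = \<kappa> d x"
  using assms map_closed[OF assms] map_self[OF assms(2) map_closed[OF assms]]
  by (intro class_eqI[of g _ d _ g]) auto

lemma carrier_lim: "carrier L = (\<Union>d\<in>D. \<kappa> d ` carrier (A d))"
  by (auto simp: dir_lim_def)

lemma common_stage:
  assumes "finite F" "F \<subseteq> carrier L"
  obtains d where "d \<in> D" "F \<subseteq> \<kappa> d ` carrier (A d)"
proof -
  have "\<exists>d\<in>D. F \<subseteq> \<kappa> d ` carrier (A d)"
    using assms
  proof (induction F rule: finite_induct)
    case empty
    then show ?case using nonempty by blast
  next
    case (insert X F)
    obtain d where d: "d \<in> D" "F \<subseteq> \<kappa> d ` carrier (A d)" using insert by auto
    obtain e x where e: "e \<in> D" "x \<in> carrier (A e)" "X = \<kappa> e x"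
      using insert.prems unfolding carrier_lim by auto
    obtain g where g: "g \<in> D" "d \<le> g" "e \<le> g" using directed[OF d(1) e(1)] by blast
    have up: "\<kappa> f ` carrier (A f) \<subseteq> \<kappa> g ` carrier (A g)" if f: "f \<in> D" "f \<le> g" for f
    proof
      fix Y assume "Y \<in> \<kappa> f ` carrier (A f)"
      then obtain y where "y \<in> carrier (A f)" "Y = \<kappa> g (\<phi> f g y)"
        using class_shift[OF f(1) g(1) f(2)] by auto
      then show "Y \<in> \<kappa> g ` carrier (A g)" using map_closed[OF f(1) g(1) f(2)] by blast
    qed
    have "insert X F \<subseteq> \<kappa> g ` carrier (A g)"
      using subset_trans[OF d(2) up[OF d(1) g(2)]] subsetD[OF up[OF e(1) g(3)], of X] e(2,3) by simp
    then show ?case using g(1) by blast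
  qed
  then show ?thesis using that by blast
qed

text \<open>
  The operations of the limit collect the results for all pairs of representatives; here all these
  results are shown to lie in one class. Addition and multiplication are the two instances.
\<close>

lemma lim_op:
  assumes op: "\<And>d e x y. d \<in> D \<Longrightarrow> e \<in> D \<Longrightarrow> d \<le> e \<Longrightarrow> x \<in> carrier (A d) \<Longrightarrow> y \<in> carrier (A d) \<Longrightarrow>
      op (A d) x y \<in> carrier (A d) \<and> \<phi> d e (op (A d) x y) = op (A e) (\<phi> d e x) (\<phi> d e y)"
    and d: "d \<in> D" and x: "x \<in> carrier (A d)" and y: "y \<in> carrier (A d)"
  shows "(\<Union>(d', x')\<in>\<kappa> d x. \<Union>(e', y')\<in>\<kappa> d y. \<Union>g\<in>{g \<in> D. d' \<le> g \<and> e' \<le> g}.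
            \<kappa> g (op (A g) (\<phi> d' g x') (\<phi> e' g y'))) = \<kappa> d (op (A d) x y)"
proof -
  have "\<kappa> g (op (A g) (\<phi> d' g x') (\<phi> e' g y')) = \<kappa> d (op (A d) x y)"
    if x': "(d', x') \<in> \<kappa> d x" and y': "(e', y') \<in> \<kappa> d y" and g: "g \<in> D" "d' \<le> g" "e' \<le> g"
    for d' x' e' y' g
  proof -
    have d': "d' \<in> D" "x' \<in> carrier (A d')" and e': "e' \<in> D" "y' \<in> carrier (A e')"
      using x' y' by (simp_all add: in_class_iff)
    obtain i where i: "i \<in> D" "d \<le> i" "d' \<le> i" "\<phi> d i x = \<phi> d' i x'" using x' unfolding in_class_iff by blast
    obtain j where j: "j \<in> D" "d \<le> j" "e' \<le> j" "\<phi> d j y = \<phi> e' j y'" using y' unfolding in_class_iff by blast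
    obtain k where k: "k \<in> D" "g \<le> k" "d \<le> k" using directed[OF g(1) d] by blast
    have le: "d' \<le> k" "e' \<le> k" using g(2,3) k(2) by (meson order_trans)+
    note cl = map_closed[OF d'(1) g(1,2) d'(2)] map_closed[OF e'(1) g(1,3) e'(2)]
    have "\<phi> g k (op (A g) (\<phi> d' g x') (\<phi> e' g y')) = op (A k) (\<phi> g k (\<phi> d' g x')) (\<phi> g k (\<phi> e' g y'))"
      using op[OF g(1) k(1,2) cl] by blast
    also have "\<phi> g k (\<phi> d' g x') = \<phi> d k x"
      using comp[OF d'(1) g(1) k(1) g(2) k(2) d'(2)] agree_everywhere[OF d x d' i k(1,3) le(1)] by simp
    also have "\<phi> g k (\<phi> e' g y') = \<phi> d k y"
      using comp[OF e'(1) g(1) k(1) g(3) k(2) e'(2)] agree_everywhere[OF d y e' j k(1,3) le(2)] by simp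
    also have "op (A k) (\<phi> d k x) (\<phi> d k y) = \<phi> d k (op (A d) x y)"
      using op[OF d k(1,3) x y] by simp
    finally show ?thesis
      using op[OF g(1,1) order_refl cl] op[OF d d order_refl x y] g(1) d k
      by (intro class_eqI[of g _ d _ k]) auto
  qed
  moreover have "(d, x) \<in> \<kappa> d x" "(d, y) \<in> \<kappa> d y" using in_own_class d x y by blast+
  ultimately show ?thesis using d by (fastforce simp: set_eq_iff)
qed

lemma lim_add:
  assumes "d \<in> D" "x \<in> carrier (A d)" "y \<in> carrier (A d)"
  shows "badd L (\<kappa> d x) (\<kappa> d y) = \<kappa> d (badd (A d) x y)"
proof -
  have "badd (A d) x y \<in> carrier (A d) \<and> \<phi> d e (badd (A d) x y) = badd (A e) (\<phi> d e x) (\<phi> d e y)"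
    if "d \<in> D" "e \<in> D" "d \<le> e" "x \<in> carrier (A d)" "y \<in> carrier (A d)" for d e x y
  proof -
    interpret measure_algebra "A d" using algebra[OF that(1)] .
    show ?thesis using map_add[OF that] that(4,5) by simp
  qed
  from lim_op[of badd, OF this assms] show ?thesis by (simp add: dir_lim_def)
qed

lemma lim_mul:
  assumes "d \<in> D" "x \<in> carrier (A d)" "y \<in> carrier (A d)"
  shows "bmul L (\<kappa> d x) (\<kappa> d y) = \<kappa> d (bmul (A d) x y)"
proof -
  have "bmul (A d) x y \<in> carrier (A d) \<and> \<phi> d e (bmul (A d) x y) = bmul (A e) (\<phi> d e x) (\<phi> d e y)"
    if "d \<in> D" "e \<in> D" "d \<le> e" "x \<in> carrier (A d)" "y \<in> carrier (A d)" for d e x y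
  proof -
    interpret measure_algebra "A d" using algebra[OF that(1)] .
    show ?thesis using map_mul[OF that] that(4,5) bmul_closed by simp
  qed
  from lim_op[of bmul, OF this assms] show ?thesis by (simp add: dir_lim_def)
qed

lemma map_zero:
  assumes "d \<in> D" "e \<in> D" "d \<le> e"
  shows "\<phi> d e (bzero (A d)) = bzero (A e)"
proof -
  interpret d: measure_algebra "A d" by (rule algebra) fact
  interpret e: measure_algebra "A e" by (rule algebra) fact
  show ?thesis
    using map_meas[OF assms d.add.one_closed] map_closed[OF assms d.add.one_closed] e.meas_eq_zero by simp
qed

lemma lim_zero:
  assumes "d \<in> D"
  shows "bzero L = \<kappa> d (bzero (A d))"
proof -
  have car: "bzero (A e) \<in> carrier (A e)" if "e \<in> D" for e
  proof -
    interpret measure_algebra "A e" using algebra[OF that] .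
    show ?thesis by simp
  qed
  have "\<kappa> e (bzero (A e)) = \<kappa> d (bzero (A d))" if e: "e \<in> D" for e
  proof -
    obtain g where "g \<in> D" "d \<le> g" "e \<le> g" using directed[OF assms e] by blast
    then show ?thesis using class_eqI[OF e car[OF e] assms car[OF assms]] map_zero assms e by auto
  qed
  then have "(\<Union>e\<in>D. \<kappa> e (bzero (A e))) = \<kappa> d (bzero (A d))"
    by (intro SUP_eq_const nonempty)
  then show ?thesis by (simp add: dir_lim_def)
qed

lemma lim_meas:
  assumes d: "d \<in> D" "x \<in> carrier (A d)"
  shows "meas L (\<kappa> d x) = meas (A d) x"
proof -
  have eq: "meas (A e) y = meas (A d) x" if "(e, y) \<in> \<kappa> d x" for e y
    using that map_meas d unfolding in_class_iff by metis
  have "(THE c. \<exists>(e, y)\<in>\<kappa> d x. c = meas (A e) y) = meas (A d) x"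
  proof (rule the_equality)
    show "\<exists>(e, y)\<in>\<kappa> d x. meas (A d) x = meas (A e) y"
      using in_own_class[OF d] by (intro bexI[of _ "(d, x)"]) simp_all
    show "c = meas (A d) x" if "\<exists>(e, y)\<in>\<kappa> d x. c = meas (A e) y" for c
      using that eq by (elim bexE) (simp split: prod.splits)
  qed
  then show ?thesis by (simp add: dir_lim_def)
qed

lemma stage_hom: "d \<in> D \<Longrightarrow> scaling_hom (A d) L 1 (\<kappa> d)"
  unfolding scaling_hom_def using lim_meas lim_add lim_mul by (auto simp: carrier_lim)

lemma measure_algebra_lim: "measure_algebra L"
proof -
  have stage: "\<exists>d\<in>D. F \<subseteq> \<kappa> d ` carrier (A d)" if "finite F" "F \<subseteq> carrier L" for F
    using common_stage[OF that] by blast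
  have lift: thesis if F: "{X, Y, Z} \<subseteq> carrier L"
    and *: "\<And>d x y z. d \<in> D \<Longrightarrow> measure_algebra (A d) \<Longrightarrow> x \<in> carrier (A d) \<Longrightarrow> y \<in> carrier (A d) \<Longrightarrow>
      z \<in> carrier (A d) \<Longrightarrow> X = \<kappa> d x \<Longrightarrow> Y = \<kappa> d y \<Longrightarrow> Z = \<kappa> d z \<Longrightarrow> thesis" for X Y Z thesis
  proof -
    obtain d where "d \<in> D" "{X, Y, Z} \<subseteq> \<kappa> d ` carrier (A d)" using stage[OF _ F] by auto
    then show thesis using * algebra by auto
  qed
  have in_lim: "\<kappa> d x \<in> carrier L" if "d \<in> D" "x \<in> carrier (A d)" for d x
    using that by (auto simp: carrier_lim)
  have zero: "bzero L \<in> carrier L"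
  proof -
    obtain d where d: "d \<in> D" using nonempty by blast
    interpret measure_algebra "A d" using algebra[OF d] .
    show ?thesis unfolding lim_zero[OF d] by (rule in_lim[OF d]) simp
  qed
  have "F2_boolean_algebra L"
  proof (rule F2_boolean_algebraI)
    show "bzero L \<in> carrier L" by (fact zero)
    fix X Y Z assume XYZ: "X \<in> carrier L" "Y \<in> carrier L" "Z \<in> carrier L"
    obtain d x y z where d: "d \<in> D" "measure_algebra (A d)" and
      x: "x \<in> carrier (A d)" "y \<in> carrier (A d)" "z \<in> carrier (A d)" and
      eqs: "X = \<kappa> d x" "Y = \<kappa> d y" "Z = \<kappa> d z"
      by (rule lift[of X Y Z]) (use XYZ in auto)
    interpret measure_algebra "A d" by (fact d(2))
    note ops = lim_add[OF d(1)] lim_mul[OF d(1)] lim_zero[OF d(1)]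
    note closed = x bmul_closed[OF x(1,2)] bmul_closed[OF x(2,3)] bmul_closed[OF x(1,3)]
    show "badd L X Y \<in> carrier L" "bmul L X Y \<in> carrier L"
      "badd L (bzero L) X = X" "badd L X X = bzero L" "bmul L X X = X"
      unfolding eqs by (simp_all add: ops closed in_lim[OF d(1)] char_two idem)
    show "badd L X Y = badd L Y X" "bmul L X Y = bmul L Y X"
      unfolding eqs using add.m_comm[OF x(1,2)] bmul_comm[OF x(1,2)] by (simp_all add: ops closed)
    show "badd L (badd L X Y) Z = badd L X (badd L Y Z)"
      unfolding eqs using add.m_assoc[OF x] by (simp add: ops closed)
    show "bmul L (bmul L X Y) Z = bmul L X (bmul L Y Z)"
      unfolding eqs using bmul_assoc[OF x] by (simp add: ops closed)
    show "bmul L (badd L X Y) Z = badd L (bmul L X Z) (bmul L Y Z)"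
      unfolding eqs using distrib[OF x] by (simp add: ops closed)
  qed
  moreover have "is_measure L (meas L)"
    unfolding is_measure_def
  proof (intro conjI ballI impI)
    fix X Y assume XY: "X \<in> carrier L" "Y \<in> carrier L"
    obtain d x y z where d: "d \<in> D" "measure_algebra (A d)" and
      x: "x \<in> carrier (A d)" "y \<in> carrier (A d)" and eqs: "X = \<kappa> d x" "Y = \<kappa> d y"
      by (rule lift[of X Y Y]) (use XY in auto)
    interpret measure_algebra "A d" by (fact d(2))
    have zero_iff: "\<kappa> d v = bzero L \<longleftrightarrow> v = bzero (A d)" if v: "v \<in> carrier (A d)" for v
    proof
      assume "\<kappa> d v = bzero L"
      then have "meas L (\<kappa> d v) = meas L (\<kappa> d (bzero (A d)))" using lim_zero[OF d(1)] by simp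
      then show "v = bzero (A d)" using v meas_eq_zero[OF v] by (simp add: lim_meas[OF d(1)])
    qed (simp add: lim_zero[OF d(1)])
    show "0 \<le> meas L X" "meas L X = 0 \<longleftrightarrow> X = bzero L"
      unfolding eqs using meas_nonneg[OF x(1)] meas_eq_zero[OF x(1)] zero_iff[OF x(1)]
      by (simp_all add: lim_meas[OF d(1)] x)
    assume "bmul L X Y = bzero L"
    then have "bmul (A d) x y = bzero (A d)"
      unfolding eqs lim_mul[OF d(1) x] using zero_iff[OF bmul_closed[OF x]] by simp
    from meas_add[OF x this] show "meas L (badd L X Y) = meas L X + meas L Y"
      unfolding eqs by (simp add: lim_add[OF d(1)] lim_meas[OF d(1)] x)
  qed
  ultimately show ?thesis by (simp add: measure_algebra_def measure_algebra_axioms_def)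
qed

lemma charted_lim:
  assumes ch: "\<And>d. d \<in> D \<Longrightarrow> charted (A d) (\<Gamma> d)"
  shows "charted L (\<Union>d\<in>D. \<Gamma> d)"
  unfolding charted_def
proof (intro conjI allI impI)
  fix F assume F: "finite F \<and> F \<subseteq> carrier L"
  obtain d where d: "d \<in> D" "F \<subseteq> \<kappa> d ` carrier (A d)" using common_stage[of F] F by blast
  obtain E where E: "E \<subseteq> carrier (A d)" "finite E" "F = \<kappa> d ` E"
    using finite_subset_image[OF _ d(2)] F by blast
  obtain n c \<psi> where \<psi>: "(n, c) \<in> \<Gamma> d" "chart (A d) {..<n} c \<psi>" "E \<subseteq> \<psi> ` Pow {..<n}"
    using charted_cover[OF ch[OF d(1)] E(2,1)] .
  have "chart L {..<n} c (\<lambda>X. \<kappa> d (\<psi> X))" using chart_image[OF \<psi>(2) stage_hom[OF d(1)]] by simp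
  moreover have "F \<subseteq> (\<lambda>X. \<kappa> d (\<psi> X)) ` Pow {..<n}"
    using \<psi>(3) unfolding E(3) by (metis image_image image_mono)
  ultimately show "\<exists>n c \<psi>. (n, c) \<in> (\<Union>d\<in>D. \<Gamma> d) \<and> chart L {..<n} c \<psi> \<and> F \<subseteq> \<psi> ` Pow {..<n}"
    using \<psi>(1) d(1) by (intro exI conjI) auto
next
  fix n c assume "(n, c) \<in> (\<Union>d\<in>D. \<Gamma> d)"
  then obtain d where d: "d \<in> D" "(n, c) \<in> \<Gamma> d" by blast
  obtain \<psi> where "chart (A d) {..<n} c \<psi>" using charted_realised[OF ch[OF d(1)] d(2)] by blast
  from chart_image[OF this stage_hom[OF d(1)]] show "\<exists>\<psi>. chart L {..<n} c \<psi>" by auto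
qed

lemma values_lim: "values L = (\<Union>d\<in>D. values (A d))"
  unfolding carrier_lim by (force simp: lim_meas)

lemma countable_lim:
  assumes "countable D" "\<And>d. d \<in> D \<Longrightarrow> countable (carrier (A d))"
  shows "countable (carrier L)"
  unfolding carrier_lim using assms by simp

end

section \<open>Finite tensor products of standard algebras\<close>

text \<open>
  The tensor product of the algebras \<open>St (P i)\<close> over \<open>i \<in> F\<close> consists of the sets of points of a
  finite grid with \<open>P i\<close> coordinates in the direction \<open>i\<close>.
\<close>

definition grid :: "('i \<Rightarrow> nat) \<Rightarrow> 'i set \<Rightarrow> ('i \<Rightarrow> nat) set" where
  "grid P F = (\<Pi>\<^sub>E i\<in>F. {..<P i})"

definition grid_alg :: "('i \<Rightarrow> nat) \<Rightarrow> 'i set \<Rightarrow> ('i \<Rightarrow> nat) set meas_alg" where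
  "grid_alg P F = \<lparr>carrier = Pow (grid P F), badd = sym_diff, bmul = (\<inter>), bzero = {},
     meas = (\<lambda>T. real (card T) / real (\<Prod>i\<in>F. P i))\<rparr>"

lemma grid_alg_simps:
  "carrier (grid_alg P F) = Pow (grid P F)" "badd (grid_alg P F) = sym_diff"
  "bmul (grid_alg P F) = (\<inter>)" "bzero (grid_alg P F) = {}"
  by (simp_all add: grid_alg_def)

definition box :: "'i set \<Rightarrow> ('i \<Rightarrow> nat \<Rightarrow> bit) \<Rightarrow> ('i \<Rightarrow> nat) set" where
  "box F x = (\<Pi>\<^sub>E i\<in>F. {j. x i j = 1})"

definition ind :: "nat set \<Rightarrow> nat \<Rightarrow> bit" where
  "ind X j = (if j \<in> X then 1 else 0)"

definition point :: "'i set \<Rightarrow> ('i \<Rightarrow> nat) \<Rightarrow> 'i \<Rightarrow> nat \<Rightarrow> bit" where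
  "point F t = (\<lambda>i\<in>F. ind {t i})"

lemma bit_add_eq_1: "a + b = (1::bit) \<longleftrightarrow> (a = 1) \<noteq> (b = 1)"
  by (cases a; cases b) auto

lemma bit_mult_eq_1: "a * b = (1::bit) \<longleftrightarrow> a = 1 \<and> b = 1"
  by (cases a; cases b) auto

lemma ind_in_St [simp]: "ind X \<in> carrier (St n) \<longleftrightarrow> X \<subseteq> {..<n}"
  by (auto simp: St_def ind_def not_le[symmetric])

lemma ind_eq_1 [simp]: "ind X j = 1 \<longleftrightarrow> j \<in> X"
  by (simp add: ind_def)

lemma St_eq_ind: "x = ind {j. x j = 1}"
  by (auto simp: ind_def fun_eq_iff)

lemma St_support: "x \<in> carrier (St n) \<Longrightarrow> {j. x j = 1} \<subseteq> {..<n}"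
  by (auto simp: St_def not_le[symmetric])

lemma badd_St_ind: "badd (St n) (ind X) (ind Y) = ind (sym_diff X Y)"
  by (auto simp: St_def ind_def fun_eq_iff)

lemma meas_St: "x \<in> carrier (St n) \<Longrightarrow> meas (St n) x = real (card {j. x j = 1}) / real n"
proof -
  assume "x \<in> carrier (St n)"
  then have "{i. i < n \<and> x i = 1} = {i. x i = 1}" by (auto simp: St_def not_le[symmetric])
  then show ?thesis by (simp add: St_def sum_bit_card)
qed

lemma unit_of_St: "n > 0 \<Longrightarrow> unit_of (St n) = ind {..<n}"
proof -
  assume n: "n > 0"
  interpret measure_algebra "St n" by (rule measure_algebra_St)
  show ?thesis
  proof (rule unit_of_eq(1))
    show "ind {..<n} \<in> carrier (St n)" by simp
    fix x assume x: "x \<in> carrier (St n)"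
    have "card {j. x j = 1} \<le> card {..<n}" using St_support[OF x] by (intro card_mono) auto
    then show "meas (St n) x \<le> meas (St n) (ind {..<n})"
      using n by (simp add: meas_St[OF x] meas_St divide_right_mono)
  qed
qed

lemma finite_grid: "finite F \<Longrightarrow> finite (grid P F)"
  by (simp add: grid_def finite_PiE)

lemma card_grid: "finite F \<Longrightarrow> card (grid P F) = (\<Prod>i\<in>F. P i)"
  by (simp add: grid_def card_PiE)

lemma measure_algebra_grid:
  assumes F: "finite F" and P: "\<And>i. i \<in> F \<Longrightarrow> P i > 0"
  shows "measure_algebra (grid_alg P F)"
proof -
  have pos: "(\<Prod>i\<in>F. P i) > 0" using P by (simp add: prod_pos)
  have fin: "finite T" if "T \<subseteq> grid P F" for T using that finite_grid[OF F] finite_subset by blast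
  have "F2_boolean_algebra (grid_alg P F)"
    by (rule F2_boolean_algebraI) (auto simp: grid_alg_def)
  moreover have "is_measure (grid_alg P F) (meas (grid_alg P F))"
  proof -
    have "card (sym_diff a b) = card a + card b"
      if "a \<subseteq> grid P F" "b \<subseteq> grid P F" "a \<inter> b = {}" for a b
    proof -
      have "sym_diff a b = a \<union> b" using that(3) by blast
      then show ?thesis using card_Un_disjoint[OF fin[OF that(1)] fin[OF that(2)] that(3)] by simp
    qed
    moreover have "0 < (\<Prod>i\<in>F. real (P i))" using pos by (simp flip: of_nat_prod)
    moreover have "\<not> (\<exists>i\<in>F. P i = 0)" using P by force
    ultimately show ?thesis
      unfolding is_measure_def using F by (auto simp: grid_alg_def fin add_divide_distrib prod_nonneg)
  qed
  ultimately show ?thesis by (simp add: measure_algebra_def measure_algebra_axioms_def)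
qed

lemma charted_grid_alg:
  assumes F: "finite F" and P: "\<And>i. i \<in> F \<Longrightarrow> P i > 0"
  shows "charted (grid_alg P F) {(\<Prod>i\<in>F. P i, 1 / real (\<Prod>i\<in>F. P i))}"
proof -
  let ?n = "\<Prod>i\<in>F. P i"
  have pos: "?n > 0" using P by (simp add: prod_pos)
  obtain h where h: "bij_betw h {..<?n} (grid P F)"
    using ex_bij_betw_nat_finite[OF finite_grid[OF F]] by (auto simp: card_grid[OF F] atLeast0LessThan)
  have id: "chart (grid_alg P F) (grid P F) (1 / real ?n) (\<lambda>T. T)"
    unfolding chart_def using pos by (simp add: grid_alg_def prod_pos P flip: of_nat_prod)
  have ch: "chart (grid_alg P F) {..<?n} (1 / real ?n) (\<lambda>X. h ` X)"
    using chart_rename[OF id finite_grid[OF F] h] .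
  have "T \<in> (\<lambda>X. h ` X) ` Pow {..<?n}" if "T \<subseteq> grid P F" for T
    using subset_image_iff[of T h "{..<?n}"] that h by (auto simp: bij_betw_def)
  then have "E \<subseteq> (\<lambda>X. h ` X) ` Pow {..<?n}" if "E \<subseteq> carrier (grid_alg P F)" for E
    using that by (auto simp: grid_alg_def)
  then show ?thesis
    unfolding charted_def using ch by blast
qed

lemma sum_sym_diff:
  fixes f :: "'x \<Rightarrow> ('g \<Rightarrow>\<^sub>0 bit)"
  assumes "finite A" "finite B"
  shows "sum f (sym_diff A B) = sum f A + sum f B"
proof -
  have "sum f A = sum f (A \<inter> B) + sum f (A - B)"
    using assms by (simp add: sum.Int_Diff)
  moreover have "sum f B = sum f (A \<inter> B) + sum f (B - A)"
    using assms by (metis Int_commute sum.Int_Diff)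
  moreover have "sum f (sym_diff A B) = sum f (A - B) + sum f (B - A)"
    using assms by (intro sum.union_disjoint) auto
  ultimately show ?thesis by (simp add: add.assoc add.left_commute)
qed

locale st_family =
  fixes P :: "'i \<Rightarrow> nat" and F :: "'i set"
  assumes fin: "finite F" and pos: "i \<in> F \<Longrightarrow> P i > 0"
begin

abbreviation "G \<equiv> (\<Pi>\<^sub>E i\<in>F. carrier (St (P i)))"
abbreviation "R \<equiv> ftensor_rels F (\<lambda>i. St (P i))"
abbreviation "pointwise \<equiv> (\<lambda>x y. \<lambda>i\<in>F. bmul (St (P i)) (x i) (y i))"

definition points_sum :: "('i \<Rightarrow> nat) set \<Rightarrow> (('i \<Rightarrow> nat \<Rightarrow> bit) \<Rightarrow>\<^sub>0 bit)" where
  "points_sum T = (\<Sum>t\<in>T. gen (point F t))"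

lemma upd_closed: "x \<in> G \<Longrightarrow> i \<in> F \<Longrightarrow> a \<in> carrier (St (P i)) \<Longrightarrow> x(i := a) \<in> G"
  by (auto simp: PiE_iff extensional_def)

lemma rel_coordinate:
  assumes "x \<in> G" "i \<in> F" "a \<in> carrier (St (P i))" "b \<in> carrier (St (P i))"
  shows "rel_cong R (gen (x(i := badd (St (P i)) a b))) (gen (x(i := a)) + gen (x(i := b)))"
  by (rule rel_cong_base) (use assms in \<open>auto simp: ftensor_rels_def\<close>)

lemma rel_coordinate_sum:
  assumes x: "x \<in> G" and i: "i \<in> F"
  shows "finite X \<Longrightarrow> X \<subseteq> {..<P i} \<Longrightarrow>
    rel_cong R (gen (x(i := ind X))) (\<Sum>j\<in>X. gen (x(i := ind {j})))"
proof (induction X rule: finite_induct)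
  case empty
  have "badd (St (P i)) (ind {}) (ind {}) = ind {}" by (simp add: badd_St_ind)
  then have "rel_cong R (gen (x(i := ind {}))) 0" using rel_coordinate[OF x i, of "ind {}" "ind {}"] by simp
  then show ?case by (simp only: sum.empty)
next
  case (insert j X)
  have "sym_diff {j} X = insert j X" using insert.hyps(2) by auto
  then have "badd (St (P i)) (ind {j}) (ind X) = ind (insert j X)" by (simp add: badd_St_ind)
  then have "rel_cong R (gen (x(i := ind (insert j X)))) (gen (x(i := ind {j})) + gen (x(i := ind X)))"
    using rel_coordinate[OF x i, of "ind {j}" "ind X"] insert.prems by simp
  also have "rel_cong R \<dots> (gen (x(i := ind {j})) + (\<Sum>j\<in>X. gen (x(i := ind {j}))))"
    by (rule rel_cong_add[OF rel_cong_refl insert.IH]) (use insert.prems in simp)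
  also have "\<dots> = (\<Sum>j\<in>insert j X. gen (x(i := ind {j})))"
    by (rule sum.insert[OF insert.hyps, symmetric])
  finally show ?case .
qed

text \<open>
  Multiadditivity expresses a generator through points. The induction expands the coordinates in
  \<open>E\<close> and leaves the others alone.
\<close>

lemma rel_expand:
  assumes x: "x \<in> G"
  shows "finite E \<Longrightarrow> E \<subseteq> F \<Longrightarrow>
    rel_cong R (gen x) (\<Sum>t\<in>box E x. gen (\<lambda>i\<in>F. if i \<in> E then ind {t i} else x i))"
proof (induction E rule: finite_induct)
  case empty
  have "(\<lambda>i\<in>F. x i) = x" using x by (simp add: PiE_iff extensional_restrict)
  then show ?case by (simp add: box_def)
next
  case (insert e E)
  define y where "y E t = (\<lambda>i\<in>F. if i \<in> E then ind {t i} else x i)" for E and t :: "'i \<Rightarrow> nat"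
  let ?S = "{j. x e j = 1}"
  have e: "e \<in> F" using insert.prems by simp
  have xe: "x e \<in> carrier (St (P e))" using x e by auto
  have S: "?S \<subseteq> {..<P e}" "finite ?S"
    using St_support[OF xe] finite_subset[OF St_support[OF xe]] by auto
  have xi: "x i \<in> carrier (St (P i))" if "i \<in> F" for i using x that by auto
  have yG: "y E t \<in> G" if t: "t \<in> box E x" for t
  proof -
    have "t i < P i" if "i \<in> E" for i
    proof -
      have "x i (t i) = 1" using t that by (auto simp: box_def PiE_iff)
      then show ?thesis using St_support[OF xi[of i]] that insert.prems by auto
    qed
    then show ?thesis using xi by (auto simp: y_def PiE_iff)
  qed
  have "rel_cong R (gen (y E t)) (\<Sum>j\<in>?S. gen (y (insert e E) (t(e := j))))" if t: "t \<in> box E x" for t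
  proof -
    have "y E t = (y E t)(e := ind ?S)"
    proof -
      have "y E t e = ind ?S"
        using insert.hyps(2) e St_eq_ind[of "x e"] by (simp only: y_def restrict_apply if_True if_False)
      then show ?thesis by (metis fun_upd_triv)
    qed
    moreover have "(y E t)(e := ind {j}) = y (insert e E) (t(e := j))" for j
      using insert.hyps(2) e by (auto simp: y_def fun_eq_iff restrict_def)
    ultimately show ?thesis
      using rel_coordinate_sum[OF yG[OF t] e S(2,1)] by simp
  qed
  then have "rel_cong R (\<Sum>t\<in>box E x. gen (y E t)) (\<Sum>t\<in>box E x. \<Sum>j\<in>?S. gen (y (insert e E) (t(e := j))))"
    by (rule rel_cong_sum)
  also have "(\<Sum>t\<in>box E x. \<Sum>j\<in>?S. gen (y (insert e E) (t(e := j)))) =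
      (\<Sum>(j, t)\<in>?S \<times> box E x. gen (y (insert e E) (t(e := j))))"
    by (subst sum.swap) (simp add: sum.cartesian_product)
  also have "\<dots> = (\<Sum>t\<in>box (insert e E) x. gen (y (insert e E) t))"
    unfolding box_def PiE_insert_eq
    by (subst sum.reindex[OF inj_combinator[OF insert.hyps(2)]]) (simp add: case_prod_unfold)
  finally have "rel_cong R (\<Sum>t\<in>box E x. gen (y E t)) (\<Sum>t\<in>box (insert e E) x. gen (y (insert e E) t))" .
  moreover have "rel_cong R (gen x) (\<Sum>t\<in>box E x. gen (y E t))"
    unfolding y_def by (rule insert.IH) (use insert.prems in simp)
  ultimately have "rel_cong R (gen x) (\<Sum>t\<in>box (insert e E) x. gen (y (insert e E) t))"
    by (rule rel_cong_trans[rotated])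
  then show ?case unfolding y_def .
qed

lemma box_closed: 
  assumes "x \<in> G"
  shows "box F x \<subseteq> grid P F"
  unfolding box_def grid_def by (rule PiE_mono) (use assms St_support in fastforce)

lemma points_gen:
  assumes x: "x \<in> G"
  shows "rel_cong R (gen x) (points_sum (box F x))"
proof -
  have "(\<Sum>t\<in>box F x. gen (\<lambda>i\<in>F. if i \<in> F then ind {t i} else x i)) = points_sum (box F x)"
    unfolding points_sum_def point_def
    by (rule sum.cong) (auto intro!: arg_cong[of _ _ gen] simp: restrict_def)
  then show ?thesis using rel_expand[OF x fin subset_refl] by simp
qed

lemma point_closed: "t \<in> grid P F \<Longrightarrow> point F t \<in> G"
  by (auto simp: point_def grid_def PiE_iff)

lemma box_point:
  assumes "t \<in> grid P F"
  shows "box F (point F t) = {t}"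
proof -
  have "box F (point F t) = (\<Pi>\<^sub>E i\<in>F. {t i})"
    unfolding box_def by (rule PiE_cong) (simp add: point_def)
  also have "\<dots> = {t}" using assms by (intro PiE_singleton) (auto simp: grid_def PiE_iff)
  finally show ?thesis .
qed

lemma points_generate:
  assumes "T \<subseteq> grid P F"
  shows "disjoint_sum (grid_alg P F) G (box F) T"
proof -
  have "finite T" using assms finite_grid[OF fin] finite_subset by blast
  then show ?thesis
    using assms
  proof (induction T rule: finite_induct)
    case empty
    show ?case using disjoint_sum.zero[of "grid_alg P F" G "box F"] by (simp add: grid_alg_def)
  next
    case (insert t T)
    have b: "box F (point F t) = {t}" using box_point insert.prems by simp
    have "badd (grid_alg P F) (box F (point F t)) T = insert t T"
      "bmul (grid_alg P F) (box F (point F t)) T = bzero (grid_alg P F)"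
      using insert.hyps(2) by (auto simp: b grid_alg_def)
    then show ?case
      using disjoint_sum.add[of "point F t" G "grid_alg P F" "box F" T] insert point_closed by auto
  qed
qed

lemma box_upd:
  assumes "i \<in> F"
  shows "t \<in> box F (x(i := c)) \<longleftrightarrow>
    t \<in> extensional F \<and> c (t i) = 1 \<and> (\<forall>j\<in>F - {i}. x j (t j) = 1)"
  using assms by (auto simp: box_def PiE_iff)

lemma presentation: "presentation (grid_alg P F) G pointwise R (box F) points_sum"
proof -
  interpret C: measure_algebra "grid_alg P F" by (rule measure_algebra_grid[OF fin pos])
  show ?thesis
  proof
    show "box F x \<in> carrier (grid_alg P F)" if "x \<in> G" for x
      using box_closed[OF that] by (simp add: grid_alg_def)
    show "pointwise x y \<in> G" if xy: "x \<in> G" "y \<in> G" for x y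
    proof -
      have "bmul (St (P i)) (x i) (y i) \<in> carrier (St (P i))" if "i \<in> F" for i
      proof -
        interpret measure_algebra "St (P i)" by (rule measure_algebra_St)
        show ?thesis using xy that by (intro bmul_closed) auto
      qed
      then show ?thesis by auto
    qed
    show "box F (pointwise x y) = bmul (grid_alg P F) (box F x) (box F y)" for x y
      by (auto simp: box_def grid_alg_def PiE_iff St_def bit_mult_eq_1)
    show "\<exists>x\<in>G. \<exists>y\<in>G. \<exists>z\<in>G. r = gen x + gen y + gen z \<and>
        box F x = badd (grid_alg P F) (box F y) (box F z)" if "r \<in> R" for r
    proof -
      obtain x i a b where r: "r = gen (x(i := badd (St (P i)) a b)) + gen (x(i := a)) + gen (x(i := b))"
        and x: "x \<in> G" "i \<in> F" "a \<in> carrier (St (P i))" "b \<in> carrier (St (P i))"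
        using \<open>r \<in> R\<close> unfolding ftensor_rels_def by blast
      interpret St: measure_algebra "St (P i)" by (rule measure_algebra_St)
      have "badd (St (P i)) a b (t i) = 1 \<longleftrightarrow> (a (t i) = 1) \<noteq> (b (t i) = 1)" for t
        by (simp add: St_def bit_add_eq_1)
      then have "box F (x(i := badd (St (P i)) a b)) =
          badd (grid_alg P F) (box F (x(i := a))) (box F (x(i := b)))"
        using x(2) by (auto simp: box_upd grid_alg_def)
      then show ?thesis
        using r upd_closed[OF x(1,2)] x(3,4) St.add.m_closed[OF x(3,4)] by blast
    qed
    show "rel_cong R (points_sum (bzero (grid_alg P F))) 0"
      by (simp add: points_sum_def grid_alg_def)
    show "rel_cong R (points_sum (badd (grid_alg P F) S T)) (points_sum S + points_sum T)"
      if "S \<in> carrier (grid_alg P F)" "T \<in> carrier (grid_alg P F)" for S T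
    proof -
      have "finite S" "finite T"
        using that finite_subset[OF _ finite_grid[OF fin, of P]] by (auto simp: grid_alg_def)
      then have "points_sum (badd (grid_alg P F) S T) = points_sum S + points_sum T"
        unfolding points_sum_def by (simp add: grid_alg_def sum_sym_diff)
      then show ?thesis by simp
    qed
    show "rel_cong R (gen x) (points_sum (box F x))" if "x \<in> G" for x
      using points_gen[OF that] .
    show "disjoint_sum (grid_alg P F) G (box F) T" if "T \<in> carrier (grid_alg P F)" for T
      using points_generate that by (simp add: grid_alg_def)
  qed
qed

sublocale presentation "grid_alg P F" G pointwise R "box F" points_sum
  by (rule presentation)

abbreviation "FT \<equiv> ftensor F (\<lambda>i. St (P i))"

lemma ftensor_grid:
  shows "measure_algebra FT" and "alg_iso (grid_alg P F) FT fibre"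
    and "\<And>T. T \<in> carrier (grid_alg P F) \<Longrightarrow> meas FT (fibre T) = meas (grid_alg P F) T"
proof -
  have w: "(\<Prod>i\<in>F. meas (St (P i)) (x i)) = meas (grid_alg P F) (box F x)" if x: "x \<in> G" for x
  proof -
    have "(\<Prod>i\<in>F. meas (St (P i)) (x i)) = (\<Prod>i\<in>F. real (card {j. x i j = 1}) / real (P i))"
      by (intro prod.cong refl meas_St PiE_mem[OF x])
    also have "\<dots> = meas (grid_alg P F) (box F x)"
      by (simp add: grid_alg_def box_def card_PiE[OF fin] prod_dividef)
    finally show ?thesis .
  qed
  note T = with_measure_presented[of "\<lambda>x. coset (F2_span R) (gen x)" "\<lambda>x. \<Prod>i\<in>F. meas (St (P i)) (x i)",
      OF refl w, folded ftensor_def]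
  show "measure_algebra FT" by (rule T(1))
  show "alg_iso (grid_alg P F) FT fibre" by (rule T(2))
  show "\<And>T. T \<in> carrier (grid_alg P F) \<Longrightarrow> meas FT (fibre T) = meas (grid_alg P F) T"
    by (rule T(4))
qed

lemma charted_ftensor: "charted FT {(\<Prod>i\<in>F. P i, 1 / real (\<Prod>i\<in>F. P i))}"
  using charted_transport[OF ftensor_grid(2,3) charted_grid_alg[OF fin pos]] by simp

lemma countable_ftensor: "countable (carrier FT)"
  by (rule countable_transport[OF ftensor_grid(2)])
    (simp add: grid_alg_def countable_finite finite_grid[OF fin])

end

text \<open>
  Under these identifications the embedding into a larger tensor product sends a set of points to the
  cylinder over it.
\<close>

definition cylinder :: "('i \<Rightarrow> nat) \<Rightarrow> 'i set \<Rightarrow> 'i set \<Rightarrow> ('i \<Rightarrow> nat) set \<Rightarrow> ('i \<Rightarrow> nat) set" where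
  "cylinder P F F' T = {t \<in> grid P F'. restrict t F \<in> T}"

lemma card_cylinder:
  assumes "finite F'" "F \<subseteq> F'" "T \<subseteq> grid P F"
  shows "card (cylinder P F F' T) = card T * (\<Prod>i\<in>F' - F. P i)"
proof -
  have finF: "finite F" using assms(1,2) finite_subset by blast
  have finT: "finite T" using finite_grid[OF finF] assms(3) finite_subset by blast
  have single: "cylinder P F F' {t} = (\<Pi>\<^sub>E i\<in>F'. if i \<in> F then {t i} else {..<P i})" if t: "t \<in> T" for t
  proof -
    have t': "t \<in> extensional F" "\<And>i. i \<in> F \<Longrightarrow> t i < P i" using t assms(3) by (auto simp: grid_def PiE_iff)
    have "restrict u F = t \<longleftrightarrow> (\<forall>i\<in>F. u i = t i)" for u
      using t'(1) by (auto simp: fun_eq_iff restrict_def extensional_def)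
    then show ?thesis
      using t'(2) assms(2) by (auto simp: cylinder_def grid_def PiE_iff extensional_def split: if_splits)
  qed
  have "card (cylinder P F F' {t}) = (\<Prod>i\<in>F' - F. P i)" if "t \<in> T" for t
  proof -
    have "card (cylinder P F F' {t}) = (\<Prod>i\<in>F'. if i \<in> F then 1 else P i)"
      unfolding single[OF that] card_PiE[OF assms(1)] by (rule prod.cong) auto
    also have "\<dots> = (\<Prod>i\<in>F' - F. P i)"
      using assms(1) by (simp add: prod.If_cases Diff_eq)
    finally show ?thesis .
  qed
  moreover have "cylinder P F F' T = (\<Union>t\<in>T. cylinder P F F' {t})"
    by (auto simp: cylinder_def)
  moreover have "card (\<Union>t\<in>T. cylinder P F F' {t}) = (\<Sum>t\<in>T. card (cylinder P F F' {t}))"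
    using finT finite_grid[OF assms(1), of P] by (intro card_UN_disjoint) (auto simp: cylinder_def)
  ultimately show ?thesis by simp
qed

lemma ftensor_emb_cylinder:
  assumes F: "st_family P F" and F': "st_family P F'" and sub: "F \<subseteq> F'" and T: "T \<subseteq> grid P F"
  shows "ftensor_emb (\<lambda>i. St (P i)) F F' (presentation.fibre (grid_alg P F) (\<Pi>\<^sub>E i\<in>F. carrier (St (P i))) (box F) T) =
    presentation.fibre (grid_alg P F') (\<Pi>\<^sub>E i\<in>F'. carrier (St (P i))) (box F') (cylinder P F F' T)"
proof -
  interpret F: st_family P F by fact
  interpret F': st_family P F' by fact
  define ext where "ext x = (\<lambda>i\<in>F'. if i \<in> F then x i else unit_of (St (P i)))" for x :: "'a \<Rightarrow> nat \<Rightarrow> bit"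
  have ext: "ext x \<in> F'.G" "box F' (ext x) = cylinder P F F' (box F x)" if x: "x \<in> F.G" for x
  proof -
    show "ext x \<in> F'.G" using x sub F'.pos by (auto simp: ext_def unit_of_St)
    have supp: "{j. x i j = 1} \<subseteq> {..<P i}" if "i \<in> F" for i
      using St_support x that by auto
    have "box F' (ext x) = (\<Pi>\<^sub>E i\<in>F'. if i \<in> F then {j. x i j = 1} else {..<P i})"
      unfolding box_def by (rule PiE_cong) (use F'.pos in \<open>auto simp: ext_def unit_of_St\<close>)
    also have "\<dots> = cylinder P F F' (box F x)"
    proof (rule Set.set_eqI)
      fix u
      have "restrict u F \<in> box F x \<longleftrightarrow> (\<forall>i\<in>F. x i (u i) = 1)" by (simp add: box_def PiE_iff)
      moreover have "u i < P i" if "i \<in> F" "x i (u i) = 1" for i using supp[OF that(1)] that(2) by auto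
      moreover have "i \<in> F'" if "i \<in> F" for i using sub that by blast
      ultimately show "u \<in> (\<Pi>\<^sub>E i\<in>F'. if i \<in> F then {j. x i j = 1} else {..<P i}) \<longleftrightarrow>
          u \<in> cylinder P F F' (box F x)"
        by (auto simp: cylinder_def grid_def PiE_iff split: if_splits)
    qed
    finally show "box F' (ext x) = cylinder P F F' (box F x)" .
  qed
  have main: "Poly_Mapping.keys (\<Sum>x\<in>Poly_Mapping.keys p. gen (ext x)) \<subseteq> F'.G \<and>
      F'.ev (\<Sum>x\<in>Poly_Mapping.keys p. gen (ext x)) = cylinder P F F' (F.ev p)"
    if "Poly_Mapping.keys p \<subseteq> F.G" for p
    using that
  proof (induction p rule: bit_poly_induct)
    case zero
    then show ?case by (simp add: grid_alg_simps cylinder_def)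
  next
    case (add g p)
    have g: "g \<in> F.G" and p: "Poly_Mapping.keys p \<subseteq> F.G" using add by (auto simp: keys_gen_add)
    note IH = add.IH[OF p]
    have sum: "(\<Sum>x\<in>Poly_Mapping.keys (gen g + p). gen (ext x)) =
        gen (ext g) + (\<Sum>x\<in>Poly_Mapping.keys p. gen (ext x))"
      using add.hyps by (simp add: keys_gen_add)
    have "F'.ev (gen (ext g) + (\<Sum>x\<in>Poly_Mapping.keys p. gen (ext x))) =
        sym_diff (cylinder P F F' (box F g)) (cylinder P F F' (F.ev p))"
      using F'.ev_gen_add[OF ext(1)[OF g]] IH ext(2)[OF g] by (simp add: grid_alg_simps)
    also have "\<dots> = cylinder P F F' (sym_diff (box F g) (F.ev p))"
      by (auto simp: cylinder_def)
    also have "\<dots> = cylinder P F F' (F.ev (gen g + p))"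
      using F.ev_gen_add[OF g p] by (simp add: grid_alg_simps)
    finally show ?case
      unfolding sum using F'.keys_add_closed[of "gen (ext g)"] ext(1)[OF g] IH by auto
  qed
  have "coset (F2_span F'.R) (\<Sum>x\<in>Poly_Mapping.keys p. gen (ext x)) = F'.fibre (cylinder P F F' T)"
    if "p \<in> F.fibre T" for p
    using that main[of p] F'.coset_eq_fibre by (auto simp: F.fibre_def)
  moreover obtain p where "p \<in> F.fibre T"
    using F.fibre_nonempty[of T] T by (auto simp: grid_alg_simps)
  ultimately show ?thesis
    unfolding ftensor_emb_def ext_def[symmetric] by auto
qed

text \<open>
  Forming cylinders respects sums and products, is transitive, and multiplies cardinalities by
  the number of points in the new directions, which the normalisation of the measure cancels.
\<close>

lemma directed_system_ftensor:
  assumes P: "\<And>i. i \<in> I \<Longrightarrow> P i > 0"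
  shows "directed_system {F. finite F \<and> F \<subseteq> I} (\<lambda>F. ftensor F (\<lambda>i. St (P i)))
    (ftensor_emb (\<lambda>i. St (P i)))"
proof -
  let ?fib = "\<lambda>F. presentation.fibre (grid_alg P F) (\<Pi>\<^sub>E i\<in>F. carrier (St (P i))) (box F)"
  let ?FT = "\<lambda>F. ftensor F (\<lambda>i. St (P i))"
  let ?emb = "ftensor_emb (\<lambda>i. St (P i))"
  have fam: "st_family P F" if "finite F" "F \<subseteq> I" for F
    using that P by unfold_locales auto
  have iso: "alg_iso (grid_alg P F) (?FT F) (?fib F)"
    and meas: "T \<subseteq> grid P F \<Longrightarrow> meas (?FT F) (?fib F T) = meas (grid_alg P F) T"
    and alg: "measure_algebra (?FT F)"
    if "finite F" "F \<subseteq> I" for F T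
    using st_family.ftensor_grid[OF fam[OF that]] by (auto simp: grid_alg_def)
  have emb: "?emb F F' (?fib F T) = ?fib F' (cylinder P F F' T)"
    if "finite F'" "F' \<subseteq> I" "F \<subseteq> F'" "T \<subseteq> grid P F" for F F' T
    using ftensor_emb_cylinder[OF fam fam] that by (meson finite_subset subset_trans)
  have cyl: "cylinder P F F' T \<subseteq> grid P F'" for F F' T by (auto simp: cylinder_def)
  have rep: "\<exists>T. T \<subseteq> grid P F \<and> X = ?fib F T" if "finite F" "F \<subseteq> I" "X \<in> carrier (?FT F)" for F X
    using alg_iso_surj[OF iso[OF that(1,2)] that(3)] by (auto simp: grid_alg_def)
  show ?thesis
  proof (rule directed_system.intro)
    show "{F. finite F \<and> F \<subseteq> I} \<noteq> {}" by blast
    show "\<exists>g\<in>{F. finite F \<and> F \<subseteq> I}. d \<le> g \<and> e \<le> g"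
      if "d \<in> {F. finite F \<and> F \<subseteq> I}" "e \<in> {F. finite F \<and> F \<subseteq> I}" for d e
      using that by (intro bexI[of _ "d \<union> e"]) auto
    show "measure_algebra (?FT F)" if "F \<in> {F. finite F \<and> F \<subseteq> I}" for F
      using that alg by blast
    show "scaling_hom (?FT F) (?FT F') 1 (?emb F F')"
      if "F \<in> {F. finite F \<and> F \<subseteq> I}" "F' \<in> {F. finite F \<and> F \<subseteq> I}" "F \<le> F'" for F F'
    proof -
      have F: "finite F" "F \<subseteq> I" and F': "finite F'" "F' \<subseteq> I" and sub: "F \<subseteq> F'" using that by auto
      note isoF = alg_isoD[OF iso[OF F]] and isoF' = alg_isoD[OF iso[OF F']]
      note emb' = emb[OF F' sub]
      have prod: "(\<Prod>i\<in>F'. P i) = (\<Prod>i\<in>F. P i) * (\<Prod>i\<in>F' - F. P i)"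
        using prod.subset_diff[OF sub F'(1), of P] by (simp add: mult.commute)
      have "(\<Prod>i\<in>F' - F. P i) > 0" using F'(2) P by (intro prod_pos) auto
      then have pres: "meas (grid_alg P F') (cylinder P F F' T) = meas (grid_alg P F) T"
        if "T \<subseteq> grid P F" for T
        using card_cylinder[OF F'(1) sub that] by (simp add: grid_alg_def prod del: of_nat_prod)
      have cyl_add: "cylinder P F F' (sym_diff S T) = sym_diff (cylinder P F F' S) (cylinder P F F' T)"
        and cyl_mul: "cylinder P F F' (S \<inter> T) = cylinder P F F' S \<inter> cylinder P F F' T" for S T
        by (auto simp: cylinder_def)
      show ?thesis
        unfolding scaling_hom_def
      proof (intro conjI ballI)
        fix X assume "X \<in> carrier (?FT F)"
        then obtain S where S: "S \<subseteq> grid P F" "X = ?fib F S" using rep[OF F] by blast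
        show "?emb F F' X \<in> carrier (?FT F')" "meas (?FT F') (?emb F F' X) = 1 * meas (?FT F) X"
          unfolding S(2) emb'[OF S(1)] using isoF'(2) cyl meas[OF F' cyl] meas[OF F S(1)] pres[OF S(1)]
          by (simp_all add: grid_alg_def)
        fix Y assume "Y \<in> carrier (?FT F)"
        then obtain T where T: "T \<subseteq> grid P F" "Y = ?fib F T" using rep[OF F] by blast
        have "badd (?FT F) X Y = ?fib F (sym_diff S T)" "bmul (?FT F) X Y = ?fib F (S \<inter> T)"
          unfolding S(2) T(2) using isoF(3,4)[of S T] S(1) T(1) by (simp_all add: grid_alg_def)
        moreover have "badd (?FT F') (?fib F' (cylinder P F F' S)) (?fib F' (cylinder P F F' T)) =
            ?fib F' (sym_diff (cylinder P F F' S) (cylinder P F F' T))"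
          "bmul (?FT F') (?fib F' (cylinder P F F' S)) (?fib F' (cylinder P F F' T)) =
            ?fib F' (cylinder P F F' S \<inter> cylinder P F F' T)"
          using isoF'(3,4)[of "cylinder P F F' S" "cylinder P F F' T"] cyl by (simp_all add: grid_alg_def)
        moreover have "sym_diff S T \<subseteq> grid P F" "S \<inter> T \<subseteq> grid P F" using S(1) T(1) by auto
        ultimately show "?emb F F' (badd (?FT F) X Y) = badd (?FT F') (?emb F F' X) (?emb F F' Y)"
          "?emb F F' (bmul (?FT F) X Y) = bmul (?FT F') (?emb F F' X) (?emb F F' Y)"
          using emb'[OF S(1)] emb'[OF T(1)] emb'[of "sym_diff S T"] emb'[of "S \<inter> T"]
          by (simp_all add: S(2) T(2) cyl_add cyl_mul)
      qed
    qed
    fix F1 F2 F3 X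
    assume F: "F1 \<in> {F. finite F \<and> F \<subseteq> I}" "F2 \<in> {F. finite F \<and> F \<subseteq> I}" "F3 \<in> {F. finite F \<and> F \<subseteq> I}"
      and le: "F1 \<le> F2" "F2 \<le> F3" and X: "X \<in> carrier (?FT F1)"
    obtain T where T: "T \<subseteq> grid P F1" "X = ?fib F1 T" using rep F(1) X by blast
    have "cylinder P F2 F3 (cylinder P F1 F2 T) = cylinder P F1 F3 T"
    proof -
      have "restrict (restrict t F2) F1 = restrict t F1" for t :: "'a \<Rightarrow> nat"
        using le(1) by (auto simp: restrict_def fun_eq_iff)
      moreover have "restrict t F2 \<in> grid P F2" if "t \<in> grid P F3" for t
        using that le(2) by (auto simp: grid_def PiE_iff)
      ultimately show ?thesis by (auto simp: cylinder_def)
    qed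
    then show "?emb F2 F3 (?emb F1 F2 X) = ?emb F1 F3 X"
      using emb[of F2 F1 T] emb[of F3 F2 "cylinder P F1 F2 T"] emb[of F3 F1 T] F le T cyl by auto
  qed
qed

section \<open>The algebra of a Steinitz number\<close>

abbreviation steinitz_index :: "steinitz \<Rightarrow> (nat \<times> nat) set" where
  "steinitz_index s \<equiv> {(p, k). prime p \<and> enat k < expo s p}"

text \<open>
  A finite set of indices uses each prime \<open>p\<close> at most as often as its exponent in \<open>s\<close> allows, and
  every divisor arises by taking, for each \<open>p\<close>, as many of the indices \<open>(p, 0), (p, 1), \<dots>\<close> as needed.
\<close>

lemma prod_index_Omega:
  assumes "finite F" "F \<subseteq> steinitz_index s"
  shows "(\<Prod>i\<in>F. fst i) \<in> Omega s"
  unfolding Omega_iff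
proof (intro conjI allI impI)
  have primes: "prime (fst i)" if "i \<in> F" for i using assms(2) that by auto
  have nz: "0 \<notin> fst ` F" using primes not_prime_0 by (metis imageE)
  show "0 < (\<Prod>i\<in>F. fst i)" using primes by (intro prod_pos) (simp add: prime_gt_0_nat)
  fix q :: nat assume q: "prime q"
  have "multiplicity q (\<Prod>i\<in>F. fst i) = (\<Sum>i\<in>F. multiplicity q (fst i))"
    using q nz assms(1) by (intro prime_elem_multiplicity_prod_distrib) auto
  also have "\<dots> = (\<Sum>i\<in>F. if fst i = q then 1 else 0)"
    using q primes by (intro sum.cong) (auto simp: prime_multiplicity_other)
  also have "\<dots> = card {i \<in> F. fst i = q}"
    using sum_bit_card[OF assms(1), of "\<lambda>i. fst i = q"] by simp
  also have "\<dots> = card (snd ` {i \<in> F. fst i = q})"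
    by (rule card_image[symmetric]) (auto simp: inj_on_def prod_eq_iff)
  finally have mult: "multiplicity q (\<Prod>i\<in>F. fst i) = card (snd ` {i \<in> F. fst i = q})" .
  have sub: "snd ` {i \<in> F. fst i = q} \<subseteq> {k. enat k < expo s q}" using assms(2) by auto
  show "enat (multiplicity q (\<Prod>i\<in>F. fst i)) \<le> expo s q"
  proof (cases "expo s q")
    case (enat n)
    then have "snd ` {i \<in> F. fst i = q} \<subseteq> {..<n}" using sub by auto
    then have "card (snd ` {i \<in> F. fst i = q}) \<le> n" by (metis card_lessThan card_mono finite_lessThan)
    then show ?thesis using mult enat by simp
  qed simp
qed

lemma Omega_prod_index:
  assumes "b \<in> Omega s"
  shows "\<exists>F. finite F \<and> F \<subseteq> steinitz_index s \<and> b = (\<Prod>i\<in>F. fst i)"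
proof -
  have b: "b > 0" "\<And>p. prime p \<Longrightarrow> enat (multiplicity p b) \<le> expo s p"
    using assms by (auto simp: Omega_iff)
  define F where "F = (SIGMA p:prime_factors b. {..<multiplicity p b})"
  have "finite F" by (simp add: F_def)
  moreover have "F \<subseteq> steinitz_index s"
  proof
    fix i assume "i \<in> F"
    then obtain p k where i: "i = (p, k)" "p \<in> prime_factors b" "k < multiplicity p b"
      by (auto simp: F_def)
    then have p: "prime p" by (simp add: in_prime_factors_imp_prime)
    have "enat k < enat (multiplicity p b)" using i(3) by simp
    also have "\<dots> \<le> expo s p" using b(2)[OF p] .
    finally show "i \<in> steinitz_index s" using p i(1) by simp
  qed
  moreover have "(\<Prod>i\<in>F. fst i) = (\<Prod>p\<in>prime_factors b. \<Prod>k<multiplicity p b. p)"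
    unfolding F_def by (subst prod.Sigma) (auto simp: case_prod_unfold)
  then have "(\<Prod>i\<in>F. fst i) = b"
    using b(1) prime_factorization_nat[of b] by simp
  ultimately show ?thesis by (intro exI[of _ F]) simp
qed

lemma H_unital_lim:
  "H_unital s = dir_lim {F. finite F \<and> F \<subseteq> steinitz_index s} (\<lambda>F. ftensor F (\<lambda>i. St (fst i)))
     (ftensor_emb (\<lambda>i. St (fst i)))"
  by (simp add: H_unital_def inf_tensor_def case_prod_unfold)

lemma H_unital:
  shows measure_algebra_H_unital: "measure_algebra (H_unital s)"
    and countable_H_unital: "countable (carrier (H_unital s))"
    and charted_H_unital: "charted (H_unital s) {(b, 1 / real b) | b. b \<in> Omega s}"
proof -
  have pos: "fst i > 0" if "i \<in> steinitz_index s" for i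
    using that by (auto dest: prime_gt_0_nat)
  interpret directed_system "{F. finite F \<and> F \<subseteq> steinitz_index s}" "\<lambda>F. ftensor F (\<lambda>i. St (fst i))"
    "ftensor_emb (\<lambda>i. St (fst i))"
    by (rule directed_system_ftensor) (rule pos)
  have fam: "st_family fst F" if "F \<in> {F. finite F \<and> F \<subseteq> steinitz_index s}" for F
    using that pos by unfold_locales auto
  show "measure_algebra (H_unital s)" unfolding H_unital_lim by (rule measure_algebra_lim)
  show "countable (carrier (H_unital s))"
    unfolding H_unital_lim
  proof (rule countable_lim)
    show "countable {F. finite F \<and> F \<subseteq> steinitz_index s}"
      by (rule countable_Collect_finite_subset) simp
  qed (rule st_family.countable_ftensor[OF fam])
  have "charted (H_unital s) (\<Union>F\<in>{F. finite F \<and> F \<subseteq> steinitz_index s}.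
      {(\<Prod>i\<in>F. fst i, 1 / real (\<Prod>i\<in>F. fst i))})"
    unfolding H_unital_lim by (rule charted_lim) (rule st_family.charted_ftensor[OF fam])
  also have "(\<Union>F\<in>{F. finite F \<and> F \<subseteq> steinitz_index s}. {(\<Prod>i\<in>F. fst i, 1 / real (\<Prod>i\<in>F. fst i))}) =
      (\<lambda>b. (b, 1 / real b)) ` (\<lambda>F. \<Prod>i\<in>F. fst i) ` {F. finite F \<and> F \<subseteq> steinitz_index s}"
    by (simp only: image_image UNION_singleton_eq_range)
  also have "(\<lambda>F. \<Prod>i\<in>F. fst i) ` {F. finite F \<and> F \<subseteq> steinitz_index s} = Omega s"
  proof (intro equalityI subsetI)
    show "n \<in> Omega s" if "n \<in> (\<lambda>F. \<Prod>i\<in>F. fst i) ` {F. finite F \<and> F \<subseteq> steinitz_index s}" for n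
      using that prod_index_Omega by (elim imageE) simp
    show "n \<in> (\<lambda>F. \<Prod>i\<in>F. fst i) ` {F. finite F \<and> F \<subseteq> steinitz_index s}" if "n \<in> Omega s" for n
      using Omega_prod_index[OF that] by (elim exE conjE) (rule image_eqI, assumption, simp)
  qed
  also have "(\<lambda>b. (b, 1 / real b)) ` Omega s = {(b, 1 / real b) | b. b \<in> Omega s}" by blast
  finally show "charted (H_unital s) {(b, 1 / real b) | b. b \<in> Omega s}" .
qed

lemma unit_H_unital:
  "unit_of (H_unital s) \<in> carrier (H_unital s)" "meas (H_unital s) (unit_of (H_unital s)) = 1"
proof -
  interpret measure_algebra "H_unital s" by (rule measure_algebra_H_unital)
  have "(1, 1 / real 1) \<in> {(b, 1 / real b) | b. b \<in> Omega s}"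
    using one_Omega by blast
  then obtain \<psi> where \<psi>: "chart (H_unital s) {..<1::nat} (1 / real 1) \<psi>"
    using charted_realised[OF charted_H_unital] by blast
  have u: "\<psi> {..<1::nat} \<in> carrier (H_unital s)" "meas (H_unital s) (\<psi> {..<1::nat}) = 1"
    using chartD(2,3)[OF \<psi>, of "{..<1::nat}"] by auto
  have "meas (H_unital s) x \<le> 1" if x: "x \<in> carrier (H_unital s)" for x
  proof -
    have "meas (H_unital s) x \<in> values (H_unital s)" using x by blast
    then obtain b k where "b \<in> Omega s" "meas (H_unital s) x = 1 / real b * real k" "k \<le> b"
      unfolding values_charted[OF charted_H_unital] by blast
    then show ?thesis using Omega_pos[of b s] by simp
  qed
  then have "unit_of (H_unital s) = \<psi> {..<1::nat}"
    using unit_of_eq(1)[OF u(1)] u(2) by simp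
  then show "unit_of (H_unital s) \<in> carrier (H_unital s)" "meas (H_unital s) (unit_of (H_unital s)) = 1"
    using u by simp_all
qed

lemma atomic_tensorI: "atomic A I \<iota> w \<Longrightarrow> measure_algebra B \<Longrightarrow> atomic_tensor A I \<iota> w B"
  by (simp add: atomic_tensor_def)

lemma countable_St: "countable (carrier (St n))"
proof -
  have "carrier (St n) \<subseteq> ind ` Pow {..<n}"
    using St_eq_ind St_support by blast
  then show ?thesis by (rule countable_subset) (simp add: countable_finite)
qed

lemma charted_St: 
  assumes "n \<ge> 1"
  shows "charted (St n) {(n, 1 / real n)}"
proof -
  have ch: "chart (St n) {..<n} (1 / real n) ind"
    unfolding chart_def
  proof (intro conjI allI impI)
    show "0 < 1 / real n" using assms by simp
    fix X assume X: "X \<subseteq> {..<n}"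
    then show "ind X \<in> carrier (St n)" "meas (St n) (ind X) = 1 / real n * real (card X)"
      by (simp_all add: meas_St)
    fix Y
    show "badd (St n) (ind X) (ind Y) = ind (sym_diff X Y)" by (rule badd_St_ind)
    show "bmul (St n) (ind X) (ind Y) = ind (X \<inter> Y)" by (auto simp: St_def ind_def fun_eq_iff)
  qed
  have "F \<subseteq> ind ` Pow {..<n}" if "F \<subseteq> carrier (St n)" for F
    using that St_eq_ind St_support by blast
  then show ?thesis unfolding charted_def using ch by blast
qed

lemma values_St: "n \<ge> 1 \<Longrightarrow> values (St n) = (\<lambda>k. real k / real n) ` {..n}"
  unfolding values_charted[OF charted_St] by auto

lemma (in atomic_tensor) values_tensor:
  assumes "charted B \<Gamma>"
  shows "v \<in> values (tensor A B) \<longleftrightarrow> (\<exists>K n c k. finite K \<and> K \<subseteq> I \<and> (n, c) \<in> \<Gamma> \<and>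
    k \<le> card K * n \<and> v = w * c * real k)"
  unfolding values_charted[OF charted_tensor[OF assms]] by blast

lemma values_tensor_H_infinity: "values (tensor H_infinity (H_unital s)) = fractions s"
proof -
  interpret atomic_tensor H_infinity UNIV id 1 "H_unital s"
    by (rule atomic_tensorI[OF atomic_H_infinity measure_algebra_H_unital])
  note vals = values_tensor[OF charted_H_unital]
  show ?thesis
  proof (intro equalityI subsetI)
    fix v assume "v \<in> values (tensor H_infinity (H_unital s))"
    then obtain b k where "b \<in> Omega s" "v = 1 * (1 / real b) * real k"
      unfolding vals by blast
    then show "v \<in> fractions s" using fractionsI[of b s k] by simp
  next
    fix v assume "v \<in> fractions s"
    then obtain k b where v: "b \<in> Omega s" "v = real k / real b" unfolding fractions_def by blast
    have "k \<le> card {..<k} * b" using Omega_pos[OF v(1)] by simp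
    moreover have "v = 1 * (1 / real b) * real k" using v(2) by simp
    moreover have "(b, 1 / real b) \<in> {(b, 1 / real b) | b. b \<in> Omega s}" using v(1) by blast
    ultimately show "v \<in> values (tensor H_infinity (H_unital s))"
      unfolding vals using finite_lessThan subset_UNIV by blast
  qed
qed

section \<open>Corners and rescaled measures\<close>

lemma corner_carrier:
  assumes "measure_algebra H" "e \<in> carrier H"
  shows "carrier (corner H e) = {x \<in> carrier H. bmul H e x = x}"
proof -
  interpret measure_algebra H by fact
  show ?thesis using assms(2) mul_left_idem[OF assms(2)] bmul_closed by (force simp: corner_def)
qed

lemma corner_ops [simp]:
  "badd (corner H e) = badd H" "bmul (corner H e) = bmul H" "bzero (corner H e) = bzero H"
  "meas (corner H e) = meas H"
  by (simp_all add: corner_def)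

lemma measure_algebra_corner:
  assumes "measure_algebra H" "e \<in> carrier H"
  shows "measure_algebra (corner H e)"
proof -
  interpret measure_algebra H by fact
  note car = corner_carrier[OF assms]
  have "F2_boolean_algebra (corner H e)"
  proof (rule F2_boolean_algebraI)
    show "badd (corner H e) x y \<in> carrier (corner H e)" if "x \<in> carrier (corner H e)" "y \<in> carrier (corner H e)" for x y
      using that assms(2) by (auto simp: car distrib_left)
    show "bmul (corner H e) x y \<in> carrier (corner H e)" if "x \<in> carrier (corner H e)" "y \<in> carrier (corner H e)" for x y
      using that assms(2) bmul_assoc[of e x y] by (auto simp: car bmul_closed)
    show "badd (corner H e) (badd (corner H e) x y) z = badd (corner H e) x (badd (corner H e) y z)"
      "bmul (corner H e) (bmul (corner H e) x y) z = bmul (corner H e) x (bmul (corner H e) y z)"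
      "bmul (corner H e) (badd (corner H e) x y) z = badd (corner H e) (bmul (corner H e) x z) (bmul (corner H e) y z)"
      if "x \<in> carrier (corner H e)" "y \<in> carrier (corner H e)" "z \<in> carrier (corner H e)" for x y z
      using that add.m_assoc[of x y z] bmul_assoc[of x y z] distrib[of x y z] by (simp_all add: car)
  qed (auto simp: car mul_zero assms(2) char_two add.m_comm bmul_comm idem)
  moreover have "is_measure (corner H e) (meas (corner H e))"
    unfolding is_measure_def using meas_nonneg meas_eq_zero meas_add by (simp add: car)
  ultimately show ?thesis by (simp add: measure_algebra_def measure_algebra_axioms_def)
qed

lemma countable_corner: "measure_algebra H \<Longrightarrow> e \<in> carrier H \<Longrightarrow> countable (carrier H) \<Longrightarrow> countable (carrier (corner H e))"
  by (simp add: corner_def)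

text \<open>
  If \<open>e\<close> belongs to a chart, the chart restricts to the points of \<open>e\<close>, and the product with \<open>e\<close> is the
  intersection with these points.
\<close>

lemma chart_corner:
  assumes H: "measure_algebra H" and e: "e \<in> carrier H"
    and \<psi>: "chart H {..<n::nat} c \<psi>" and E: "E \<subseteq> {..<n}" "e = \<psi> E"
  shows "\<exists>\<theta>. chart (corner H e) {..<card E} c \<theta> \<and>
    {x \<in> \<psi> ` Pow {..<n}. bmul H e x = x} \<subseteq> \<theta> ` Pow {..<card E}"
proof -
  have "finite E" using E(1) finite_subset by blast
  then obtain h where h: "bij_betw h {..<card E} E"
    using ex_bij_betw_nat_finite[of E] by (auto simp: atLeast0LessThan)
  have "chart (corner H e) E c \<psi>"
    unfolding chart_def corner_ops corner_carrier[OF H e]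
  proof (intro conjI allI impI)
    show "c > 0" using chartD(1)[OF \<psi>] .
    fix X assume X: "X \<subseteq> E"
    then have Xn: "X \<subseteq> {..<n}" using E(1) by blast
    have "bmul H e (\<psi> X) = \<psi> (E \<inter> X)" unfolding E(2) by (rule chartD(5)[OF \<psi> E(1) Xn])
    also have "E \<inter> X = X" using X by blast
    finally show "\<psi> X \<in> {x \<in> carrier H. bmul H e x = x}" using chartD(2)[OF \<psi> Xn] by simp
    show "meas H (\<psi> X) = c * real (card X)" using chartD(3)[OF \<psi> Xn] .
    fix Y assume "Y \<subseteq> E"
    then have Yn: "Y \<subseteq> {..<n}" using E(1) by blast
    show "badd H (\<psi> X) (\<psi> Y) = \<psi> (sym_diff X Y)" "bmul H (\<psi> X) (\<psi> Y) = \<psi> (X \<inter> Y)"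
      using chartD(4,5)[OF \<psi> Xn Yn] .
  qed
  from chart_rename[OF this \<open>finite E\<close> h]
  have ch: "chart (corner H e) {..<card E} c (\<lambda>X. \<psi> (h ` X))" .
  have "{x \<in> \<psi> ` Pow {..<n}. bmul H e x = x} \<subseteq> (\<lambda>X. \<psi> (h ` X)) ` Pow {..<card E}"
  proof
    fix x assume "x \<in> {x \<in> \<psi> ` Pow {..<n}. bmul H e x = x}"
    then obtain X where X: "X \<subseteq> {..<n}" "x = \<psi> X" "bmul H e x = x" by blast
    have "x = \<psi> (E \<inter> X)" using chartD(5)[OF \<psi> E(1) X(1)] X(2,3) E(2) by simp
    moreover have "E \<inter> X \<subseteq> h ` {..<card E}" using h by (simp add: bij_betw_def)
    then obtain Z where "Z \<subseteq> {..<card E}" "E \<inter> X = h ` Z" unfolding subset_image_iff by blast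
    ultimately show "x \<in> (\<lambda>X. \<psi> (h ` X)) ` Pow {..<card E}"
      by (intro image_eqI[of _ _ Z]) auto
  qed
  then show ?thesis using ch by blast
qed

lemma charted_corner:
  assumes H: "measure_algebra H" and e: "e \<in> carrier H" and ch: "charted H \<Gamma>"
  shows "\<exists>\<Delta>. charted (corner H e) \<Delta>"
proof (intro exI, rule charted_UNIV)
  fix F assume F: "finite F" "F \<subseteq> carrier (corner H e)"
  have sub: "insert e F \<subseteq> carrier H" using F(2) e by (auto simp: corner_carrier[OF H e])
  obtain n c \<psi> where \<psi>: "chart H {..<n::nat} c \<psi>" "insert e F \<subseteq> \<psi> ` Pow {..<n}"
    by (rule charted_cover[OF ch _ sub]) (use F(1) in simp_all)
  then obtain E where E: "E \<subseteq> {..<n}" "e = \<psi> E" by auto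
  obtain \<theta> where \<theta>: "chart (corner H e) {..<card E} c \<theta>"
      "{x \<in> \<psi> ` Pow {..<n}. bmul H e x = x} \<subseteq> \<theta> ` Pow {..<card E}"
    using chart_corner[OF H e \<psi>(1) E] by blast
  moreover have "F \<subseteq> {x \<in> \<psi> ` Pow {..<n}. bmul H e x = x}"
    using F(2) \<psi>(2) by (auto simp: corner_carrier[OF H e])
  ultimately show "\<exists>n c \<psi>. chart (corner H e) {..<n::nat} c \<psi> \<and> F \<subseteq> \<psi> ` Pow {..<n}"
    by (intro exI[of _ "card E"] exI[of _ c] exI[of _ \<theta>]) auto
qed

lemma values_corner:
  assumes H: "measure_algebra H" and e: "e \<in> carrier H" and ch: "charted H \<Gamma>"
  shows "values (corner H e) = values H \<inter> {..meas H e}"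
proof (intro equalityI subsetI)
  interpret measure_algebra H by fact
  fix v assume "v \<in> values (corner H e)"
  then obtain x where x: "x \<in> carrier H" "bmul H e x = x" "v = meas H x"
    by (auto simp: corner_carrier[OF H e])
  have "meas H e = meas H (bmul H x e) + meas H (badd H e (bmul H x e))"
    by (rule meas_split[OF e x(1)])
  moreover have "bmul H x e = x" using x(2) bmul_comm[OF e x(1)] by simp
  moreover have "0 \<le> meas H (badd H e (bmul H x e))"
    using e x(1) by (intro meas_nonneg) (auto simp: bmul_closed)
  ultimately show "v \<in> values H \<inter> {..meas H e}" using x(1,3) by auto
next
  fix v assume "v \<in> values H \<inter> {..meas H e}"
  then obtain y where y: "y \<in> carrier H" "v = meas H y" "v \<le> meas H e" by auto
  obtain n c \<psi> where \<psi>: "chart H {..<n::nat} c \<psi>" "{e, y} \<subseteq> \<psi> ` Pow {..<n}"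
    by (rule charted_cover[OF ch, of "{e, y}"]) (use e y(1) in simp_all)
  then obtain E Y where E: "E \<subseteq> {..<n}" "e = \<psi> E" and Y: "Y \<subseteq> {..<n}" "y = \<psi> Y" by auto
  have "c * real (card Y) \<le> c * real (card E)"
    using y(2,3) chartD(3)[OF \<psi>(1) E(1)] chartD(3)[OF \<psi>(1) Y(1)] E(2) Y(2) by simp
  then have "card Y \<le> card E" using chartD(1)[OF \<psi>(1)] by simp
  obtain \<theta> where "chart (corner H e) {..<card E} c \<theta>"
    using chart_corner[OF H e \<psi>(1) E] by blast
  from chart_values[OF this \<open>card Y \<le> card E\<close>] show "v \<in> values (corner H e)"
    using y(2) chartD(3)[OF \<psi>(1) Y(1)] Y(2) by simp
qed

lemma scale_meas_simps [simp]:
  "carrier (scale_meas c H) = carrier H" "badd (scale_meas c H) = badd H"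
  "bmul (scale_meas c H) = bmul H" "bzero (scale_meas c H) = bzero H"
  "meas (scale_meas c H) x = c * meas H x"
  by (simp_all add: scale_meas_def)

text \<open>
  The stages with \<open>m\<^sub>i = 0\<close> carry the scalar zero. They are zero algebras, on which the zero function is
  a measure.
\<close>

lemma measure_algebra_scale:
  assumes H: "measure_algebra H" and c: "c > 0 \<or> c = 0 \<and> carrier H = {bzero H}"
  shows "measure_algebra (scale_meas c H)"
proof -
  interpret measure_algebra H by fact
  have "alg_iso H (scale_meas c H) id" by (simp add: alg_iso_def)
  then have "F2_boolean_algebra (scale_meas c H)"
    by (rule F2_boolean_algebra_transport[OF F2_boolean_algebra_axioms]) simp
  moreover have "is_measure (scale_meas c H) (meas (scale_meas c H))"
    using c
  proof
    assume "c > 0"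
    then show ?thesis
      unfolding is_measure_def using meas_nonneg meas_eq_zero meas_add by (simp add: algebra_simps)
  next
    assume "c = 0 \<and> carrier H = {bzero H}"
    then show ?thesis by (simp add: is_measure_def)
  qed
  ultimately show ?thesis by (simp add: measure_algebra_def measure_algebra_axioms_def)
qed

lemma charted_scale:
  assumes H: "measure_algebra H" "charted H \<Gamma>" and c: "c > 0 \<or> c = 0 \<and> carrier H = {bzero H}"
  shows "\<exists>\<Delta>. charted (scale_meas c H) \<Delta>"
proof (intro exI, rule charted_UNIV)
  fix F assume F: "finite F" "F \<subseteq> carrier (scale_meas c H)"
  show "\<exists>n d \<psi>. chart (scale_meas c H) {..<n::nat} d \<psi> \<and> F \<subseteq> \<psi> ` Pow {..<n}"
    using c
  proof
    assume "c > 0"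
    obtain n d \<psi> where \<psi>: "chart H {..<n::nat} d \<psi>" "F \<subseteq> \<psi> ` Pow {..<n}"
      by (rule charted_cover[OF H(2) F(1)]) (use F(2) in simp_all)
    have "chart (scale_meas c H) {..<n} (c * d) \<psi>"
      using \<psi>(1) \<open>c > 0\<close> unfolding chart_def by (simp add: mult.assoc)
    then show ?thesis using \<psi>(2) by blast
  next
    assume 0: "c = 0 \<and> carrier H = {bzero H}"
    have "chart (scale_meas c H) {..<0::nat} 1 (\<lambda>_. bzero H)"
      using chart_zero[OF measure_algebra_scale[OF H(1) c], of 1] by simp
    moreover have "F \<subseteq> (\<lambda>_. bzero H) ` Pow {..<0::nat}" using 0 F(2) by simp
    ultimately show ?thesis by blast
  qed
qed

lemma values_scale: "values (scale_meas c H) = (*) c ` values H"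
  by (simp add: image_image)

lemma scaling_hom_comp:
  "scaling_hom A B \<alpha> f \<Longrightarrow> scaling_hom B C \<beta> g \<Longrightarrow> scaling_hom A C (\<beta> * \<alpha>) (g \<circ> f)"
  unfolding scaling_hom_def by (simp add: mult.assoc)

lemma scaled_initial_segment:
  fixes r t :: real
  assumes "t > 0" "r \<le> t"
  shows "(*) (1 / t) ` (S \<inter> {..t}) \<inter> {..r / t} = (*) (1 / t) ` (S \<inter> {..r})"
proof (intro equalityI subsetI)
  fix v assume "v \<in> (*) (1 / t) ` (S \<inter> {..t}) \<inter> {..r / t}"
  then obtain q where q: "q \<in> S" "v = 1 / t * q" "v \<le> r / t" by auto
  then have "q \<le> r" using assms(1) by (simp add: divide_le_cancel)
  then show "v \<in> (*) (1 / t) ` (S \<inter> {..r})" using q(1,2) by auto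
next
  fix v assume "v \<in> (*) (1 / t) ` (S \<inter> {..r})"
  then obtain q where q: "q \<in> S" "q \<le> r" "v = 1 / t * q" by auto
  then have "v \<le> r / t" "q \<le> t" using assms by (simp_all add: divide_le_cancel)
  then show "v \<in> (*) (1 / t) ` (S \<inter> {..t}) \<inter> {..r / t}" using q(1,3) by auto
qed

section \<open>The limit algebras\<close>

text \<open>
  The chain \<open>b\<close> and the identifications are arbitrary choices in the construction, so everything is
  proved for all of them. The growth condition is what places the corner inside the next stage.
\<close>

locale limit_data =
  fixes m :: "nat \<Rightarrow> nat" and s :: steinitz and b :: "nat \<Rightarrow> nat"
  assumes chain: "divisor_chain s b"
    and growth: "c > 0 \<Longrightarrow> k > 0 \<Longrightarrow> m c * k \<le> m (c * k)"
begin

abbreviation "M \<equiv> M_alg s m b"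

lemma b_Omega: "b i \<in> Omega s"
  using chain unfolding divisor_chain_def by blast

lemma b_pos: "b i > 0"
  using Omega_pos[OF b_Omega] .

lemma m_step: "m (b i) * (b (Suc i) div b i) \<le> m (b (Suc i))"
proof -
  have dvd: "b i dvd b (Suc i)" using chain unfolding divisor_chain_def by blast
  then obtain k where k: "b (Suc i) = b i * k" by (rule dvdE)
  then have "k > 0" using b_pos[of "Suc i"] by (auto intro: gr0I)
  then show ?thesis using growth[OF b_pos[of i], of k] k b_pos[of i] by simp
qed

abbreviation "ratio i \<equiv> real (m (b i)) / real (b i)"

lemma M_tensor:
  "atomic_tensor (St (m (b i))) {..<m (b i)} (\<lambda>x. {i. x i = 1}) (1 / real (max 1 (m (b i))))
     (H_unital (steinitz_div s (b i)))"
  by (rule atomic_tensorI[OF atomic_St measure_algebra_H_unital])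

lemma measure_algebra_M: "measure_algebra (M i)"
  unfolding M_alg_def by (rule atomic_tensor.measure_algebra_tensor[OF M_tensor])

lemma charted_M:
  "charted (M i) {(card K * n, 1 / real (max 1 (m (b i))) * c) | K n c. finite K \<and> K \<subseteq> {..<m (b i)} \<and>
     (n, c) \<in> {(d, 1 / real d) | d. d \<in> Omega (steinitz_div s (b i))}}"
  unfolding M_alg_def by (rule atomic_tensor.charted_tensor[OF M_tensor charted_H_unital])

lemma countable_M: "countable (carrier (M i))"
  unfolding M_alg_def by (rule countable_tensor[OF countable_St countable_H_unital])

text \<open>
  Over the common denominator \<open>b i * d\<close>, where \<open>d\<close> divides \<open>s / b i\<close>, both sides consist of the fractions
  with numerator at most \<open>m (b i) * d\<close>. For \<open>m (b i) = 0\<close> both sides are \<open>{0}\<close>.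
\<close>

lemma values_M: "(*) (ratio i) ` values (M i) = fractions s \<inter> {..ratio i}"
proof -
  note vals = atomic_tensor.values_tensor[OF M_tensor charted_H_unital, folded M_alg_def, of _ i]
  show ?thesis
  proof (intro equalityI subsetI)
    fix q assume "q \<in> (*) (ratio i) ` values (M i)"
    then obtain v where v: "q = ratio i * v" "v \<in> values (M i)" by (rule imageE)
    obtain K d k where K: "K \<subseteq> {..<m (b i)}" and d: "d \<in> Omega (steinitz_div s (b i))"
      and k: "k \<le> card K * d" and "v = 1 / real (max 1 (m (b i))) * (1 / real d) * real k"
      using v(2)[unfolded vals] by blast
    then have q: "q = ratio i * (1 / real (max 1 (m (b i))) * (1 / real d) * real k)"
      using v(1) by simp
    have dO: "d * b i \<in> Omega s" and dpos: "d > 0"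
      using d Omega_steinitz_div[OF b_Omega] Omega_pos by auto
    have "card K \<le> m (b i)" using K by (metis card_lessThan card_mono finite_lessThan)
    then have km: "k \<le> m (b i) * d" using k by (meson le_trans mult_le_mono1)
    show "q \<in> fractions s \<inter> {..ratio i}"
    proof (cases "m (b i) = 0")
      case True
      then show ?thesis using q fractionsI[OF one_Omega, of 0 s] by simp
    next
      case False
      then have "max 1 (m (b i)) = m (b i)" by simp
      then have q': "q = real k / real (d * b i)"
        unfolding q using False by (simp add: field_simps)
      have "real k \<le> real (m (b i)) * real d" using km by (metis of_nat_le_iff of_nat_mult)
      then have "q \<le> ratio i" unfolding q' using dpos b_pos[of i] by (simp add: field_simps)
      then show ?thesis using fractionsI[OF dO, of k] q' by simp
    qed
  next
    fix q assume q: "q \<in> fractions s \<inter> {..ratio i}"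
    obtain k B where B: "B \<in> Omega s" "b i dvd B" "q = real k / real B"
      using fractions_denominator[of q s "b i"] q b_Omega by blast
    obtain d where d: "B = b i * d" using B(2) by (rule dvdE)
    have dO: "d \<in> Omega (steinitz_div s (b i))"
      using B(1) d Omega_steinitz_div[OF b_Omega] by (simp add: mult.commute)
    then have dpos: "d > 0" by (rule Omega_pos)
    have "real k \<le> real (m (b i)) * real d"
      using q dpos b_pos[of i] unfolding B(3) d by (simp add: field_simps)
    then have k: "k \<le> card {..<m (b i)} * d" by (simp flip: of_nat_mult)
    have "q = ratio i * (1 / real (max 1 (m (b i))) * (1 / real d) * real k)"
    proof (cases "m (b i) = 0")
      case True
      then have "k = 0" using k by simp
      then show ?thesis using B(3) by simp
    next
      case False
      then have "max 1 (m (b i)) = m (b i)" by simp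
      then show ?thesis unfolding B(3) d using False by (simp add: field_simps)
    qed
    moreover have "(d, 1 / real d) \<in> {(d, 1 / real d) | d. d \<in> Omega (steinitz_div s (b i))}"
      using dO by blast
    then have "1 / real (max 1 (m (b i))) * (1 / real d) * real k \<in> values (M i)"
      unfolding vals using k finite_lessThan subset_refl by blast
    ultimately show "q \<in> (*) (ratio i) ` values (M i)" by blast
  qed
qed

lemma ratio_pos: "m (b i) > 0 \<Longrightarrow> ratio i > 0"
  using b_pos by simp

lemma values_M_pos:
  assumes "m (b i) > 0"
  shows "values (M i) = (*) (1 / ratio i) ` (fractions s \<inter> {..ratio i})"
proof -
  have "1 / r * (r * v) = v" if "r > 0" for r v :: real using that by simp
  then show ?thesis unfolding values_M[symmetric] image_image by (simp only: ratio_pos[OF assms])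
qed

lemma M_zero:
  assumes "m (b i) = 0"
  shows "carrier (M i) = {bzero (M i)}"
proof -
  interpret measure_algebra "M i" by (rule measure_algebra_M)
  have "meas (M i) x = 0" if "x \<in> carrier (M i)" for x
  proof -
    have "meas (M i) x \<in> values (M i)" using that by blast
    then show ?thesis unfolding values_charted[OF charted_M] using assms by auto
  qed
  then show ?thesis using meas_eq_zero by auto
qed

abbreviation "e i \<equiv> M_idem s m b i"

lemma e_carrier: "e i \<in> carrier (M (Suc i))"
  and e_meas: "meas (M (Suc i)) (e i) = real (m (b i) * (b (Suc i) div b i)) / real (m (b (Suc i)))"
proof -
  let ?k = "m (b i) * (b (Suc i) div b i)"
  let ?N = "H_unital (steinitz_div s (b (Suc i)))"
  have x: "(\<lambda>j. if j < ?k then 1 else 0) = ind {..<?k}" by (auto simp: ind_def)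
  have car: "ind {..<?k} \<in> carrier (St (m (b (Suc i))))" using m_step by simp
  have e: "e i = pure_tensor (St (m (b (Suc i)))) ?N (ind {..<?k}) (unit_of ?N)"
    by (simp add: M_idem_def Let_def x)
  show "e i \<in> carrier (M (Suc i))"
    unfolding e M_alg_def by (rule atomic_tensor.pure_tensor(1)[OF M_tensor car unit_H_unital(1)])
  show "meas (M (Suc i)) (e i) = real ?k / real (m (b (Suc i)))"
    unfolding e M_alg_def atomic_tensor.pure_tensor(2)[OF M_tensor car unit_H_unital(1)]
    by (simp add: meas_St[OF car] unit_H_unital(2))
qed

lemma e_scaled: "ratio (Suc i) * meas (M (Suc i)) (e i) = ratio i"
proof -
  have dvd: "b i dvd b (Suc i)" using chain unfolding divisor_chain_def by blast
  then have eq: "real (b (Suc i) div b i) = real (b (Suc i)) / real (b i)" by (rule real_of_nat_div)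
  show ?thesis
  proof (cases "m (b (Suc i)) = 0")
    case True
    then have "m (b i) * (b (Suc i) div b i) = 0" using m_step[of i] by simp
    moreover have "b (Suc i) div b i \<noteq> 0" using dvd b_pos[of "Suc i"] b_pos[of i] 
      by (metis div_greater_zero_iff dvd_imp_le not_gr_zero)
    ultimately have "m (b i) = 0" by simp
    then show ?thesis using True by simp
  next
    case False
    then show ?thesis
      using b_pos[of "Suc i"] b_pos[of i] by (simp add: e_meas eq field_simps)
  qed
qed

abbreviation "corner_e i \<equiv> corner (M (Suc i)) (e i)"

text \<open>
  The corner consists of the elements of the next stage below \<open>e i\<close>, so its values are those up to the
  measure of \<open>e i\<close>. Up to a scalar these are the values of \<open>M i\<close>, and algebras with proportional values
  are scalar equivalent.
\<close>

lemma M_iso_corner: "\<exists>g. scalar_iso (M i) (corner_e i) g"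
proof -
  note cor = measure_algebra_corner[OF measure_algebra_M e_carrier]
  obtain \<Delta> where \<Delta>: "charted (corner_e i) \<Delta>"
    using charted_corner[OF measure_algebra_M e_carrier charted_M] by blast
  note vc = values_corner[OF measure_algebra_M e_carrier charted_M, of i]
  have "\<exists>\<alpha>>0. values (corner_e i) = (*) \<alpha> ` values (M i)"
  proof (cases "m (b i) = 0")
    case True
    interpret C: measure_algebra "corner_e i" by (rule cor)
    interpret Mi: measure_algebra "M i" by (rule measure_algebra_M)
    have "meas (M (Suc i)) (e i) = 0" using e_meas True by simp
    then have "values (corner_e i) \<subseteq> {..0}" using vc by auto
    moreover have "0 \<le> v" if "v \<in> values (corner_e i)" for v
      using that C.meas_nonneg by auto
    moreover have "0 \<in> values (corner_e i)"
      by (rule image_eqI[of _ _ "bzero (corner_e i)"]) (simp_all only: C.meas_zero C.add.one_closed)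
    ultimately have "values (corner_e i) = {0}" by force
    moreover have "values (M i) = {0}" using M_zero[OF True] by simp
    ultimately show ?thesis by (intro exI[of _ 1]) simp
  next
    case False
    then have pos: "m (b i) > 0" by simp
    have r: "ratio (Suc i) * meas (M (Suc i)) (e i) = ratio i" by (rule e_scaled)
    have "ratio i > 0" using ratio_pos[OF pos] .
    then have "ratio (Suc i) \<noteq> 0" using r by (intro notI) (simp only: mult_zero_left less_irrefl)
    moreover have "ratio (Suc i) \<ge> 0" by (intro divide_nonneg_nonneg) simp_all
    ultimately have pos': "ratio (Suc i) > 0" and nz: "ratio (Suc i) \<noteq> 0" by linarith+
    have m_pos: "m (b (Suc i)) > 0" using nz by (intro gr0I notI) simp
    have "ratio i \<le> ratio (Suc i)"
    proof -
      have "meas (M (Suc i)) (e i) \<le> 1"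
        unfolding e_meas using m_step[of i] m_pos by (simp only: of_nat_le_iff divide_le_eq_1 of_nat_0_less_iff) simp
      then show ?thesis using r pos' by (metis mult.right_neutral mult_left_mono less_imp_le)
    qed
    have me: "meas (M (Suc i)) (e i) = ratio i / ratio (Suc i)"
      unfolding r[symmetric] by (rule nonzero_mult_div_cancel_left[OF nz, symmetric])
    have "values (corner_e i) = (*) (1 / ratio (Suc i)) ` (fractions s \<inter> {..ratio i})"
      unfolding vc values_M_pos[OF m_pos] me
      by (rule scaled_initial_segment[OF pos' \<open>ratio i \<le> ratio (Suc i)\<close>])
    also have "\<dots> = (*) (ratio i / ratio (Suc i)) ` values (M i)"
    proof -
      have "1 / t * (r * v) = r / t * v" for r t v :: real by simp
      then show ?thesis unfolding values_M[of i, symmetric] image_image by (simp only:)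
    qed
    finally show ?thesis
      by (intro exI[of _ "ratio i / ratio (Suc i)"] conjI divide_pos_pos[OF \<open>ratio i > 0\<close> pos'])
  qed
  then obtain \<alpha> where "\<alpha> > 0" "values (corner_e i) = (*) \<alpha> ` values (M i)" by blast
  then have "scalar_equivalent (M i) (corner_e i)"
    by (rule scalar_iso_if_same_values[OF measure_algebra_M charted_M countable_M cor \<Delta>
          countable_corner[OF measure_algebra_M e_carrier countable_M]])
  then show ?thesis unfolding scalar_equivalent_def .
qed

abbreviation "stage i \<equiv> scale_meas (ratio i) (M i)"

text \<open>
  Any identification of \<open>M i\<close> with the corner preserves the rescaled measures, since the scalar
  is determined by the largest values on either side.
\<close>

lemma identification_preserves:
  assumes g: "scalar_iso (M i) (corner_e i) g"
  shows "scaling_hom (stage i) (stage (Suc i)) 1 g"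
proof -
  interpret Mi: measure_algebra "M i" by (rule measure_algebra_M)
  obtain \<alpha> where \<alpha>: "\<alpha> > 0" "\<And>x. x \<in> carrier (M i) \<Longrightarrow> meas (M (Suc i)) (g x) = \<alpha> * meas (M i) x"
    and iso: "alg_iso (M i) (corner_e i) g"
    using g unfolding scalar_iso_def by auto
  note iso' = alg_isoD[OF iso]
  have vals: "values (corner_e i) = (*) \<alpha> ` values (M i)"
  proof -
    have "carrier (corner_e i) = g ` carrier (M i)" using bij_betw_imp_surj_on[OF iso'(1)] by simp
    then show ?thesis using \<alpha>(2) by (simp add: image_image cong: image_cong)
  qed
  have scaled: "ratio (Suc i) * (\<alpha> * meas (M i) x) = ratio i * meas (M i) x" if x: "x \<in> carrier (M i)" for x
  proof (cases "m (b i) = 0")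
    case True
    then show ?thesis using M_zero[OF True] x by simp
  next
    case False
    then have pos: "m (b i) > 0" by simp
    have rpos: "ratio i > 0" using ratio_pos[OF pos] .
    have max: "1 \<in> values (M i)" "\<And>v. v \<in> values (M i) \<Longrightarrow> v \<le> 1"
    proof -
      have "ratio i \<in> fractions s \<inter> {..ratio i}" using fractionsI[OF b_Omega] by simp
      then have "1 / ratio i * ratio i \<in> values (M i)" unfolding values_M_pos[OF pos] by blast
      moreover have "1 / r * r = 1" if "r > 0" for r :: real using that by simp
      ultimately show "1 \<in> values (M i)" by (simp only: rpos)
      fix v assume "v \<in> values (M i)"
      then have "ratio i * v \<in> (*) (ratio i) ` values (M i)" by blast
      then have "ratio i * v \<le> ratio i * 1" unfolding values_M by simp
      then show "v \<le> 1" using rpos by (simp only: mult_le_cancel_left_pos)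
    qed
    have vc: "values (corner_e i) = values (M (Suc i)) \<inter> {..meas (M (Suc i)) (e i)}"
      by (rule values_corner[OF measure_algebra_M e_carrier charted_M])
    have "\<alpha> * 1 \<in> values (corner_e i)" unfolding vals using max(1) by blast
    then have "\<alpha> \<le> meas (M (Suc i)) (e i)" unfolding vc by simp
    moreover have "meas (M (Suc i)) (e i) \<in> values (corner_e i)" unfolding vc using e_carrier by simp
    then obtain v where "v \<in> values (M i)" "meas (M (Suc i)) (e i) = \<alpha> * v" unfolding vals by blast
    then have "meas (M (Suc i)) (e i) \<le> \<alpha>" using max(2)[of v] \<alpha>(1) mult_left_mono[of v 1 \<alpha>] by simp
    ultimately have "\<alpha> = meas (M (Suc i)) (e i)" by simp
    then have "ratio (Suc i) * \<alpha> = ratio i" using e_scaled by simp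
    then show ?thesis by (metis mult.assoc)
  qed
  show ?thesis
    unfolding scaling_hom_def
  proof (intro conjI ballI)
    fix x assume x: "x \<in> carrier (stage i)"
    then have x': "x \<in> carrier (M i)" by simp
    show "g x \<in> carrier (stage (Suc i))"
      using iso'(2)[OF x'] corner_carrier[OF measure_algebra_M e_carrier] by simp
    show "meas (stage (Suc i)) (g x) = 1 * meas (stage i) x"
      using scaled[OF x'] \<alpha>(2)[OF x'] by simp
    fix y assume "y \<in> carrier (stage i)"
    then show "g (badd (stage i) x y) = badd (stage (Suc i)) (g x) (g y)"
      "g (bmul (stage i) x y) = bmul (stage (Suc i)) (g x) (g y)"
      using iso'(3,4)[OF x', of y] by simp_all
  qed
qed

lemma limit_system:
  assumes f: "\<And>i. scalar_iso (M i) (corner_e i) (f i)"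
  shows "directed_system UNIV stage (\<lambda>i j. fold f [i..<j])"
proof (rule directed_system.intro)
  show "measure_algebra (stage i)" for i
    using ratio_pos[of i] M_zero[of i] by (intro measure_algebra_scale[OF measure_algebra_M]) auto
  show "scaling_hom (stage i) (stage j) 1 (fold f [i..<j])" if "i \<le> j" for i j
    using that
  proof (induction j rule: dec_induct)
    case base
    show ?case by (simp add: scaling_hom_def)
  next
    case (step j)
    then show ?case
      using scaling_hom_comp[OF step.IH identification_preserves[OF f]] by (simp add: comp_def)
  qed
  show "fold f [j..<k] (fold f [i..<j] x) = fold f [i..<k] x" if "i \<le> j" "j \<le> k" for i j k x
  proof -
    have "[i..<k] = [i..<j] @ [j..<k]" using that by (metis le_add_diff_inverse upt_add_eq_append)
    then show ?thesis by simp
  qed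
  show "\<exists>k\<in>UNIV. i \<le> k \<and> j \<le> k" for i j :: nat by (rule bexI[of _ "max i j"]) auto
qed simp

lemma limit_algebra:
  assumes f: "\<And>i. scalar_iso (M i) (corner_e i) (f i)"
  defines "L \<equiv> dir_lim UNIV stage (\<lambda>i j. fold f [i..<j])"
  shows "measure_algebra L" "\<exists>\<Gamma>. charted L \<Gamma>" "countable (carrier L)"
    "values L = (\<Union>i. fractions s \<inter> {..ratio i})"
proof -
  interpret directed_system UNIV stage "\<lambda>i j. fold f [i..<j]" by (rule limit_system[OF f])
  show "measure_algebra L" unfolding L_def by (rule measure_algebra_lim)
  have "\<exists>\<Gamma>. charted (stage i) \<Gamma>" for i
    using ratio_pos[of i] M_zero[of i] by (intro charted_scale[OF measure_algebra_M charted_M]) auto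
  then obtain \<Gamma> where "\<And>i. charted (stage i) (\<Gamma> i)" by metis
  then show "\<exists>\<Gamma>. charted L \<Gamma>" unfolding L_def using charted_lim[of \<Gamma>] by blast
  show "countable (carrier L)" unfolding L_def by (rule countable_lim) (simp_all add: countable_M)
  show "values L = (\<Union>i. fractions s \<inter> {..ratio i})"
    unfolding L_def values_lim values_scale values_M ..
qed

end

lemma H_limit:
  assumes "\<And>c k. c > 0 \<Longrightarrow> k > 0 \<Longrightarrow> m c * k \<le> m (c * k)"
  obtains b \<Gamma> where "divisor_chain s b" "measure_algebra (H_limit m s)" "charted (H_limit m s) \<Gamma>"
    "countable (carrier (H_limit m s))"
    "values (H_limit m s) = (\<Union>i. fractions s \<inter> {..real (m (b i)) / real (b i)})"
proof -
  define b where "b = (SOME b. divisor_chain s b)"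
  have b: "divisor_chain s b" unfolding b_def using divisor_chain_exists by (rule someI_ex)
  interpret limit_data m s b by unfold_locales (use b assms in auto)
  define f where "f i = (SOME g. scalar_iso (M i) (corner_e i) g)" for i
  have f: "scalar_iso (M i) (corner_e i) (f i)" for i
    unfolding f_def using M_iso_corner by (rule someI_ex)
  have eq: "H_limit m s = dir_lim UNIV stage (\<lambda>i j. fold f [i..<j])"
    unfolding H_limit_def b_def[symmetric] Let_def f_def ..
  show ?thesis
    using limit_algebra[OF f] b that unfolding eq by blast
qed

text \<open>
  A fraction has a denominator \<open>b i\<close> for some \<open>i\<close>, because the chain is cofinal among the divisors of \<open>s\<close>;
  it lies in \<open>S\<close> just if its numerator over \<open>b i\<close> is at most \<open>m (b i)\<close>.
\<close>

lemma fractions_bounded: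
  assumes b: "divisor_chain s b"
    and m: "\<And>k c. c > 0 \<Longrightarrow> k \<le> m c \<longleftrightarrow> real k / real c \<in> S"
    and down: "\<And>x y. x \<in> S \<Longrightarrow> 0 \<le> y \<Longrightarrow> y \<le> x \<Longrightarrow> y \<in> S"
  shows "(\<Union>i. fractions s \<inter> {..real (m (b i)) / real (b i)}) = fractions s \<inter> S"
proof (intro equalityI subsetI)
  have pos: "b i > 0" for i
    using b Omega_pos unfolding divisor_chain_def by blast
  fix q assume "q \<in> (\<Union>i. fractions s \<inter> {..real (m (b i)) / real (b i)})"
  then obtain i where q: "q \<in> fractions s" "q \<le> real (m (b i)) / real (b i)" by blast
  have "0 \<le> q" using q(1) unfolding fractions_def by auto
  moreover have "real (m (b i)) / real (b i) \<in> S" using m[OF pos] by blast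
  ultimately show "q \<in> fractions s \<inter> S" using down q by blast
next
  have pos: "b i > 0" for i
    using b Omega_pos unfolding divisor_chain_def by blast
  fix q assume q: "q \<in> fractions s \<inter> S"
  then obtain k c where c: "c \<in> Omega s" "q = real k / real c" unfolding fractions_def by blast
  obtain i where "c dvd b i" using divisor_chain_cofinal[OF b c(1)] by blast
  then obtain d where d: "b i = c * d" by (rule dvdE)
  then have "d > 0" using pos[of i] by (auto intro: gr0I)
  then have q': "q = real (k * d) / real (b i)" unfolding c(2) d by simp
  then have "k * d \<le> m (b i)" using m[OF pos] q by auto
  then have "q \<le> real (m (b i)) / real (b i)"
    unfolding q' by (intro divide_right_mono) (simp_all flip: of_nat_mult)
  then show "q \<in> (\<Union>i. fractions s \<inter> {..real (m (b i)) / real (b i)})" using q by blast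
qed

text \<open>Both choices of \<open>m\<close> count the multiples of \<open>1 / c\<close> in an initial segment bounded by \<open>r\<close>.\<close>

lemma le_nat_floor_ratio_iff:
  assumes "r \<ge> 1" "c > 0"
  shows "k \<le> nat \<lfloor>r * real c\<rfloor> \<longleftrightarrow> real k / real c \<in> {..r}"
  using assms by (simp add: le_nat_iff le_floor_iff pos_divide_le_eq)

lemma le_nat_floor_pred_ratio_iff:
  assumes "r \<ge> 1" "c > 0"
  shows "k \<le> (if r * real c \<in> \<nat> then nat \<lfloor>r * real c\<rfloor> - 1 else nat \<lfloor>r * real c\<rfloor>) \<longleftrightarrow>
    real k / real c \<in> {..<r}"
proof -
  have rhs: "real k / real c \<in> {..<r} \<longleftrightarrow> real k < r * real c"
    using assms(2) by (simp add: pos_divide_less_eq)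
  show ?thesis
  proof (cases "r * real c \<in> \<nat>")
    case True
    then obtain n where n: "r * real c = real n" by (auto elim: Nats_cases)
    have "0 < r * real c" using assms by simp
    then have "n > 0" using n by simp
    then show ?thesis unfolding rhs using True n by auto
  next
    case False
    have "real k \<noteq> r * real c" using False by (metis of_nat_in_Nats)
    then have "real k < r * real c \<longleftrightarrow> real k \<le> r * real c" by linarith
    also have "\<dots> \<longleftrightarrow> k \<le> nat \<lfloor>r * real c\<rfloor>"
      using le_nat_floor_ratio_iff[OF assms, of k] assms(2) by (simp add: pos_divide_le_eq)
    finally show ?thesis unfolding rhs using False by simp
  qed
qed

lemma H_limit_initial_segment:
  assumes m: "\<And>k c. c > 0 \<Longrightarrow> k \<le> m c \<longleftrightarrow> real k / real c \<in> S"
    and down: "\<And>x y. x \<in> S \<Longrightarrow> 0 \<le> y \<Longrightarrow> y \<le> x \<Longrightarrow> y \<in> S"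
  obtains \<Gamma> where "measure_algebra (H_limit m s)" "charted (H_limit m s) \<Gamma>"
    "countable (carrier (H_limit m s))" "values (H_limit m s) = fractions s \<inter> S"
proof -
  have "m c * k \<le> m (c * k)" if "c > 0" "k > 0" for c k
  proof -
    have "real (m c * k) / real (c * k) = real (m c) / real c" using that by simp
    moreover have "real (m c) / real c \<in> S" using m[OF that(1), of "m c"] by simp
    ultimately show ?thesis using m[of "c * k" "m c * k"] that by simp
  qed
  then obtain b \<Gamma> where b: "divisor_chain s b" "measure_algebra (H_limit m s)" "charted (H_limit m s) \<Gamma>"
    "countable (carrier (H_limit m s))"
    "values (H_limit m s) = (\<Union>i. fractions s \<inter> {..real (m (b i)) / real (b i)})"
    by (rule H_limit)
  show ?thesis
    by (rule that[OF b(2-4)]) (simp only: b(5) fractions_bounded[OF b(1) m down])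
qed

section \<open>The classification\<close>

text \<open>
  A scalar equivalence of a subalgebra with \<open>St n\<close> is, inverted, a chart with \<open>n\<close> points.
\<close>

lemma locally_standard_charted:
  assumes H: "measure_algebra H" and ls: "locally_standard H"
  shows "charted H {(n, c). \<exists>\<psi>. chart H {..<n} c \<psi>}"
    and "\<exists>h\<in>carrier H. h \<noteq> bzero H"
proof -
  interpret H: measure_algebra H by fact
  have ex: "\<exists>n c \<psi>. n \<ge> 1 \<and> chart H {..<n::nat} c \<psi> \<and> F \<subseteq> \<psi> ` Pow {..<n}"
    if F: "finite F" "F \<subseteq> carrier H" for F
  proof -
    obtain S n \<phi> where S: "subalgebra S H" "F \<subseteq> S" and n: "n \<ge> 1"
      and \<phi>: "scalar_iso (H\<lparr>carrier := S\<rparr>) (St n) \<phi>"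
      using ls[unfolded locally_standard_def scalar_equivalent_def, rule_format, OF conjI[OF F]]
      by (elim exE conjE)
    obtain \<alpha> where iso: "alg_iso (H\<lparr>carrier := S\<rparr>) (St n) \<phi>" and \<alpha>: "\<alpha> > 0"
      "\<And>a. a \<in> S \<Longrightarrow> meas (St n) (\<phi> a) = \<alpha> * meas H a"
      using \<phi> unfolding scalar_iso_def by auto
    note iso' = alg_isoD[OF iso, simplified]
    have bij: "bij_betw \<phi> S (carrier (St n))" by (rule iso'(1))
    define \<psi> where "\<psi> X = inv_into S \<phi> (ind X)" for X
    have \<psi>: "\<psi> X \<in> S" "\<phi> (\<psi> X) = ind X" if "X \<subseteq> {..<n}" for X
    proof -
      have "ind X \<in> \<phi> ` S" using that bij by (simp add: bij_betw_def)
      then show "\<psi> X \<in> S" "\<phi> (\<psi> X) = ind X"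
        unfolding \<psi>_def by (rule inv_into_into, rule f_inv_into_f)
    qed
    have Scar: "S \<subseteq> carrier H" and Sclosed: "\<And>x y. x \<in> S \<Longrightarrow> y \<in> S \<Longrightarrow> badd H x y \<in> S \<and> bmul H x y \<in> S"
      using S(1) unfolding subalgebra_def by blast+
    have "chart H {..<n} (1 / (\<alpha> * real n)) \<psi>"
      unfolding chart_def
    proof (intro conjI allI impI)
      show "0 < 1 / (\<alpha> * real n)" using \<alpha>(1) n by simp
      fix X assume X: "X \<subseteq> {..<n}"
      show "\<psi> X \<in> carrier H" using \<psi>(1)[OF X] Scar by blast
      have "\<alpha> * meas H (\<psi> X) = real (card X) / real n"
        using \<alpha>(2)[OF \<psi>(1)[OF X]] \<psi>(2)[OF X] X by (simp add: meas_St)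
      then show "meas H (\<psi> X) = 1 / (\<alpha> * real n) * real (card X)"
        using \<alpha>(1) n by (simp add: field_simps)
      fix Y assume Y: "Y \<subseteq> {..<n}"
      have sub: "sym_diff X Y \<subseteq> {..<n}" "X \<inter> Y \<subseteq> {..<n}" using X Y by auto
      note XY = \<psi>(1)[OF X] \<psi>(1)[OF Y]
      have "\<phi> (badd H (\<psi> X) (\<psi> Y)) = \<phi> (\<psi> (sym_diff X Y))"
        using iso'(3)[OF XY] \<psi>(2)[OF X] \<psi>(2)[OF Y] \<psi>(2)[OF sub(1)] badd_St_ind by simp
      then show "badd H (\<psi> X) (\<psi> Y) = \<psi> (sym_diff X Y)"
        using iso'(5)[of "badd H (\<psi> X) (\<psi> Y)"] Sclosed[OF XY] \<psi>(1)[OF sub(1)] by blast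
      have "bmul (St n) (ind X) (ind Y) = ind (X \<inter> Y)" by (auto simp: St_def ind_def fun_eq_iff)
      then have "\<phi> (bmul H (\<psi> X) (\<psi> Y)) = \<phi> (\<psi> (X \<inter> Y))"
        using iso'(4)[OF XY] \<psi>(2)[OF X] \<psi>(2)[OF Y] \<psi>(2)[OF sub(2)] by simp
      then show "bmul H (\<psi> X) (\<psi> Y) = \<psi> (X \<inter> Y)"
        using iso'(5)[of "bmul H (\<psi> X) (\<psi> Y)"] Sclosed[OF XY] \<psi>(1)[OF sub(2)] by blast
    qed
    moreover have "F \<subseteq> \<psi> ` Pow {..<n}"
    proof
      fix x assume "x \<in> F"
      then have x: "x \<in> S" using S(2) by blast
      then have "\<phi> x \<in> carrier (St n)" by (rule iso'(2))
      then have sub: "{j. \<phi> x j = 1} \<subseteq> {..<n}" by (rule St_support)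
      have "\<phi> (\<psi> {j. \<phi> x j = 1}) = \<phi> x" using \<psi>(2)[OF sub] St_eq_ind[of "\<phi> x", symmetric] by (rule trans)
      then have "x = \<psi> {j. \<phi> x j = 1}" using iso'(5)[OF \<psi>(1)[OF sub] x] by simp
      then show "x \<in> \<psi> ` Pow {..<n}" using sub by (intro image_eqI) auto
    qed
    ultimately show ?thesis using n by blast
  qed
  show "charted H {(n, c). \<exists>\<psi>. chart H {..<n} c \<psi>}"
  proof (rule charted_UNIV)
    fix F assume "finite F" "F \<subseteq> carrier H"
    from ex[OF this] show "\<exists>n c \<psi>. chart H {..<n::nat} c \<psi> \<and> F \<subseteq> \<psi> ` Pow {..<n}" by blast
  qed
  obtain n c \<psi> where \<psi>: "n \<ge> 1" "chart H {..<n::nat} c \<psi>" using ex[of "{}"] by blast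
  then have "{..<1} \<subseteq> {..<n}" by simp
  then have "\<psi> {..<1} \<in> carrier H" "meas H (\<psi> {..<1}) > 0"
    using chartD(1-3)[OF \<psi>(2)] by auto
  then show "\<exists>h\<in>carrier H. h \<noteq> bzero H" by (intro bexI[of _ "\<psi> {..<1}"]) auto
qed

theorem theorem1:
  fixes H :: "'a meas_alg"
  assumes "measure_algebra H"
    and "countable (carrier H)"
    and "locally_standard H"
  shows "(\<exists>n\<ge>1. scalar_equivalent H (St n)) \<or>
         (\<exists>s. scalar_equivalent H (tensor H_infinity (H_unital s))) \<or>
         (\<exists>r s. 1 \<le> r \<and> infinite_steinitz s \<and> scalar_equivalent H (H_rs r s)) \<or>
         (\<exists>r s. 1 \<le> r \<and> infinite_steinitz s \<and> scalar_equivalent H (H_plus_rs r s))"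
proof -
  note ch = locally_standard_charted(1)[OF assms(1,3)]
  note equiv = scalar_iso_if_same_values[OF assms(1) ch assms(2)]
  obtain h where h: "h \<in> carrier H" "h \<noteq> bzero H"
    using locally_standard_charted(2)[OF assms(1,3)] by blast
  show ?thesis
  proof (cases rule: values_cases[OF assms(1) ch h])
    case (1 n \<alpha>)
    have "scalar_equivalent H (St n)"
      by (rule equiv[OF measure_algebra_St charted_St[OF 1(1)] countable_St 1(2)])
        (simp only: values_St[OF 1(1)] 1(3))
    then show ?thesis using 1(1) by blast
  next
    case (2 s \<alpha>)
    interpret T: atomic_tensor H_infinity UNIV id 1 "H_unital s"
      by (rule atomic_tensorI[OF atomic_H_infinity measure_algebra_H_unital])
    have "countable (carrier H_infinity)"
      using countable_Collect_finite by (simp add: H_infinity_def)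
    then have "scalar_equivalent H (tensor H_infinity (H_unital s))"
      by (intro equiv[OF T.measure_algebra_tensor T.charted_tensor[OF charted_H_unital] _ 2(1)]
          countable_tensor countable_H_unital) (simp_all only: values_tensor_H_infinity 2(2))
    then show ?thesis by blast
  next
    case (3 r s \<alpha>)
    obtain \<Gamma> where K: "measure_algebra (H_rs r s)" "charted (H_rs r s) \<Gamma>"
      "countable (carrier (H_rs r s))" "values (H_rs r s) = fractions s \<inter> {..r}"
      unfolding H_rs_def
      by (rule H_limit_initial_segment[where m = "\<lambda>b. nat \<lfloor>r * real b\<rfloor>" and S = "{..r}" and s = s])
        (use le_nat_floor_ratio_iff[OF 3(1)] in auto)
    have "scalar_equivalent H (H_rs r s)"
      by (rule equiv[OF K(1-3) 3(3)]) (simp only: K(4) 3(4))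
    then show ?thesis using 3(1,2) by blast
  next
    case (4 r s \<alpha>)
    obtain \<Gamma> where K: "measure_algebra (H_plus_rs r s)" "charted (H_plus_rs r s) \<Gamma>"
      "countable (carrier (H_plus_rs r s))" "values (H_plus_rs r s) = fractions s \<inter> {..<r}"
      unfolding H_plus_rs_def
      by (rule H_limit_initial_segment[where
            m = "\<lambda>b. if r * real b \<in> \<nat> then nat \<lfloor>r * real b\<rfloor> - 1 else nat \<lfloor>r * real b\<rfloor>"
            and S = "{..<r}" and s = s])
        (use le_nat_floor_pred_ratio_iff[OF 4(1)] in auto)
    have "scalar_equivalent H (H_plus_rs r s)"
      by (rule equiv[OF K(1-3) 4(3)]) (simp only: K(4) 4(4))
    then show ?thesis using 4(1,2) by blast
  qed
qed

end
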